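(* Let $p>1$, $\beta>0$, $\gamma\in[0,1]$ and $s\in(0,1]$ (with $s\in(0,1)$ if $\gamma\in[0,1)$, and $s=1$ if $\gamma=1$) be such that $1/p<s<N/p$. Let $\alpha>-sp$ and $p<q<p^{*}_{\gamma,s,\alpha}$, and assume moreover that $$\alpha-\beta+(q-p)\left(\frac{1-N}{p}\right)<0.$$ Then for any radial weak solution $u\in\mathcal{W}^{s,p}_\beta(\mathbb{R}^N)$ of the problem $$\mathcal{L}_{s,p,\gamma}\,u+|x|^\beta|u|^{p-2}u=|x|^\alpha|u|^{q-2}u\ \text{ in }\mathbb{R}^N,\qquad u>0,$$ there is a constant $C>0$ such that $$\|u\|_{L^\infty(\mathbb{R}^N)}\le C.$$
   Context: Weighted Lebesgue norms: $\|u\|_{p,\beta}=\left(\int_{\mathbb{R}^N}|x|^\beta|u|^p\,dx\right)^{1/p}$, and $L^p_\beta(\mathbb{R}^N)$ is the space of functions with $\|u\|_{p,\beta}<\infty$. Seminorms: for $s\in(0,1)$, $[u]_{s,p}=\left(\int_{\mathbb{R}^N}\int_{\mathbb{R}^N}\frac{|u(x)-u(y)|^p}{|x-y|^{N+sp}}\,dx\,dy\right)^{1/p}$; for $s=1$, $[u]_{1,p}=\left(\int_{\mathbb{R}^N}|\nabla u|^p\,dx\right)^{1/p}$. Set $W^{s,p}_\beta(\mathbb{R}^N)=\{u\in L^p_\beta(\mathbb{R}^N):[u]_{s,p}<\infty\}$ with norm $\|u\|_{s,p,\beta}=\|u\|_{p,\beta}+[u]_{s,p}$, and let $W^{s,p}_{rad,\beta}(\mathbb{R}^N)$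 be its subset of radial functions. The solution space is $\mathcal{W}^{s,p}_\beta(\mathbb{R}^N)=W^{s,p}_{rad,\beta}(\mathbb{R}^N)$ if $\gamma=0$ (with norm $\|\cdot\|_{s,p,\beta}$), and $\mathcal{W}^{s,p}_\beta(\mathbb{R}^N)=W^{1,p}_{rad,\beta}(\mathbb{R}^N)$ if $\gamma\in(0,1]$ (with norm $\|\cdot\|_{1,p,\beta}$). The operator is $\mathcal{L}_{s,p,\gamma}u=\gamma(-\Delta_p)u+(1-\gamma)(-\Delta_p)^s u$, where $-\Delta_p u=-\mathrm{div}(|\nabla u|^{p-2}\nabla u)$ and, for $s\in(0,1)$, $(-\Delta_p)^s u(x)=\text{p.v.}\int_{\mathbb{R}^N}\frac{|u(x)-u(y)|^{p-2}(u(x)-u(y))}{|x-y|^{N+sp}}\,dy$. The case $\gamma=1$ is the purely local operator $-\Delta_p$ and is identified with $s=1$; when $\gamma=0$ or $\gamma\in(0,1)$ one takes $s\in(0,1)$. With $\Phi_r(t)=|t|^{r-2}t$ (for scalars and vectors), its weak form is $$\langle\mathcal{L}_{s,p,\gamma}u,v\rangle=\gamma\int_{\mathbb{R}^N}\Phi_p(\nabla u)\cdot\nabla v\,dx+(1-\gamma)\int_{\mathbb{R}^N}\int_{\mathbb{R}^N}\frac{\Phi_p(u(x)-u(y))(v(x)-v(y))}{|x-y|^{N+sp}}\,dx\,dy,$$ the first (second) term being absent if $\gamma=0$ ($\gamma=1$). Weak solution: $u\in\mathcal{W}^{s,p}_\beta(\mathbb{R}^N)$ (and $u>0$) such that $\langle\mathcal{L}_{s,p,\gamma}u,v\rangle+\int_{\mathbb{R}^N}|x|^\beta\Phi_p(u)v\,dx=\int_{\mathbb{R}^N}|x|^\alpha\Phi_q(u)v\,dx$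 for all $v\in\mathcal{W}^{s,p}_\beta(\mathbb{R}^N)$. Critical exponent: $p^{*}_{\gamma,s,\alpha}=\frac{p(N+\alpha)}{N-sp}$ if $\gamma=0$, and $p^{*}_{\gamma,s,\alpha}=\frac{p(N+\alpha)}{N-p}$ if $\gamma\in(0,1]$ (the latter presupposes $N>p$). *)

theory Defs
  imports "HOL-Analysis.Analysis" "HOL-Probability.Essential_Supremum"
begin

text \<open>
  Functions on \<open>\<real>\<^sup>N\<close> are Lebesgue measurable functions on \<^typ>\<open>real ^ 'n\<close>, with \<open>N = CARD('n)\<close>;
  every notion below is invariant under changes on null sets.
\<close>

subsection \<open>Weak gradients\<close>

primrec C_k :: "nat \<Rightarrow> (real ^ 'n \<Rightarrow> real) \<Rightarrow> bool" where
  "C_k 0 f \<longleftrightarrow> continuous_on UNIV f"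
| "C_k (Suc k) f \<longleftrightarrow> (\<forall>x. f differentiable at x) \<and>
     (\<forall>i. C_k k (\<lambda>x. frechet_derivative f (at x) (axis i 1)))"

text \<open>The space \<open>C\<^sub>c\<^sup>\<infinity>(\<real>\<^sup>N)\<close>.\<close>

definition test_function :: "(real ^ 'n \<Rightarrow> real) \<Rightarrow> bool" where
  "test_function \<phi> \<longleftrightarrow> (\<forall>k. C_k k \<phi>) \<and> compact (closure {x. \<phi> x \<noteq> 0})"

definition locally_integrable :: "(real ^ 'n \<Rightarrow> 'b::{banach, second_countable_topology}) \<Rightarrow> bool" where
  "locally_integrable f \<longleftrightarrow> (\<forall>K. compact K \<longrightarrow> set_integrable lebesgue K f)"

definition has_weak_gradient :: "(real ^ 'n \<Rightarrow> real) \<Rightarrow> (real ^ 'n \<Rightarrow> real ^ 'n) \<Rightarrow> bool" where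
  "has_weak_gradient u g \<longleftrightarrow> locally_integrable u \<and> locally_integrable g \<and>
     (\<forall>\<phi> i. test_function \<phi> \<longrightarrow>
        (LINT x|lebesgue. u x * frechet_derivative \<phi> (at x) (axis i 1))
        = - (LINT x|lebesgue. g x $ i * \<phi> x))"

text \<open>
  Weak gradients are unique up to null sets, so the choice is immaterial
  (and only used for functions that have a weak gradient).
\<close>

definition weak_gradient :: "(real ^ 'n \<Rightarrow> real) \<Rightarrow> real ^ 'n \<Rightarrow> real ^ 'n" where
  "weak_gradient u = (SOME g. has_weak_gradient u g)"

subsection \<open>Function spaces\<close>

text \<open>
  The norm \<open>\<parallel>u\<parallel>\<^bsub>p,\<beta>\<^esub>\<close> and the seminorms \<open>[u]\<^bsub>s,p\<^esub>\<close>, \<open>[u]\<^bsub>1,p\<^esub>\<close> enter only through their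
  finiteness, hence they are represented by their \<open>p\<close>-th powers with values in \<^typ>\<open>ennreal\<close>.
\<close>

definition weighted_norm_pow :: "real \<Rightarrow> real \<Rightarrow> (real ^ 'n \<Rightarrow> real) \<Rightarrow> ennreal" where
  "weighted_norm_pow p \<beta> u = (\<integral>\<^sup>+x. ennreal (norm x powr \<beta> * \<bar>u x\<bar> powr p) \<partial>lebesgue)"

definition Lp_weighted :: "real \<Rightarrow> real \<Rightarrow> (real ^ 'n \<Rightarrow> real) set" where
  "Lp_weighted p \<beta> = {u \<in> borel_measurable lebesgue. weighted_norm_pow p \<beta> u < \<infinity>}"

definition gagliardo_pow :: "real \<Rightarrow> real \<Rightarrow> (real ^ 'n \<Rightarrow> real) \<Rightarrow> ennreal" where
  "gagliardo_pow s p u =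
     (\<integral>\<^sup>+(x, y). ennreal (\<bar>u x - u y\<bar> powr p / norm (x - y) powr (real CARD('n) + s * p))
        \<partial>(lebesgue :: ((real ^ 'n) \<times> (real ^ 'n)) measure))"

text \<open>The value is \<open>\<infinity>\<close> if there is no weak gradient.\<close>

definition gradient_pow :: "real \<Rightarrow> (real ^ 'n \<Rightarrow> real) \<Rightarrow> ennreal" where
  "gradient_pow p u = (if \<exists>g. has_weak_gradient u g
     then \<integral>\<^sup>+x. ennreal (norm (weak_gradient u x) powr p) \<partial>lebesgue else \<infinity>)"

definition seminorm_pow :: "real \<Rightarrow> real \<Rightarrow> (real ^ 'n \<Rightarrow> real) \<Rightarrow> ennreal" where
  "seminorm_pow s p u = (if s = 1 then gradient_pow p u else gagliardo_pow s p u)"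

definition sobolev :: "real \<Rightarrow> real \<Rightarrow> real \<Rightarrow> (real ^ 'n \<Rightarrow> real) set" where
  "sobolev s p \<beta> = {u \<in> Lp_weighted p \<beta>. seminorm_pow s p u < \<infinity>}"

text \<open>
  Radial symmetry of an equivalence class modulo null sets. The profile of a measurable radial
  function can always be chosen Borel.
\<close>

definition radial :: "(real ^ 'n \<Rightarrow> real) \<Rightarrow> bool" where
  "radial u \<longleftrightarrow> (\<exists>f \<in> borel_measurable borel. AE x in lebesgue. u x = f (norm x))"

definition sobolev_rad :: "real \<Rightarrow> real \<Rightarrow> real \<Rightarrow> (real ^ 'n \<Rightarrow> real) set" where
  "sobolev_rad s p \<beta> = {u \<in> sobolev s p \<beta>. radial u}"

definition solution_space :: "real \<Rightarrow> real \<Rightarrow> real \<Rightarrow> real \<Rightarrow> (real ^ 'n \<Rightarrow> real) set" where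
  "solution_space \<gamma> s p \<beta> = (if \<gamma> = 0 then sobolev_rad s p \<beta> else sobolev_rad 1 p \<beta>)"

subsection \<open>The equation\<close>

definition Phi :: "real \<Rightarrow> 'a::real_normed_vector \<Rightarrow> 'a" where
  "Phi r t = norm t powr (r - 2) *\<^sub>R t"

definition local_density ::
  "real \<Rightarrow> (real ^ 'n \<Rightarrow> real) \<Rightarrow> (real ^ 'n \<Rightarrow> real) \<Rightarrow> real ^ 'n \<Rightarrow> real" where
  "local_density p u v x = Phi p (weak_gradient u x) \<bullet> weak_gradient v x"

definition nonlocal_density ::
  "real \<Rightarrow> real \<Rightarrow> (real ^ 'n \<Rightarrow> real) \<Rightarrow> (real ^ 'n \<Rightarrow> real) \<Rightarrow> (real ^ 'n) \<times> (real ^ 'n) \<Rightarrow> real" where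
  "nonlocal_density s p u v = (\<lambda>(x, y).
     Phi p (u x - u y) * (v x - v y) / norm (x - y) powr (real CARD('n) + s * p))"

definition operator_form ::
  "real \<Rightarrow> real \<Rightarrow> real \<Rightarrow> (real ^ 'n \<Rightarrow> real) \<Rightarrow> (real ^ 'n \<Rightarrow> real) \<Rightarrow> real" where
  "operator_form \<gamma> s p u v =
     (if \<gamma> = 0 then 0 else \<gamma> * (LINT x|lebesgue. local_density p u v x)) +
     (if \<gamma> = 1 then 0 else (1 - \<gamma>) * (LINT z|lebesgue. nonlocal_density s p u v z))"

text \<open>
  The Bochner integral of a non-integrable function is \<open>0\<close>, so an identity between integrals is
  meaningful only together with the existence of the integrals involved.
\<close>

definition weak_identity ::
  "real \<Rightarrow> real \<Rightarrow> real \<Rightarrow> real \<Rightarrow> real \<Rightarrow> real \<Rightarrow> (real ^ 'n \<Rightarrow> real) \<Rightarrow> (real ^ 'n \<Rightarrow> real) \<Rightarrow> bool" where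
  "weak_identity \<gamma> s p q \<alpha> \<beta> u v \<longleftrightarrow>
     (\<gamma> \<noteq> 0 \<longrightarrow> integrable lebesgue (local_density p u v)) \<and>
     (\<gamma> \<noteq> 1 \<longrightarrow> integrable lebesgue (nonlocal_density s p u v)) \<and>
     integrable lebesgue (\<lambda>x. norm x powr \<beta> * Phi p (u x) * v x) \<and>
     integrable lebesgue (\<lambda>x. norm x powr \<alpha> * Phi q (u x) * v x) \<and>
     operator_form \<gamma> s p u v + (LINT x|lebesgue. norm x powr \<beta> * Phi p (u x) * v x)
       = (LINT x|lebesgue. norm x powr \<alpha> * Phi q (u x) * v x)"

definition weak_solution ::
  "real \<Rightarrow> real \<Rightarrow> real \<Rightarrow> real \<Rightarrow> real \<Rightarrow> real \<Rightarrow> (real ^ 'n \<Rightarrow> real) \<Rightarrow> bool" where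
  "weak_solution \<gamma> s p q \<alpha> \<beta> u \<longleftrightarrow>
     u \<in> solution_space \<gamma> s p \<beta> \<and> (AE x in lebesgue. u x > 0) \<and>
     (\<forall>v \<in> solution_space \<gamma> s p \<beta>. weak_identity \<gamma> s p q \<alpha> \<beta> u v)"

text \<open>For \<open>\<gamma> > 0\<close> this presupposes \<open>N > p\<close>.\<close>

definition critical_exponent :: "real \<Rightarrow> real \<Rightarrow> real \<Rightarrow> real \<Rightarrow> real \<Rightarrow> real" where
  "critical_exponent N p \<gamma> s \<alpha> =
     (if \<gamma> = 0 then p * (N + \<alpha>) / (N - s * p) else p * (N + \<alpha>) / (N - p))"

definition Linfty_norm :: "(real ^ 'n \<Rightarrow> real) \<Rightarrow> ereal" where
  "Linfty_norm u = esssup lebesgue (\<lambda>x. ereal \<bar>u x\<bar>)"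

end

theory Submission
  imports Defs
begin

text \<open>
  Let \<open>\<sigma> = s\<close> if \<open>\<gamma> = 0\<close> and \<open>\<sigma> = 1\<close> otherwise, and \<open>a = (N - \<sigma>p)/p\<close>. Two facts about a radial function \<open>w\<close>
  carry the proof.

  First, since \<open>\<sigma>p > 1\<close>, a finite seminorm controls \<open>w\<close> pointwise away from the origin:
  \<open>|w(x)| \<le> C [w] |x|\<^bsup>-a\<^esup>\<close> almost everywhere (lemma \<open>radial_pointwise_bound\<close>). Besides integrability at infinity,
  its proof uses a bound \<open>K r\<^bsup>N+\<sigma>p\<^esup>\<close> for the integral of \<open>|w(x) - w(y)|\<^sup>p\<close> over all pairs at distance
  less than \<open>r\<close>, called \<open>oscillation\<close> below. For the Gagliardo seminorm this bound is immediate, and for a gradient in \<open>L\<^sup>p\<close>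
  it follows by integrating the gradient along segments, so the local, the nonlocal and the mixed
  operator are treated at once. In the variable \<open>t = ln |x|\<close> the bound becomes an estimate of
  \<open>F(t + h) - F(t)\<close> in \<open>L\<^sup>p\<close> of unit intervals by \<open>h\<^bsup>\<sigma>\<^esup> exp(-at)\<close>. As \<open>\<sigma> > 1/p\<close>, dyadic averages then converge
  geometrically, as in the proof of Morrey's embedding, and the factor \<open>exp(-at)\<close> makes the sum over unit
  steps towards infinity converge.

  Second, testing the equation with a \<open>C\<^sup>1\<close> approximation of \<open>(u - k)\<^sup>+\<close> bounds its energy by
  \<open>X(k)\<close>, the integral of \<open>|x|\<^bsup>\<alpha>\<^esup> u\<^sup>q\<close> over \<open>{u > k}\<close>, because the term with weight \<open>|x|\<^bsup>\<beta>\<^esup>\<close> is nonnegative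
  (lemma \<open>truncation_energy\<close>). Together with the first fact, \<open>(u - k)\<^sup>+ \<le> C X(k)\<^bsup>1/p\<^esup> |x|\<^bsup>-a\<^esup>\<close>.

  This closes on itself. The first fact for \<open>u\<close> gives \<open>u \<le> C |x|\<^bsup>-a\<^esup>\<close>. For \<open>l > k\<close>, on \<open>{u > l}\<close> the second
  inequality bounds \<open>|x|\<close> and, as \<open>u \<le> l/(l - k) (u - k)\<close>, also \<open>u\<^sup>p\<close>; the factor \<open>u\<^bsup>q-p\<^esup>\<close> is
  bounded by the first. The remaining power of \<open>|x|\<close> is \<open>|x|\<^bsup>\<epsilon>-N\<^esup>\<close> with \<open>\<epsilon> = N + \<alpha> - aq\<close>, and \<open>\<epsilon> > 0\<close> says exactly
  that \<open>q\<close> is below the critical exponent. Hence \<open>X(l) \<le> C l\<^sup>p (l - k)\<^bsup>-p(1+\<delta>)\<^esup> X(k)\<^bsup>1+\<delta>\<^esup>\<close> with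
  \<open>\<delta> = \<epsilon>/(ap)\<close>, and De Giorgi's iteration (lemma \<open>bounded_of_level_set_estimate\<close>) yields \<open>X(2d) = 0\<close> for a
  large \<open>d\<close>, that is \<open>u \<le> 2d\<close>.

  For \<open>\<gamma> > 0\<close> it has to be known that a \<open>C\<^sup>1\<close> function \<open>T(u)\<close> has the weak gradient \<open>T'(u)\<nabla>u\<close>. This is proved
  by characterising weak derivatives through increments \<open>u(x + tv) - u(x)\<close> for almost every \<open>x\<close>, so that
  only a chain rule for indefinite integrals on the line remains.
\<close>

section \<open>Smooth bump functions\<close>

text \<open>
  The classical flat functions \<open>exp(-1/t)/t\<^sup>m\<close>, extended by \<open>0\<close>. Keeping all powers \<open>m\<close> makes the
  family closed, up to linear combinations, under differentiation.
\<close>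

definition flat :: "nat \<Rightarrow> real \<Rightarrow> real" where
  "flat m t = (if t > 0 then exp (- 1 / t) / t ^ m else 0)"

lemma flat_tendsto_0: "(flat m \<longlongrightarrow> 0) (at 0)"
proof -
  have "((\<lambda>t::real. (inverse t) ^ m / exp (inverse t)) \<longlongrightarrow> 0) (at_right 0)"
    by (rule filterlim_compose[OF tendsto_power_div_exp_0 filterlim_inverse_at_top_right])
  moreover have "\<forall>\<^sub>F t in at_right 0. (inverse t) ^ m / exp (inverse t) = flat m t"
    unfolding eventually_at_right_field
    by (intro exI[of _ 1]) (auto simp: flat_def field_simps exp_minus)
  ultimately have r: "(flat m \<longlongrightarrow> 0) (at_right 0)"
    by (blast intro: Lim_transform_eventually)
  have "\<forall>\<^sub>F t in at_left 0. 0 = flat m t"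
    unfolding eventually_at_left_field by (intro exI[of _ "-1"]) (auto simp: flat_def)
  then have "(flat m \<longlongrightarrow> 0) (at_left 0)"
    by (rule Lim_transform_eventually[OF tendsto_const])
  with r show ?thesis by (simp add: filterlim_split_at)
qed

lemma flat_has_derivative:
  "(flat m has_real_derivative (flat (m + 2) t - real m * flat (m + 1) t)) (at t)"
proof -
  consider "t > 0" | "t < 0" | "t = 0" by linarith
  then show ?thesis
  proof cases
    case 1
    have "((\<lambda>t. exp (- 1 / t) / t ^ m) has_real_derivative
        (flat (m + 2) t - real m * flat (m + 1) t)) (at t)"
      using 1 by (cases m) (auto intro!: derivative_eq_intros simp: flat_def field_simps power2_eq_square,
        metis power_minus_mult mult.commute One_nat_def neq0_conv)
    then show ?thesis
      by (rule has_field_derivative_transform_within_open[where S="{0<..}"])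
        (use 1 in \<open>auto simp: flat_def\<close>)
  next
    case 2
    have "((\<lambda>t. 0) has_real_derivative (flat (m + 2) t - real m * flat (m + 1) t)) (at t)"
      using 2 by (auto simp: flat_def)
    then show ?thesis
      by (rule has_field_derivative_transform_within_open[where S="{..<0}"])
        (use 2 in \<open>auto simp: flat_def\<close>)
  next
    case 3
    have "(\<lambda>y. (flat m y - flat m 0) / (y - 0)) = flat (Suc m)"
      by (auto simp: flat_def fun_eq_iff)
    then show ?thesis
      using flat_tendsto_0[of "Suc m"] 3 by (simp add: has_field_derivative_iff flat_def)
  qed
qed

lemma flat_0_bounds: "0 \<le> flat 0 t" "flat 0 t \<le> 1"
  by (auto simp: flat_def)

lemma flat_0_tendsto: "(\<lambda>n. flat 0 (real n * y)) \<longlonglongrightarrow> (if y > 0 then 1 else 0)"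
proof (cases "y > 0")
  case True
  have "(\<lambda>n. exp (- (1 / y) * (1 / real n))) \<longlonglongrightarrow> exp (- (1 / y) * 0)"
    by (intro tendsto_intros lim_1_over_n)
  moreover have "\<forall>\<^sub>F n in sequentially. exp (- (1 / y) * (1 / real n)) = flat 0 (real n * y)"
    using True by (intro eventually_sequentiallyI[of 1]) (auto simp: flat_def field_simps)
  ultimately show ?thesis
    using True by (auto intro: Lim_transform_eventually)
next
  case False
  then have "flat 0 (real n * y) = 0" for n
    by (auto simp: flat_def zero_less_mult_iff)
  then show ?thesis using False by simp
qed

text \<open>
  A class of functions that contains the bumps below and that is closed under partial derivatives by
  construction; closedness is all that the recursive definition of \<open>C_k\<close> asks for.
\<close>

inductive smooth_expr :: "(real ^ 'n \<Rightarrow> real) \<Rightarrow> bool" where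
  const: "smooth_expr (\<lambda>x. c)"
| coord: "smooth_expr (\<lambda>x. x $ i)"
| add: "smooth_expr f \<Longrightarrow> smooth_expr g \<Longrightarrow> smooth_expr (\<lambda>x. f x + g x)"
| mult: "smooth_expr f \<Longrightarrow> smooth_expr g \<Longrightarrow> smooth_expr (\<lambda>x. f x * g x)"
| flat: "smooth_expr f \<Longrightarrow> smooth_expr (\<lambda>x. flat m (f x))"

lemma smooth_expr_has_derivative:
  assumes "smooth_expr f"
  shows "\<exists>f'. (\<forall>x. (f has_derivative f' x) (at x)) \<and> (\<forall>v. smooth_expr (\<lambda>x. f' x v))"
  using assms
proof induction
  case (const c)
  show ?case
    by (intro exI[of _ "\<lambda>x v. 0"]) (auto intro: smooth_expr.const)
next
  case (coord i)
  show ?case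
    by (intro exI[of _ "\<lambda>x v. v $ i"])
      (auto intro: smooth_expr.const bounded_linear_imp_has_derivative bounded_linear_vec_nth)
next
  case (add f g)
  then obtain f' g' where "\<forall>x. (f has_derivative f' x) (at x)" "\<forall>v. smooth_expr (\<lambda>x. f' x v)"
    "\<forall>x. (g has_derivative g' x) (at x)" "\<forall>v. smooth_expr (\<lambda>x. g' x v)" by blast
  then show ?case
    by (intro exI[of _ "\<lambda>x v. f' x v + g' x v"])
      (auto intro!: smooth_expr.add has_derivative_add)
next
  case (mult f g)
  then obtain f' g' where "\<forall>x. (f has_derivative f' x) (at x)" "\<forall>v. smooth_expr (\<lambda>x. f' x v)"
    "\<forall>x. (g has_derivative g' x) (at x)" "\<forall>v. smooth_expr (\<lambda>x. g' x v)" by blast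
  then show ?case
    using mult.hyps
    by (intro exI[of _ "\<lambda>x v. f x * g' x v + f' x v * g x"])
      (auto intro!: smooth_expr.add smooth_expr.mult has_derivative_mult)
next
  case (flat f m)
  then obtain f' where f': "\<forall>x. (f has_derivative f' x) (at x)" "\<forall>v. smooth_expr (\<lambda>x. f' x v)"
    by blast
  have "((\<lambda>x. flat m (f x)) has_derivative
      (\<lambda>v. f' x v * (flat (m + 2) (f x) + (- real m) * flat (m + 1) (f x)))) (at x)" for x
    using has_derivative_compose[OF f'(1)[rule_format]
        flat_has_derivative[of m "f x", unfolded has_field_derivative_def]]
    by (simp add: mult.commute)
  moreover have "smooth_expr (\<lambda>x. f' x v * (flat (m + 2) (f x) + (- real m) * flat (m + 1) (f x)))" for v
    using f'(2) flat.hyps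
    by (intro smooth_expr.mult smooth_expr.add smooth_expr.flat smooth_expr.const) auto
  ultimately show ?case
    by (intro exI[of _ "\<lambda>x v. f' x v * (flat (m + 2) (f x) + (- real m) * flat (m + 1) (f x))"]) auto
qed

lemma smooth_expr_C_k: "smooth_expr f \<Longrightarrow> C_k k f"
proof (induction k arbitrary: f)
  case 0
  then show ?case
    using smooth_expr_has_derivative has_derivative_continuous
    by (fastforce intro: continuous_at_imp_continuous_on)
next
  case (Suc k)
  obtain f' where f': "\<forall>x. (f has_derivative f' x) (at x)" "\<forall>v. smooth_expr (\<lambda>x. f' x v)"
    using smooth_expr_has_derivative[OF Suc.prems] by blast
  then have "frechet_derivative f (at x) = f' x" for x
    using frechet_derivative_at by metis
  with f' show ?case
    by (auto simp: differentiable_def intro: Suc.IH)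
qed

lemma smooth_expr_prod:
  "finite I \<Longrightarrow> (\<And>i. i \<in> I \<Longrightarrow> smooth_expr (f i)) \<Longrightarrow> smooth_expr (\<lambda>x. \<Prod>i\<in>I. f i x)"
  by (induction I rule: finite_induct) (auto intro: smooth_expr.const smooth_expr.mult)

text \<open>
  Smooth functions with values in \<open>[0, 1]\<close>, supported in a closed box, that increase to the indicator
  of the open box as \<open>n\<close> grows.
\<close>

definition box_bump :: "nat \<Rightarrow> real ^ 'n \<Rightarrow> real ^ 'n \<Rightarrow> real ^ 'n \<Rightarrow> real" where
  "box_bump n a b x =
     (\<Prod>i\<in>UNIV. flat 0 (real n * (x $ i - a $ i)) * flat 0 (real n * (b $ i - x $ i)))"

lemma box_bump_eq_0: "x \<notin> cbox a b \<Longrightarrow> box_bump n a b x = 0"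
proof -
  assume "x \<notin> cbox a b"
  then obtain i where "x $ i < a $ i \<or> b $ i < x $ i"
    by (auto simp: mem_box_cart not_le)
  then have "flat 0 (real n * (x $ i - a $ i)) * flat 0 (real n * (b $ i - x $ i)) = 0"
    by (auto simp: flat_def zero_less_mult_iff)
  then show ?thesis
    unfolding box_bump_def by (intro prod_zero) auto
qed

lemma box_bump_bounds: "0 \<le> box_bump n a b x" "box_bump n a b x \<le> 1"
  unfolding box_bump_def
  by (auto intro!: prod_nonneg prod_le_1 mult_nonneg_nonneg mult_le_one flat_0_bounds)

lemma box_bump_test_function: "test_function (box_bump n a b)"
proof -
  have "smooth_expr (\<lambda>x. \<Prod>i\<in>UNIV. flat 0 (real n * (x $ i + - a $ i))
      * flat 0 (real n * (b $ i + (-1) * x $ i)))"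
    by (intro smooth_expr_prod smooth_expr.mult smooth_expr.flat smooth_expr.add smooth_expr.const
         smooth_expr.coord) auto
  then have "smooth_expr (box_bump n a b)"
    by (simp add: box_bump_def[abs_def])
  moreover have "closure {x. box_bump n a b x \<noteq> 0} \<subseteq> cbox a b"
    using box_bump_eq_0[of _ a b n] by (intro closure_minimal closed_cbox) blast
  then have "compact (closure {x. box_bump n a b x \<noteq> 0})"
    by (meson bounded_cbox bounded_subset closed_closure compact_eq_bounded_closed)
  ultimately show ?thesis
    by (simp add: test_function_def smooth_expr_C_k)
qed

lemma box_bump_tendsto: "(\<lambda>n. box_bump n a b x) \<longlonglongrightarrow> indicator (box a b) x"
proof -
  have "(\<lambda>n. box_bump n a b x) \<longlonglongrightarrow>
    (\<Prod>i\<in>UNIV. (if x $ i - a $ i > 0 then 1 else 0) * (if b $ i - x $ i > 0 then 1 else 0))"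
    unfolding box_bump_def by (intro tendsto_prod tendsto_mult flat_0_tendsto)
  also have "(\<Prod>i\<in>UNIV. (if x $ i - a $ i > 0 then 1 else 0) * (if b $ i - x $ i > 0 then 1 else 0))
      = (indicator (box a b) x :: real)"
    by (auto simp: indicator_def mem_box_cart)
  finally show ?thesis .
qed

section \<open>The fundamental lemma of the calculus of variations\<close>

lemma locally_integrable_measurable:
  assumes "locally_integrable f"
  shows "f \<in> borel_measurable lebesgue"
proof -
  have "(\<lambda>x. indicator (cball 0 (real n)) x *\<^sub>R f x) \<in> borel_measurable lebesgue" for n
    using assms unfolding locally_integrable_def set_integrable_def
    by (intro borel_measurable_integrable) auto
  moreover have "(\<lambda>n. indicator (cball 0 (real n)) x *\<^sub>R f x) \<longlonglongrightarrow> f x" for x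
  proof -
    obtain m where m: "norm x \<le> real m" using real_arch_simple by blast
    have "\<forall>\<^sub>F n in sequentially. f x = indicator (cball 0 (real n)) x *\<^sub>R f x"
      using m by (intro eventually_sequentiallyI[of m]) (auto simp: indicator_def)
    then show ?thesis by (rule Lim_transform_eventually[OF tendsto_const])
  qed
  ultimately show ?thesis
    by (rule borel_measurable_LIMSEQ_metric)
qed

text \<open>
  The positive and the negative part of \<open>F\<close> are densities of two measures that agree on boxes, hence
  everywhere.
\<close>

lemma AE_zero_of_box_integrals:
  fixes F :: "'a::euclidean_space \<Rightarrow> real"
  assumes [measurable]: "F \<in> borel_measurable borel"
    and int: "\<And>a b. set_integrable lborel (box a b) F"
    and zero: "\<And>a b. set_lebesgue_integral lborel (box a b) F = 0"
  shows "AE x in lborel. F x = 0"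
proof -
  let ?M = "density lborel (\<lambda>x. ennreal (F x))" and ?N = "density lborel (\<lambda>x. ennreal (- F x))"
  have em: "emeasure ?M (box a b) = emeasure ?N (box a b)" and fin: "emeasure ?M (box a b) \<noteq> \<infinity>" for a b
  proof -
    have I: "integrable lborel (\<lambda>x. F x * indicator (box a b) x)"
      using int[of a b] by (simp add: set_integrable_def mult.commute)
    have "(\<integral>\<^sup>+x. ennreal (F x) * indicator (box a b) x \<partial>lborel) = (\<integral>\<^sup>+x. ennreal (F x * indicator (box a b) x) \<partial>lborel)"
      "(\<integral>\<^sup>+x. ennreal (- F x) * indicator (box a b) x \<partial>lborel) = (\<integral>\<^sup>+x. ennreal (- (F x * indicator (box a b) x)) \<partial>lborel)"
      by (auto intro!: nn_integral_cong simp: indicator_def)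
    moreover have "(\<integral>\<^sup>+x. ennreal (F x * indicator (box a b) x) \<partial>lborel) < \<infinity>"
      "(\<integral>\<^sup>+x. ennreal (- (F x * indicator (box a b) x)) \<partial>lborel) < \<infinity>"
      using I by (auto simp: real_integrable_def top.not_eq_extremum)
    moreover have "enn2real (\<integral>\<^sup>+x. ennreal (F x * indicator (box a b) x) \<partial>lborel)
      = enn2real (\<integral>\<^sup>+x. ennreal (- (F x * indicator (box a b) x)) \<partial>lborel)"
      using zero[of a b] real_lebesgue_integral_def[OF I]
      by (simp add: set_lebesgue_integral_def mult.commute)
    moreover have "X = Y" if "X < \<infinity>" "Y < \<infinity>" "enn2real X = enn2real Y" for X Y :: ennreal
      using that by (metis ennreal_enn2real infinity_ennreal_def)
    ultimately show "emeasure ?M (box a b) = emeasure ?N (box a b)" "emeasure ?M (box a b) \<noteq> \<infinity>"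
      by (simp_all add: emeasure_density)
  qed
  have "?M = ?N"
  proof (rule measure_eqI_generator_eq[where \<Omega>=UNIV and E="range (\<lambda>(a, b). box a b)"
        and A="\<lambda>n. box (- (real n *\<^sub>R One)) (real n *\<^sub>R One)"])
    show "Int_stable (range (\<lambda>(a, b). box a b :: 'a set))"
      by (auto simp: Int_stable_def box_Int_box)
    show "\<Union> (range (\<lambda>n. box (- (real n *\<^sub>R One)) (real n *\<^sub>R One))) = (UNIV :: 'a set)"
      by (rule UN_box_eq_UNIV)
    show "emeasure ?M (box (- (real i *\<^sub>R One)) (real i *\<^sub>R One)) \<noteq> \<infinity>" for i
      by (rule fin)
  qed (auto simp: em borel_eq_box)
  then have "AE x in lborel. ennreal (F x) = ennreal (- F x)"
    by (intro sigma_finite_measure.density_unique[OF sigma_finite_lborel]) auto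
  then show ?thesis
  proof eventually_elim
    case (elim x)
    then show ?case
      by (cases "F x \<ge> 0") (auto simp: ennreal_neg ennreal_eq_0_iff not_le)
  qed
qed

text \<open>
  By dominated convergence along \<open>box_bump\<close> the integrals of \<open>F\<close> over boxes vanish.
\<close>

lemma fundamental_lemma_calculus_of_variations:
  fixes F :: "real ^ 'n \<Rightarrow> real"
  assumes F: "locally_integrable F"
    and zero: "\<And>\<phi>. test_function \<phi> \<Longrightarrow> (LINT x|lebesgue. F x * \<phi> x) = 0"
  shows "AE x in lebesgue. F x = 0"
proof -
  obtain G where [measurable]: "G \<in> borel_measurable borel" and G: "AE x in lborel. F x = G x"
    using completion_ex_borel_measurable_real[OF locally_integrable_measurable[OF F]] by auto
  have G': "AE x in lebesgue. F x = G x" using G by (rule AE_completion)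
  have Fm[measurable]: "F \<in> borel_measurable lebesgue" by (rule locally_integrable_measurable[OF F])
  have G''[measurable]: "G \<in> borel_measurable lebesgue" by (simp add: measurable_completion)
  have intK: "integrable lebesgue (\<lambda>x. indicator K x * G x)" if "compact K" for K
  proof -
    have "integrable lebesgue (\<lambda>x. indicator K x * F x)"
      using F that by (auto simp: locally_integrable_def set_integrable_def)
    moreover have [measurable]: "K \<in> sets lebesgue" using that by (simp add: borel_compact)
    moreover have "AE x in lebesgue. indicator K x * F x = indicator K x * G x"
      using G' by eventually_elim simp
    moreover have "(\<lambda>x. indicator K x * G x) \<in> borel_measurable lebesgue"
      by measurable
    ultimately show ?thesis
      by (rule_tac integrable_cong_AE_imp[of lebesgue "\<lambda>x. indicator K x * F x"])
  qed
  have int: "set_integrable lborel (box a b) G" for a b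
  proof -
    have "integrable lborel (\<lambda>x. indicator (cbox a b) x * G x)"
      using intK[of "cbox a b"] by (simp add: integrable_completion)
    then have "set_integrable lborel (cbox a b) G" by (simp add: set_integrable_def)
    then show ?thesis by (rule set_integrable_subset) (auto simp: box_subset_cbox)
  qed
  have "set_lebesgue_integral lborel (box a b) G = 0" for a b
  proof -
    have bump[measurable]: "box_bump n a b \<in> borel_measurable borel" for n
      using box_bump_test_function by (metis C_k.simps(1) borel_measurable_continuous_onI test_function_def)
    have bump'[measurable]: "box_bump n a b \<in> borel_measurable lebesgue" for n
      using bump by (simp add: measurable_completion)
    have "(\<lambda>n. LINT x|lborel. box_bump n a b x * G x) \<longlonglongrightarrow> (LINT x|lborel. indicator (box a b) x * G x)"
    proof (rule integral_dominated_convergence)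
      show "integrable lborel (\<lambda>x. norm (indicator (cbox a b) x * G x))"
        using intK[of "cbox a b"] by (simp add: integrable_completion)
      show "AE x in lborel. (\<lambda>n. box_bump n a b x * G x) \<longlonglongrightarrow> indicator (box a b) x * G x"
        by (intro AE_I2 tendsto_mult box_bump_tendsto tendsto_const)
      have "norm (box_bump n a b x * G x) \<le> norm (indicator (cbox a b) x * G x)" for n x
        using box_bump_eq_0[of x a b n] box_bump_bounds[where n=n and a=a and b=b and x=x]
        by (auto simp: indicator_def abs_mult intro!: mult_left_le_one_le)
      then show "AE x in lborel. norm (box_bump n a b x * G x) \<le> norm (indicator (cbox a b) x * G x)" for n
        by simp
    qed measurable
    moreover have "(LINT x|lborel. box_bump n a b x * G x) = 0" for n
    proof -
      have "(LINT x|lborel. box_bump n a b x * G x) = (LINT x|lebesgue. box_bump n a b x * G x)"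
        by (rule integral_completion[symmetric]) measurable
      also have "\<dots> = (LINT x|lebesgue. F x * box_bump n a b x)"
        proof (rule integral_cong_AE)
        show "AE x in lebesgue. box_bump n a b x * G x = F x * box_bump n a b x"
          using G' by eventually_elim simp
      qed measurable
      finally show ?thesis using zero[OF box_bump_test_function] by simp
    qed
    ultimately show ?thesis
      by (simp add: set_lebesgue_integral_def LIMSEQ_const_iff)
  qed
  then have "AE x in lborel. G x = 0"
    by (intro AE_zero_of_box_integrals int) auto
  then have "AE x in lborel. F x = 0" using G by eventually_elim simp
  then show ?thesis by (rule AE_completion)
qed

section \<open>Test functions\<close>

lemma test_function_has_derivative:
  "test_function \<phi> \<Longrightarrow> (\<phi> has_derivative frechet_derivative \<phi> (at x)) (at x)"
  using frechet_derivative_works[of \<phi> "at x"] by (auto simp: test_function_def dest!: spec[of _ 1])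

lemma test_function_continuous: "test_function \<phi> \<Longrightarrow> continuous_on UNIV \<phi>"
  by (metis C_k.simps(1) test_function_def)

lemma frechet_derivative_eq_sum:
  fixes \<phi> :: "real ^ 'n \<Rightarrow> real"
  assumes "(\<phi> has_derivative frechet_derivative \<phi> (at x)) (at x)"
  shows "frechet_derivative \<phi> (at x) v = (\<Sum>i\<in>UNIV. v $ i * frechet_derivative \<phi> (at x) (axis i 1))"
proof -
  have l: "linear (frechet_derivative \<phi> (at x))"
    using assms by (simp add: has_derivative_linear)
  have "frechet_derivative \<phi> (at x) v = frechet_derivative \<phi> (at x) (\<Sum>i\<in>UNIV. v $ i *\<^sub>R axis i 1)"
    by (simp add: basis_expansion flip: scalar_mult_eq_scaleR)
  then show ?thesis
    using l by (simp add: linear_sum linear_cmul)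
qed

lemma test_function_derivative_continuous:
  assumes "test_function \<phi>"
  shows "continuous_on UNIV (\<lambda>x. frechet_derivative \<phi> (at x) v)"
proof -
  have "continuous_on UNIV (\<lambda>x. frechet_derivative \<phi> (at x) (axis i 1))" for i
    using assms by (auto simp: test_function_def dest!: spec[of _ 1])
  then have "continuous_on UNIV (\<lambda>x. \<Sum>i\<in>UNIV. v $ i * frechet_derivative \<phi> (at x) (axis i 1))"
    by (intro continuous_on_sum continuous_on_mult_left)
  also have "(\<lambda>x. \<Sum>i\<in>UNIV. v $ i * frechet_derivative \<phi> (at x) (axis i 1))
      = (\<lambda>x. frechet_derivative \<phi> (at x) v)"
    by (rule ext) (rule frechet_derivative_eq_sum[OF test_function_has_derivative[OF assms], symmetric])
  finally show ?thesis .
qed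

text \<open>
  What the integrability and Fubini arguments below use of a test function and, equally, of its
  directional derivatives.
\<close>

definition test_like :: "('a::euclidean_space \<Rightarrow> real) \<Rightarrow> bool" where
  "test_like h \<longleftrightarrow> continuous_on UNIV h \<and> (\<exists>R. \<forall>x. norm x > R \<longrightarrow> h x = 0)"

lemma test_function_test_like:
  assumes "test_function \<phi>"
  shows "test_like \<phi>" "test_like (\<lambda>x. frechet_derivative \<phi> (at x) v)"
proof -
  define S where "S = closure {x. \<phi> x \<noteq> 0}"
  have "closed S" by (simp add: S_def)
  have "bounded S" using assms by (auto simp: S_def test_function_def intro: compact_imp_bounded)
  then obtain R where R: "\<And>x. x \<in> S \<Longrightarrow> norm x \<le> R" by (auto simp: bounded_iff)
  have 0: "x \<notin> S" if "norm x > R" for x using R[of x] that by auto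
  have phi0: "\<phi> x = 0" if "x \<notin> S" for x
    using that unfolding S_def using closure_subset[of "{x. \<phi> x \<noteq> 0}"] by auto
  have "frechet_derivative \<phi> (at x) v = 0" if "x \<notin> S" for x
  proof -
    have "(\<phi> has_derivative (\<lambda>v. 0)) (at x)"
      by (rule has_derivative_transform_within_open[where s="- S" and f="\<lambda>x. 0"])
        (use that phi0 \<open>closed S\<close> in auto)
    then show ?thesis by (metis frechet_derivative_at)
  qed
  then show "test_like \<phi>" "test_like (\<lambda>x. frechet_derivative \<phi> (at x) v)"
    using assms 0 phi0 unfolding test_like_def
    by (auto intro: test_function_continuous test_function_derivative_continuous)
qed

lemma C_k_translate: "C_k k f \<Longrightarrow> C_k k (\<lambda>x. f (x + c))"
proof (induction k arbitrary: f)
  case 0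
  then show ?case by (auto intro!: continuous_on_compose2[of UNIV f] continuous_intros)
next
  case (Suc k)
  have d: "((\<lambda>x. f (x + c)) has_derivative frechet_derivative f (at (x + c))) (at x)" for x
  proof -
    have "(f has_derivative frechet_derivative f (at (x + c))) (at (x + c))"
      using Suc.prems frechet_derivative_works by auto
    moreover have "((\<lambda>x. x + c) has_derivative (\<lambda>v. v)) (at x)"
      by (auto intro!: derivative_eq_intros)
    ultimately show ?thesis
      using has_derivative_compose[of "\<lambda>x. x + c" "\<lambda>v. v" x UNIV f] by simp
  qed
  then have e: "frechet_derivative (\<lambda>x. f (x + c)) (at x) = frechet_derivative f (at (x + c))" for x
    by (metis frechet_derivative_at)
  show ?case
    using d Suc by (auto simp: e differentiable_def)
qed

lemma frechet_derivative_translate: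
  assumes "test_function \<phi>"
  shows "frechet_derivative (\<lambda>x. \<phi> (x + c)) (at x) = frechet_derivative \<phi> (at (x + c))"
proof -
  have "((\<lambda>x. x + c) has_derivative (\<lambda>v. v)) (at x)"
    by (auto intro!: derivative_eq_intros)
  then have "((\<lambda>x. \<phi> (x + c)) has_derivative frechet_derivative \<phi> (at (x + c))) (at x)"
    using has_derivative_compose[of "\<lambda>x. x + c" "\<lambda>v. v" x UNIV \<phi>]
      test_function_has_derivative[OF assms] by simp
  then show ?thesis by (metis frechet_derivative_at)
qed

lemma test_function_translate:
  assumes "test_function \<phi>"
  shows "test_function (\<lambda>x. \<phi> (x + c))"
proof -
  have "{x. \<phi> (x + c) \<noteq> 0} = (\<lambda>x. - c + x) ` {x. \<phi> x \<noteq> 0}"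
  proof (intro equalityI subsetI)
    fix x assume "x \<in> {x. \<phi> (x + c) \<noteq> 0}"
    then have "x = - c + (x + c)" "x + c \<in> {x. \<phi> x \<noteq> 0}" by auto
    then show "x \<in> (\<lambda>x. - c + x) ` {x. \<phi> x \<noteq> 0}" by (rule image_eqI)
  qed auto
  then have "closure {x. \<phi> (x + c) \<noteq> 0} = (\<lambda>x. - c + x) ` closure {x. \<phi> x \<noteq> 0}"
    by (simp only: closure_translation)
  moreover have "compact ((\<lambda>x. - c + x) ` closure {x. \<phi> x \<noteq> 0})"
    using assms unfolding test_function_def by (intro compact_translation) blast
  ultimately show ?thesis
    using assms by (simp add: test_function_def C_k_translate del: compact_closure)
qed

lemma test_like_translate:
  assumes "test_like h"
  shows "test_like (\<lambda>x. h (x + c))"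
proof -
  obtain R where R: "\<forall>x. norm x > R \<longrightarrow> h x = 0" using assms by (auto simp: test_like_def)
  have "norm (x + c) > R" if "norm x > R + norm c" for x
    using norm_triangle_ineq4[of "x + c" c] that by simp
  then have "\<forall>x. norm x > R + norm c \<longrightarrow> h (x + c) = 0" using R by blast
  moreover have "continuous_on UNIV (\<lambda>x. h (x + c))"
    by (rule continuous_on_compose2[of UNIV h UNIV "\<lambda>x. x + c"])
      (use assms in \<open>auto simp: test_like_def intro: continuous_intros\<close>)
  ultimately show ?thesis
    unfolding test_like_def by blast
qed

lemma test_like_bounded:
  assumes "test_like h"
  obtains M R where "M \<ge> 0" "R \<ge> 0" "\<And>x. \<bar>h x\<bar> \<le> M * indicator (cball 0 R) x"
proof -
  obtain R where R: "\<forall>x. norm x > R \<longrightarrow> h x = 0" using assms by (auto simp: test_like_def)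
  have "compact (h ` cball 0 \<bar>R\<bar>)"
    using assms by (intro compact_continuous_image) (auto simp: test_like_def intro: continuous_on_subset)
  then obtain M where "\<forall>y\<in>h ` cball 0 \<bar>R\<bar>. norm y \<le> M"
    using compact_imp_bounded bounded_iff by metis
  then have "\<bar>h x\<bar> \<le> \<bar>M\<bar> * indicator (cball 0 \<bar>R\<bar>) x" for x
    using R by (cases "norm x \<le> \<bar>R\<bar>") force+
  then show thesis using that[of "\<bar>M\<bar>" "\<bar>R\<bar>"] by auto
qed

lemma cball_borel[measurable]: "cball (c::'a::metric_space) r \<in> sets borel"
  by (simp add: borel_closed)

lemma test_like_measurable[measurable_dest]: "test_like h \<Longrightarrow> h \<in> borel_measurable borel"
  by (auto simp: test_like_def intro: borel_measurable_continuous_onI)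

section \<open>Local integrability and translation\<close>

text \<open>
  Locally integrable Borel functions. Borel representatives are used because functions such as
  \<open>(x, \<tau>) \<mapsto> f(x + \<tau>v)\<close> need not be measurable for the product \<open>\<sigma>\<close>-algebra when \<open>f\<close> is only Lebesgue measurable.
\<close>

definition loc_int :: "('a::euclidean_space \<Rightarrow> real) \<Rightarrow> bool" where
  "loc_int f \<longleftrightarrow> f \<in> borel_measurable borel \<and> (\<forall>R. (\<integral>\<^sup>+x\<in>cball 0 R. ennreal \<bar>f x\<bar> \<partial>lborel) < \<infinity>)"

lemma loc_int_measurable[measurable_dest]: "loc_int f \<Longrightarrow> f \<in> borel_measurable borel"
  by (auto simp: loc_int_def)

lemma nn_integral_lborel_translate:
  fixes c :: "'a::euclidean_space"
  assumes [measurable]: "f \<in> borel_measurable borel"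
  shows "(\<integral>\<^sup>+x. f (x + c) \<partial>lborel) = (\<integral>\<^sup>+x. f x \<partial>lborel)"
  by (subst (2) lborel_distr_plus[symmetric, of c])
    (auto simp: nn_integral_distr add.commute)

lemma integral_lborel_translate:
  fixes c :: "'a::euclidean_space" and f :: "'a \<Rightarrow> real"
  assumes [measurable]: "f \<in> borel_measurable borel"
  shows "(LINT x|lborel. f (x + c)) = (LINT x|lborel. f x)"
  by (subst (2) lborel_distr_plus[symmetric, of c])
    (auto simp: integral_distr add.commute)

lemma loc_int_nn_integral_translate:
  assumes "loc_int f" and "norm c \<le> B"
  shows "(\<integral>\<^sup>+x. ennreal (\<bar>f (x + c)\<bar> * indicator (cball 0 R) x) \<partial>lborel)
     \<le> (\<integral>\<^sup>+x\<in>cball 0 (R + B). ennreal \<bar>f x\<bar> \<partial>lborel)"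
proof -
  note [measurable] = loc_int_measurable[OF assms(1)]
  have "(\<integral>\<^sup>+x. ennreal (\<bar>f (x + c)\<bar> * indicator (cball 0 R) x) \<partial>lborel)
      \<le> (\<integral>\<^sup>+x. ennreal \<bar>f (x + c)\<bar> * indicator (cball 0 (R + B)) (x + c) \<partial>lborel)"
  proof (intro nn_integral_mono)
    fix x
    show "ennreal (\<bar>f (x + c)\<bar> * indicator (cball 0 R) x) \<le> ennreal \<bar>f (x + c)\<bar> * indicator (cball 0 (R + B)) (x + c)"
      using norm_triangle_ineq[of x c] assms(2) by (auto simp: indicator_def)
  qed
  also have "\<dots> = (\<integral>\<^sup>+x\<in>cball 0 (R + B). ennreal \<bar>f x\<bar> \<partial>lborel)"
    by (rule nn_integral_lborel_translate) measurable
  finally show ?thesis .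
qed

lemma loc_int_mult_integrable:
  assumes f: "loc_int f" and h: "test_like h"
  shows "integrable lborel (\<lambda>x. f x * h x)"
proof -
  note [measurable] = loc_int_measurable[OF f] test_like_measurable[OF h]
  obtain M R where M: "M \<ge> 0" "R \<ge> 0" "\<And>x. \<bar>h x\<bar> \<le> M * indicator (cball 0 R) x"
    using test_like_bounded[OF h] by metis
  have "(\<integral>\<^sup>+x. ennreal (norm (f x * h x)) \<partial>lborel) \<le> (\<integral>\<^sup>+x. ennreal M * (ennreal \<bar>f x\<bar> * indicator (cball 0 R) x) \<partial>lborel)"
  proof (intro nn_integral_mono)
    fix x
    have "norm (f x * h x) \<le> \<bar>f x\<bar> * (M * indicator (cball 0 R) x)"
      using M(3)[of x] by (auto simp: abs_mult intro!: mult_left_mono)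
    then show "ennreal (norm (f x * h x)) \<le> ennreal M * (ennreal \<bar>f x\<bar> * indicator (cball 0 R) x)"
      using M(1) by (auto simp: indicator_def ennreal_mult'[symmetric] mult.commute intro!: ennreal_leI)
  qed
  also have "\<dots> = ennreal M * (\<integral>\<^sup>+x\<in>cball 0 R. ennreal \<bar>f x\<bar> \<partial>lborel)"
    by (rule nn_integral_cmult) measurable
  also have "\<dots> < \<infinity>"
    using f by (auto simp: loc_int_def ennreal_mult_less_top)
  finally show ?thesis by (intro integrableI_bounded) auto
qed

text \<open>
  The joint integrability behind every exchange of \<open>dx\<close> and \<open>d\<tau>\<close>: for each \<open>\<tau> \<in> [0, t]\<close> the \<open>x\<close>-integral
  only sees \<open>f\<close> on the ball of radius \<open>R + |t||v|\<close>.
\<close>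

lemma shear_integrable:
  fixes f :: "'a::euclidean_space \<Rightarrow> real"
  assumes f: "loc_int f" and h: "test_like h" 
  shows "integrable (lborel \<Otimes>\<^sub>M lborel) (\<lambda>(x, \<tau>). h x * (indicator {0..t} \<tau> * f (x + \<tau> *\<^sub>R v)))"
    and "integrable (lborel \<Otimes>\<^sub>M lborel) (\<lambda>(x, \<tau>). f x * (indicator {0..t} \<tau> * h (x - \<tau> *\<^sub>R v)))"
proof -
  note [measurable] = loc_int_measurable[OF f] test_like_measurable[OF h]
  obtain M R where M: "M \<ge> 0" "R \<ge> 0" "\<And>x. \<bar>h x\<bar> \<le> M * indicator (cball 0 R) x"
    using test_like_bounded[OF h] by metis
  let ?B = "\<bar>t\<bar> * norm v"
  let ?C = "\<integral>\<^sup>+x\<in>cball 0 (R + ?B). ennreal \<bar>f x\<bar> \<partial>lborel"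
  have C: "?C < \<infinity>" using f by (auto simp: loc_int_def)
  have n: "norm (\<tau> *\<^sub>R v) \<le> ?B" if "\<tau> \<in> {0..t}" for \<tau>
    using that by (auto intro!: mult_right_mono)
  have fin: "(\<integral>\<^sup>+\<tau>. ennreal M * ?C * indicator {0..t} \<tau> \<partial>lborel) < \<infinity>"
    using C by (subst nn_integral_cmult) (auto simp: ennreal_mult_less_top emeasure_lborel_Icc_eq)
  have "(\<integral>\<^sup>+z. ennreal (norm (case z of (x, \<tau>) \<Rightarrow> h x * (indicator {0..t} \<tau> * f (x + \<tau> *\<^sub>R v)))) \<partial>(lborel \<Otimes>\<^sub>M lborel))
      = (\<integral>\<^sup>+\<tau>. \<integral>\<^sup>+x. ennreal \<bar>h x * (indicator {0..t} \<tau> * f (x + \<tau> *\<^sub>R v))\<bar> \<partial>lborel \<partial>lborel)"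
    by (subst lborel_pair.nn_integral_snd[symmetric]) auto
  also have "\<dots> \<le> (\<integral>\<^sup>+\<tau>. ennreal M * ?C * indicator {0..t} \<tau> \<partial>lborel)"
  proof (intro nn_integral_mono)
    fix \<tau> :: real
    show "(\<integral>\<^sup>+x. ennreal \<bar>h x * (indicator {0..t} \<tau> * f (x + \<tau> *\<^sub>R v))\<bar> \<partial>lborel) \<le> ennreal M * ?C * indicator {0..t} \<tau>"
    proof (cases "\<tau> \<in> {0..t}")
      case True
      have "(\<integral>\<^sup>+x. ennreal \<bar>h x * (indicator {0..t} \<tau> * f (x + \<tau> *\<^sub>R v))\<bar> \<partial>lborel)
         \<le> (\<integral>\<^sup>+x. ennreal M * ennreal (\<bar>f (x + \<tau> *\<^sub>R v)\<bar> * indicator (cball 0 R) x) \<partial>lborel)"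
        using True M(1) by (intro nn_integral_mono)
          (auto simp: abs_mult ennreal_mult'[symmetric] mult.left_commute mult.assoc
             intro!: ennreal_leI mult_left_mono mult_right_mono order_trans[OF mult_right_mono[OF M(3)]])
      also have "\<dots> = ennreal M * (\<integral>\<^sup>+x. ennreal (\<bar>f (x + \<tau> *\<^sub>R v)\<bar> * indicator (cball 0 R) x) \<partial>lborel)"
        by (rule nn_integral_cmult) measurable
      also have "\<dots> \<le> ennreal M * ?C"
        using n[OF True] by (intro mult_left_mono loc_int_nn_integral_translate f) auto
      finally show ?thesis using True by simp
    qed simp
  qed
  also note fin
  finally show "integrable (lborel \<Otimes>\<^sub>M lborel) (\<lambda>(x, \<tau>). h x * (indicator {0..t} \<tau> * f (x + \<tau> *\<^sub>R v)))"
    by (intro integrableI_bounded) auto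
  have "(\<integral>\<^sup>+z. ennreal (norm (case z of (x, \<tau>) \<Rightarrow> f x * (indicator {0..t} \<tau> * h (x - \<tau> *\<^sub>R v)))) \<partial>(lborel \<Otimes>\<^sub>M lborel))
      = (\<integral>\<^sup>+\<tau>. \<integral>\<^sup>+x. ennreal \<bar>f x * (indicator {0..t} \<tau> * h (x - \<tau> *\<^sub>R v))\<bar> \<partial>lborel \<partial>lborel)"
    by (subst lborel_pair.nn_integral_snd[symmetric]) auto
  also have "\<dots> \<le> (\<integral>\<^sup>+\<tau>. ennreal M * ?C * indicator {0..t} \<tau> \<partial>lborel)"
  proof (intro nn_integral_mono)
    fix \<tau> :: real
    show "(\<integral>\<^sup>+x. ennreal \<bar>f x * (indicator {0..t} \<tau> * h (x - \<tau> *\<^sub>R v))\<bar> \<partial>lborel) \<le> ennreal M * ?C * indicator {0..t} \<tau>"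
    proof (cases "\<tau> \<in> {0..t}")
      case True
      have "ennreal \<bar>f x * (indicator {0..t} \<tau> * h (x - \<tau> *\<^sub>R v))\<bar>
          \<le> ennreal M * (ennreal \<bar>f x\<bar> * indicator (cball 0 (R + ?B)) x)" for x
      proof (cases "x \<in> cball 0 (R + ?B)")
        case x: True
        have "\<bar>h (x - \<tau> *\<^sub>R v)\<bar> \<le> M"
          using M(3)[of "x - \<tau> *\<^sub>R v"] M(1) by (cases "norm (x - \<tau> *\<^sub>R v) \<le> R") auto
        then show ?thesis
          using True x M(1) by (auto simp: abs_mult ennreal_mult'[symmetric] mult.commute[of M] intro!: ennreal_leI mult_left_mono)
      next
        case x: False
        have "norm (x - \<tau> *\<^sub>R v) > R"
          using norm_triangle_ineq[of "x - \<tau> *\<^sub>R v" "\<tau> *\<^sub>R v"] n[OF True] x by auto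
        then show ?thesis
          using M(3)[of "x - \<tau> *\<^sub>R v"] by auto
      qed
      then have "(\<integral>\<^sup>+x. ennreal \<bar>f x * (indicator {0..t} \<tau> * h (x - \<tau> *\<^sub>R v))\<bar> \<partial>lborel)
         \<le> (\<integral>\<^sup>+x. ennreal M * (ennreal \<bar>f x\<bar> * indicator (cball 0 (R + ?B)) x) \<partial>lborel)"
        by (intro nn_integral_mono)
      also have "\<dots> = ennreal M * ?C"
        by (rule nn_integral_cmult) measurable
      finally show ?thesis using True by simp
    qed simp
  qed
  also note fin
  finally show "integrable (lborel \<Otimes>\<^sub>M lborel) (\<lambda>(x, \<tau>). f x * (indicator {0..t} \<tau> * h (x - \<tau> *\<^sub>R v)))"
    by (intro integrableI_bounded) auto
qed

lemma shear_fubini: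
  fixes f :: "'a::euclidean_space \<Rightarrow> real"
  assumes f: "loc_int f" and h: "test_like h" 
  shows "AE x in lborel. h x \<noteq> 0 \<longrightarrow> set_integrable lborel {0..t} (\<lambda>\<tau>. f (x + \<tau> *\<^sub>R v))"
    and "integrable lborel (\<lambda>x. h x * (LINT \<tau>:{0..t}|lborel. f (x + \<tau> *\<^sub>R v)))"
    and "(LINT x|lborel. h x * (LINT \<tau>:{0..t}|lborel. f (x + \<tau> *\<^sub>R v)))
      = (LINT \<tau>:{0..t}|lborel. (LINT x|lborel. f x * h (x - \<tau> *\<^sub>R v)))"
    and "(LINT x|lborel. f x * (LINT \<tau>:{0..t}|lborel. h (x - \<tau> *\<^sub>R v)))
      = (LINT \<tau>:{0..t}|lborel. (LINT x|lborel. f x * h (x - \<tau> *\<^sub>R v)))"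
    and "set_integrable lborel {0..t} (\<lambda>\<tau>. LINT x|lborel. f x * h (x - \<tau> *\<^sub>R v))"
proof -
  note [measurable] = loc_int_measurable[OF f] test_like_measurable[OF h]
  note I1 = shear_integrable(1)[OF f h, of t v] and I2 = shear_integrable(2)[OF f h, of t v]
  have "AE x in lborel. integrable lborel (\<lambda>\<tau>. h x * (indicator {0..t} \<tau> * f (x + \<tau> *\<^sub>R v)))"
    using lborel_pair.AE_integrable_fst'[OF I1] by simp
  then show "AE x in lborel. h x \<noteq> 0 \<longrightarrow> set_integrable lborel {0..t} (\<lambda>\<tau>. f (x + \<tau> *\<^sub>R v))"
    by eventually_elim (auto simp: set_integrable_def)
  show "integrable lborel (\<lambda>x. h x * (LINT \<tau>:{0..t}|lborel. f (x + \<tau> *\<^sub>R v)))"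
    using lborel_pair.integrable_fst'[OF I1] by (simp add: set_lebesgue_integral_def)
  have "(LINT x|lborel. h x * (LINT \<tau>:{0..t}|lborel. f (x + \<tau> *\<^sub>R v)))
      = (LINT \<tau>|lborel. LINT x|lborel. h x * (indicator {0..t} \<tau> * f (x + \<tau> *\<^sub>R v)))"
    using lborel_pair.Fubini_integral[OF I1] by (simp add: set_lebesgue_integral_def)
  also have "\<dots> = (LINT \<tau>:{0..t}|lborel. (LINT x|lborel. f x * h (x - \<tau> *\<^sub>R v)))"
    unfolding set_lebesgue_integral_def
  proof (intro Bochner_Integration.integral_cong refl)
    fix \<tau> :: real
    have "(LINT x|lborel. f x * h (x - \<tau> *\<^sub>R v)) = (LINT x|lborel. f (x + \<tau> *\<^sub>R v) * h x)"
      using integral_lborel_translate[of "\<lambda>x. f x * h (x - \<tau> *\<^sub>R v)" "\<tau> *\<^sub>R v"] by simp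
    then show "(LINT x|lborel. h x * (indicator {0..t} \<tau> * f (x + \<tau> *\<^sub>R v))) = indicat_real {0..t} \<tau> *\<^sub>R (LINT x|lborel. f x * h (x - \<tau> *\<^sub>R v))"
      by (auto simp: indicator_def mult.commute)
  qed
  finally show "(LINT x|lborel. h x * (LINT \<tau>:{0..t}|lborel. f (x + \<tau> *\<^sub>R v)))
      = (LINT \<tau>:{0..t}|lborel. (LINT x|lborel. f x * h (x - \<tau> *\<^sub>R v)))" .
  have *: "(LINT x|lborel. f x * (indicator {0..t} \<tau> * h (x - \<tau> *\<^sub>R v)))
      = indicator {0..t} \<tau> *\<^sub>R (LINT x|lborel. f x * h (x - \<tau> *\<^sub>R v))" for \<tau>
    by (auto simp: indicator_def)
  show "(LINT x|lborel. f x * (LINT \<tau>:{0..t}|lborel. h (x - \<tau> *\<^sub>R v)))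
      = (LINT \<tau>:{0..t}|lborel. (LINT x|lborel. f x * h (x - \<tau> *\<^sub>R v)))"
    using lborel_pair.Fubini_integral[OF I2] by (simp add: set_lebesgue_integral_def *)
  show "set_integrable lborel {0..t} (\<lambda>\<tau>. LINT x|lborel. f x * h (x - \<tau> *\<^sub>R v))"
    using lborel_pair.integrable_snd[OF I2] by (simp add: set_integrable_def *)
qed

section \<open>Weak directional derivatives and increments\<close>

text \<open>
  The chain rule for the absolutely continuous function \<open>U\<close>. By the mean value theorem and
  the intermediate value theorem \<open>T(U(t)) - T(U(s)) = T'(U(r)) (U(t) - U(s))\<close> for some \<open>r\<close> in between, so the error
  \<open>H\<close> of the formula grows on a sufficiently short interval by at most \<open>e\<close> times the integral of
  \<open>|f|\<close>, where \<open>e > 0\<close> is arbitrary, by uniform continuity of \<open>T' \<circ> U\<close>. Summing over a fine partition, \<open>H\<close> vanishes.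
\<close>

lemma chain_rule_indefinite_integral:
  fixes f T T' :: "real \<Rightarrow> real"
  assumes f: "set_integrable lborel {0..b} f" and b: "0 \<le> b"
    and T: "\<And>y. (T has_real_derivative T' y) (at y)" and T': "continuous_on UNIV T'"
    and U: "\<And>t. t \<in> {0..b} \<Longrightarrow> U t = c + (LINT \<tau>:{0..t}|lborel. f \<tau>)"
  shows "T (U b) - T (U 0) = (LINT \<tau>:{0..b}|lborel. T' (U \<tau>) * f \<tau>)"
proof -
  have fi: "f integrable_on {0..b}" using f by (rule set_borel_integral_eq_integral)
  have f': "set_integrable lborel {s..t} f" if "0 \<le> s" "t \<le> b" for s t
    by (rule set_integrable_subset[OF f]) (use that in auto)
  have U': "U t = c + integral {0..t} f" if "t \<in> {0..b}" for t
    using U[OF that] set_borel_integral_eq_integral(2)[OF f'[of 0 t]] that by simp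
  have contU: "continuous_on {0..b} U"
  proof -
    have "continuous_on {0..b} (\<lambda>t. c + integral {0..t} f)"
      by (intro continuous_intros indefinite_integral_continuous_1 fi)
    then show ?thesis
      by (rule continuous_on_cong[THEN iffD1, rotated -1]) (use U' in auto)
  qed
  have contTU: "continuous_on {0..b} (\<lambda>t. T' (U t))"
    using continuous_on_compose2[OF T' contU] by auto
  have prod: "set_integrable lborel {0..b} (\<lambda>\<tau>. T' (U \<tau>) * f \<tau>)"
  proof -
    have "compact ((\<lambda>t. T' (U t)) ` {0..b})"
      by (intro compact_continuous_image contTU) auto
    then obtain B where B: "\<And>t. t \<in> {0..b} \<Longrightarrow> \<bar>T' (U t)\<bar> \<le> B"
      using compact_imp_bounded bounded_iff by (metis imageI real_norm_def)
    have [measurable]: "(\<lambda>t. indicator {0..b} t *\<^sub>R T' (U t)) \<in> borel_measurable borel"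
      by (rule borel_measurable_continuous_on_indicator[OF _ contTU]) simp
    have [measurable]: "(\<lambda>t. indicator {0..b} t *\<^sub>R f t) \<in> borel_measurable lborel"
      using f unfolding set_integrable_def by (rule borel_measurable_integrable)
    have "integrable lborel (\<lambda>t. (indicator {0..b} t *\<^sub>R T' (U t)) * (indicator {0..b} t *\<^sub>R f t))"
    proof (rule Bochner_Integration.integrable_bound)
      show "integrable lborel (\<lambda>t. B * (indicator {0..b} t *\<^sub>R f t))"
        using f unfolding set_integrable_def by (rule integrable_mult_right)
      show "AE t in lborel. norm (indicator {0..b} t *\<^sub>R T' (U t) * (indicator {0..b} t *\<^sub>R f t))
          \<le> norm (B * (indicator {0..b} t *\<^sub>R f t))"
        using B by (intro AE_I2) (auto simp: indicator_def abs_mult intro!: mult_right_mono order_trans[OF B])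
    qed measurable
    moreover have "(\<lambda>t. (indicator {0..b} t *\<^sub>R T' (U t)) * (indicator {0..b} t *\<^sub>R f t))
        = (\<lambda>t. indicator {0..b} t *\<^sub>R (T' (U t) * f t))"
      by (auto simp: indicator_def)
    ultimately show ?thesis by (simp add: set_integrable_def)
  qed
  have prod': "(\<lambda>\<tau>. T' (U \<tau>) * f \<tau>) integrable_on {s..t}" if "0 \<le> s" "t \<le> b" for s t
    by (intro set_borel_integral_eq_integral set_integrable_subset[OF prod]) (use that in auto)
  have absf: "(\<lambda>\<tau>. \<bar>f \<tau>\<bar>) integrable_on {s..t}" if "0 \<le> s" "t \<le> b" for s t
    by (intro set_borel_integral_eq_integral set_integrable_abs f' that)
  define H where "H = (\<lambda>t. T (U t) - T (U 0) - integral {0..t} (\<lambda>\<tau>. T' (U \<tau>) * f \<tau>))"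
  have mvt: "\<exists>r\<in>{s..t}. T (U t) - T (U s) = T' (U r) * (U t - U s)" if st: "0 \<le> s" "s \<le> t" "t \<le> b" for s t
  proof -
    have c: "continuous_on {s..t} U" by (rule continuous_on_subset[OF contU]) (use st in auto)
    consider "U s < U t" | "U t < U s" | "U s = U t" by linarith
    then show ?thesis
    proof cases
      case 1
      obtain z where z: "U s < z" "z < U t" "T (U t) - T (U s) = (U t - U s) * T' z"
        using MVT2[OF 1, of T T'] T by blast
      obtain r where "s \<le> r" "r \<le> t" "U r = z"
        using IVT'[of U s z t] z c st by auto
      then show ?thesis using z by (intro bexI[of _ r]) (auto simp: mult.commute)
    next
      case 2
      obtain z where z: "U t < z" "z < U s" "T (U s) - T (U t) = (U s - U t) * T' z"
        using MVT2[OF 2, of T T'] T by blast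
      obtain r where "s \<le> r" "r \<le> t" "U r = z"
        using IVT2'[of U t z s] z c st by auto
      then show ?thesis using z by (intro bexI[of _ r]) (auto simp: algebra_simps)
    next
      case 3
      then show ?thesis using st by (intro bexI[of _ s]) auto
    qed
  qed
  have "\<bar>H b\<bar> \<le> e * integral {0..b} (\<lambda>\<tau>. \<bar>f \<tau>\<bar>)" if e: "e > 0" for e
  proof -
    have "uniformly_continuous_on {0..b} (\<lambda>t. T' (U t))"
      by (intro compact_uniformly_continuous contTU) auto
    then obtain d where d: "d > 0" "\<And>s t. s \<in> {0..b} \<Longrightarrow> t \<in> {0..b} \<Longrightarrow> \<bar>s - t\<bar> < d \<Longrightarrow> \<bar>T' (U s) - T' (U t)\<bar> < e"
      using e unfolding uniformly_continuous_on_def dist_real_def by metis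
    have step: "\<bar>H t - H s\<bar> \<le> e * integral {s..t} (\<lambda>\<tau>. \<bar>f \<tau>\<bar>)" if st: "0 \<le> s" "s \<le> t" "t \<le> b" "t - s < d" for s t
    proof -
      obtain r where r: "r \<in> {s..t}" "T (U t) - T (U s) = T' (U r) * (U t - U s)"
        using mvt[OF st(1-3)] by blast
      have Ud: "U t - U s = integral {s..t} f"
        using Henstock_Kurzweil_Integration.integral_combine[of 0 s t f]
          integrable_on_subinterval[OF fi, of 0 t] U'[of s] U'[of t] st by auto
      have Id: "integral {0..t} (\<lambda>\<tau>. T' (U \<tau>) * f \<tau>) - integral {0..s} (\<lambda>\<tau>. T' (U \<tau>) * f \<tau>)
          = integral {s..t} (\<lambda>\<tau>. T' (U \<tau>) * f \<tau>)"
        using Henstock_Kurzweil_Integration.integral_combine[of 0 s t "\<lambda>\<tau>. T' (U \<tau>) * f \<tau>"]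
          prod'[of 0 t] st by auto
      have fst: "f integrable_on {s..t}"
        using st by (intro set_borel_integral_eq_integral f') auto
      have "H t - H s = integral {s..t} (\<lambda>\<tau>. T' (U r) * f \<tau>) - integral {s..t} (\<lambda>\<tau>. T' (U \<tau>) * f \<tau>)"
        using r(2) Ud Id by (simp add: H_def)
      also have "\<dots> = integral {s..t} (\<lambda>\<tau>. T' (U r) * f \<tau> - T' (U \<tau>) * f \<tau>)"
        using st fst prod'[of s t]
        by (intro Henstock_Kurzweil_Integration.integral_diff[symmetric] integrable_on_mult_right) auto
      finally have "H t - H s = integral {s..t} (\<lambda>\<tau>. T' (U r) * f \<tau> - T' (U \<tau>) * f \<tau>)" .
      moreover have "norm (integral {s..t} (\<lambda>\<tau>. T' (U r) * f \<tau> - T' (U \<tau>) * f \<tau>))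
          \<le> integral {s..t} (\<lambda>\<tau>. e * \<bar>f \<tau>\<bar>)"
      proof (rule integral_norm_bound_integral)
        show "(\<lambda>\<tau>. T' (U r) * f \<tau> - T' (U \<tau>) * f \<tau>) integrable_on {s..t}"
          using st fst prod'[of s t] by (intro integrable_diff integrable_on_mult_right) auto
        show "(\<lambda>\<tau>. e * \<bar>f \<tau>\<bar>) integrable_on {s..t}"
          using absf[of s t] st by (intro integrable_on_mult_right) auto
        show "norm (T' (U r) * f \<tau> - T' (U \<tau>) * f \<tau>) \<le> e * \<bar>f \<tau>\<bar>" if "\<tau> \<in> {s..t}" for \<tau>
        proof -
          have "\<bar>T' (U r) - T' (U \<tau>)\<bar> \<le> e"
            using d(2)[of r \<tau>] r(1) that st by (force simp: abs_less_iff)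
          then have "\<bar>T' (U r) - T' (U \<tau>)\<bar> * \<bar>f \<tau>\<bar> \<le> e * \<bar>f \<tau>\<bar>" by (intro mult_right_mono) auto
          then show ?thesis by (simp add: abs_mult flip: left_diff_distrib)
        qed
      qed
      ultimately show ?thesis by simp
    qed
    obtain n :: nat where n: "b / d < real n" using reals_Archimedean2 by blast
    have n0: "n > 0" using n b d(1) by (metis divide_nonneg_pos gr0I linorder_not_less of_nat_0)
    have nd: "b / real n < d" using n n0 d(1) by (simp add: field_simps)
    have "\<bar>H (b * real i / real n)\<bar> \<le> e * integral {0..b * real i / real n} (\<lambda>\<tau>. \<bar>f \<tau>\<bar>)" if "i \<le> n" for i
      using that
    proof (induction i)
      case 0
      then show ?case by (simp add: H_def)
    next
      case (Suc i)
      let ?s = "b * real i / real n" and ?t = "b * real (Suc i) / real n"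
      have st: "0 \<le> ?s" "?s \<le> ?t" "?t - ?s < d"
        using b n0 nd by (auto simp: field_simps)
      have tb: "?t \<le> b"
        using Suc.prems n0 mult_left_mono[of "real (Suc i)" "real n" b] b by (simp add: field_simps)
      have "\<bar>H ?t\<bar> \<le> \<bar>H ?s\<bar> + \<bar>H ?t - H ?s\<bar>" by simp
      also have "\<dots> \<le> e * integral {0..?s} (\<lambda>\<tau>. \<bar>f \<tau>\<bar>) + e * integral {?s..?t} (\<lambda>\<tau>. \<bar>f \<tau>\<bar>)"
        using Suc step[OF st(1,2) tb st(3)] by (intro add_mono) auto
      also have "\<dots> = e * integral {0..?t} (\<lambda>\<tau>. \<bar>f \<tau>\<bar>)"
        using Henstock_Kurzweil_Integration.integral_combine[of 0 ?s ?t "\<lambda>\<tau>. \<bar>f \<tau>\<bar>"]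
          absf[of 0 ?t] st tb by (simp flip: distrib_left)
      finally show ?case .
    qed
    from this[of n] show ?thesis using n0 by simp
  qed
  then have "\<bar>H b\<bar> \<le> 0"
  proof -
    assume *: "\<And>e. e > 0 \<Longrightarrow> \<bar>H b\<bar> \<le> e * integral {0..b} (\<lambda>\<tau>. \<bar>f \<tau>\<bar>)"
    let ?I = "integral {0..b} (\<lambda>\<tau>. \<bar>f \<tau>\<bar>)"
    have I: "?I \<ge> 0" using absf[of 0 b] by (intro integral_nonneg) auto
    show ?thesis
    proof (rule field_le_epsilon)
      fix e :: real assume "e > 0"
      then have "\<bar>H b\<bar> \<le> e / (?I + 1) * ?I" using I by (intro *) auto
      also have "\<dots> \<le> e" using I \<open>e > 0\<close> by (simp add: field_simps)
      finally show "\<bar>H b\<bar> \<le> 0 + e" by simp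
    qed
  qed
  then show ?thesis
    using set_borel_integral_eq_integral(2)[OF prod] by (simp add: H_def)
qed

lemma loc_intI:
  fixes F :: "'a::euclidean_space \<Rightarrow> real"
  assumes [measurable]: "F \<in> borel_measurable borel"
    and int: "\<And>h. test_like h \<Longrightarrow> integrable lborel (\<lambda>x. h x * F x)"
  shows "loc_int F"
  unfolding loc_int_def
proof (intro conjI allI assms)
  fix R :: real
  \<comment> \<open>a weight that is at least \<open>1\<close> on the ball of radius \<open>R\<close>\<close>
  define h :: "'a \<Rightarrow> real" where "h = (\<lambda>x. max 0 (R + 1 - norm x))"
  have h: "test_like h"
    unfolding test_like_def h_def
    by (intro conjI exI[of _ "R + 1"] continuous_intros) auto
  have "(\<integral>\<^sup>+x\<in>cball 0 R. ennreal \<bar>F x\<bar> \<partial>lborel) \<le> (\<integral>\<^sup>+x. ennreal (norm (h x * F x)) \<partial>lborel)"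
  proof (intro nn_integral_mono)
    fix x
    have "1 * \<bar>F x\<bar> \<le> \<bar>h x\<bar> * \<bar>F x\<bar>" if "norm x \<le> R"
      using that by (intro mult_right_mono) (auto simp: h_def)
    then show "ennreal \<bar>F x\<bar> * indicator (cball 0 R) x \<le> ennreal (norm (h x * F x))"
      by (auto simp: indicator_def abs_mult intro!: ennreal_leI)
  qed
  also have "\<dots> < \<infinity>" using int[OF h] by (simp add: integrable_iff_bounded)
  finally show "(\<integral>\<^sup>+x\<in>cball 0 R. ennreal \<bar>F x\<bar> \<partial>lborel) < \<infinity>" .
qed

lemma loc_int_diff: "loc_int f \<Longrightarrow> loc_int g \<Longrightarrow> loc_int (\<lambda>x. f x - g x)"
proof (rule loc_intI)
  fix h :: "'a \<Rightarrow> real" assume "loc_int f" "loc_int g" "test_like h"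
  then have "integrable lborel (\<lambda>x. f x * h x - g x * h x)"
    by (intro Bochner_Integration.integrable_diff loc_int_mult_integrable)
  then show "integrable lborel (\<lambda>x. h x * (f x - g x))"
    by (simp add: algebra_simps)
qed (auto dest: loc_int_measurable)

lemma loc_int_bound:
  assumes "loc_int f" and [measurable]: "g \<in> borel_measurable borel" and "\<And>x. \<bar>g x\<bar> \<le> \<bar>f x\<bar>"
  shows "loc_int g"
  unfolding loc_int_def
proof (intro conjI allI)
  fix R
  have "(\<integral>\<^sup>+x\<in>cball 0 R. ennreal \<bar>g x\<bar> \<partial>lborel) \<le> (\<integral>\<^sup>+x\<in>cball 0 R. ennreal \<bar>f x\<bar> \<partial>lborel)"
    using assms(3) by (intro nn_integral_mono mult_right_mono ennreal_leI) auto
  also have "\<dots> < \<infinity>" using assms(1) by (auto simp: loc_int_def)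
  finally show "(\<integral>\<^sup>+x\<in>cball 0 R. ennreal \<bar>g x\<bar> \<partial>lborel) < \<infinity>" .
qed simp

lemma loc_int_translate:
  assumes "loc_int f"
  shows "loc_int (\<lambda>x. f (x + c))"
proof (rule loc_intI)
  note [measurable] = loc_int_measurable[OF assms]
  show "(\<lambda>x. f (x + c)) \<in> borel_measurable borel" by measurable
  fix h :: "'a \<Rightarrow> real" assume h: "test_like h"
  have "integrable lborel (\<lambda>x. f x * h (x + - c))"
    by (intro loc_int_mult_integrable assms test_like_translate h)
  then have "integrable (distr lborel borel (\<lambda>x. c + x)) (\<lambda>x. f x * h (x + - c))"
    by (simp add: lborel_distr_plus)
  then have "integrable lborel (\<lambda>x. f (c + x) * h (c + x + - c))"
    by (rule integrable_distr[rotated]) simp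
  then show "integrable lborel (\<lambda>x. h x * f (x + c))"
    by (simp add: algebra_simps)
qed

lemma loc_int_locally_integrable: 
  assumes "loc_int (f :: real ^ 'n \<Rightarrow> real)"
  shows "locally_integrable f"
  unfolding locally_integrable_def set_integrable_def
proof (intro allI impI)
  fix K :: "(real ^ 'n) set" assume "compact K"
  note [measurable] = loc_int_measurable[OF assms]
  have [measurable]: "K \<in> sets borel" using \<open>compact K\<close> by (rule borel_compact)
  obtain R where "\<forall>x\<in>K. norm x \<le> R"
    using compact_imp_bounded[OF \<open>compact K\<close>] unfolding bounded_iff by blast
  then have R: "K \<subseteq> cball 0 R" by auto
  have "(\<integral>\<^sup>+x. ennreal (norm (indicator K x *\<^sub>R f x)) \<partial>lborel) \<le> (\<integral>\<^sup>+x\<in>cball 0 R. ennreal \<bar>f x\<bar> \<partial>lborel)"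
    using R by (intro nn_integral_mono) (auto simp: indicator_def)
  also have "\<dots> < \<infinity>" using assms by (auto simp: loc_int_def)
  finally have "integrable lborel (\<lambda>x. indicator K x *\<^sub>R f x)"
    by (intro integrableI_bounded) auto
  then show "integrable lebesgue (\<lambda>x. indicator K x *\<^sub>R f x)"
    by (subst integrable_completion) auto
qed

lemma fundamental_lemma_borel:
  fixes F :: "real ^ 'n \<Rightarrow> real"
  assumes F: "loc_int F" and zero: "\<And>\<phi>. test_function \<phi> \<Longrightarrow> (LINT x|lborel. F x * \<phi> x) = 0"
  shows "AE x in lborel. F x = 0"
proof -
  have "AE x in lebesgue. F x = 0"
  proof (rule fundamental_lemma_calculus_of_variations[OF loc_int_locally_integrable[OF F]])
    fix \<phi> :: "real ^ 'n \<Rightarrow> real" assume \<phi>: "test_function \<phi>"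
    note [measurable] = loc_int_measurable[OF F] test_like_measurable[OF test_function_test_like(1)[OF \<phi>]]
    show "(LINT x|lebesgue. F x * \<phi> x) = 0"
      using zero[OF \<phi>] by (subst integral_completion) auto
  qed
  then show ?thesis by (simp add: AE_completion_iff)
qed

text \<open>
  The direction is arbitrary, not only a coordinate direction, because increments along arbitrary
  segments are needed to estimate the oscillation of a function by its gradient.
\<close>

definition weak_dderiv :: "(real ^ 'n \<Rightarrow> real) \<Rightarrow> (real ^ 'n \<Rightarrow> real) \<Rightarrow> real ^ 'n \<Rightarrow> bool" where
  "weak_dderiv u G v \<longleftrightarrow> loc_int u \<and> loc_int G \<and>
     (\<forall>\<phi>. test_function \<phi> \<longrightarrow>
        (LINT x|lborel. u x * frechet_derivative \<phi> (at x) v) = - (LINT x|lborel. G x * \<phi> x))"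

lemma test_function_line_integral:
  assumes \<phi>: "test_function \<phi>" and t: "0 \<le> t"
  shows "(LINT \<tau>:{0..t}|lborel. frechet_derivative \<phi> (at (x - \<tau> *\<^sub>R v)) v) = \<phi> x - \<phi> (x - t *\<^sub>R v)"
proof -
  let ?f = "\<lambda>\<tau>. frechet_derivative \<phi> (at (x - \<tau> *\<^sub>R v)) v"
  have cont: "continuous_on {0..t} ?f"
    by (rule continuous_on_compose2[OF test_function_derivative_continuous[OF \<phi>]])
      (auto intro!: continuous_intros)
  have "((\<lambda>\<tau>. - \<phi> (x - \<tau> *\<^sub>R v)) has_vector_derivative ?f \<tau>) (at \<tau> within {0..t})" for \<tau>
  proof -
    have "((\<lambda>\<tau>. x - \<tau> *\<^sub>R v) has_derivative (\<lambda>r. - (r *\<^sub>R v))) (at \<tau>)"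
      by (auto intro!: derivative_eq_intros)
    then have "((\<lambda>\<tau>. \<phi> (x - \<tau> *\<^sub>R v)) has_derivative (\<lambda>r. frechet_derivative \<phi> (at (x - \<tau> *\<^sub>R v)) (- (r *\<^sub>R v)))) (at \<tau>)"
      using has_derivative_compose[of "\<lambda>\<tau>. x - \<tau> *\<^sub>R v" _ \<tau> UNIV \<phi>] test_function_has_derivative[OF \<phi>] by blast
    moreover have "frechet_derivative \<phi> (at (x - \<tau> *\<^sub>R v)) (- (r *\<^sub>R v)) = - (r *\<^sub>R ?f \<tau>)" for r
      using has_derivative_linear[OF test_function_has_derivative[OF \<phi>]]
      by (simp add: linear_neg linear_cmul)
    ultimately have "((\<lambda>\<tau>. - \<phi> (x - \<tau> *\<^sub>R v)) has_derivative (\<lambda>r. r *\<^sub>R ?f \<tau>)) (at \<tau>)"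
      using has_derivative_minus by fastforce
    then show ?thesis
      by (simp add: has_vector_derivative_def has_derivative_at_withinI)
  qed
  then have "(?f has_integral (- \<phi> (x - t *\<^sub>R v) - - \<phi> (x - 0 *\<^sub>R v))) {0..t}"
    by (intro fundamental_theorem_of_calculus t)
  moreover have "set_integrable lborel {0..t} ?f"
    unfolding set_integrable_def by (rule borel_integrable_compact[OF _ cont]) simp
  ultimately show ?thesis
    by (simp add: set_borel_integral_eq_integral(2) integral_unique)
qed

text \<open>
  Moving the translation from \<open>w\<close> to \<open>\<phi>\<close> turns an increment of \<open>w\<close> into a derivative of \<open>\<phi>\<close>; this
  identity serves both directions of the equivalence between weak derivatives and increments.
\<close>

lemma integral_increment_test_function:
  assumes w: "loc_int w" and \<phi>: "test_function \<phi>" and t: "0 \<le> t"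
  shows "(LINT x|lborel. \<phi> x * (w (x + t *\<^sub>R v) - w x))
    = - (LINT \<tau>:{0..t}|lborel. (LINT x|lborel. w x * frechet_derivative \<phi> (at (x - \<tau> *\<^sub>R v)) v))"
proof -
  note tl = test_function_test_like[OF \<phi>]
  note [measurable] = loc_int_measurable[OF w] test_like_measurable[OF tl(1)]
  have i1: "integrable lborel (\<lambda>x. w (x + t *\<^sub>R v) * \<phi> x)"
    by (intro loc_int_mult_integrable loc_int_translate w tl)
  have i2: "integrable lborel (\<lambda>x. w x * \<phi> x)"
    by (intro loc_int_mult_integrable w tl)
  have i3: "integrable lborel (\<lambda>x. w x * \<phi> (x - t *\<^sub>R v))"
    using loc_int_mult_integrable[OF w test_like_translate[OF tl(1), of "- (t *\<^sub>R v)"]] by simp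
  have "(LINT x|lborel. \<phi> x * (w (x + t *\<^sub>R v) - w x)) = (LINT x|lborel. w (x + t *\<^sub>R v) * \<phi> x - w x * \<phi> x)"
    by (simp add: algebra_simps)
  also have "\<dots> = (LINT x|lborel. w (x + t *\<^sub>R v) * \<phi> x) - (LINT x|lborel. w x * \<phi> x)"
    by (intro Bochner_Integration.integral_diff i1 i2)
  also have "(LINT x|lborel. w (x + t *\<^sub>R v) * \<phi> x) = (LINT x|lborel. w x * \<phi> (x - t *\<^sub>R v))"
    using integral_lborel_translate[of "\<lambda>x. w x * \<phi> (x - t *\<^sub>R v)" "t *\<^sub>R v"] by simp
  also have "(LINT x|lborel. w x * \<phi> (x - t *\<^sub>R v)) - (LINT x|lborel. w x * \<phi> x)
      = - (LINT x|lborel. w x * (\<phi> x - \<phi> (x - t *\<^sub>R v)))"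
    using i2 i3 by (simp add: algebra_simps)
  also have "\<dots> = - (LINT x|lborel. w x * (LINT \<tau>:{0..t}|lborel. frechet_derivative \<phi> (at (x - \<tau> *\<^sub>R v)) v))"
    by (simp add: test_function_line_integral[OF \<phi> t])
  also have "\<dots> = - (LINT \<tau>:{0..t}|lborel. (LINT x|lborel. w x * frechet_derivative \<phi> (at (x - \<tau> *\<^sub>R v)) v))"
    by (subst shear_fubini(4)[OF w tl(2)]) simp
  finally show ?thesis .
qed

lemma loc_int_line_integral:
  assumes "loc_int G"
  shows "loc_int (\<lambda>x. LINT \<tau>:{0..t}|lborel. G (x + \<tau> *\<^sub>R v))"
proof (rule loc_intI)
  note [measurable] = loc_int_measurable[OF assms]
  show "(\<lambda>x. LINT \<tau>:{0..t}|lborel. G (x + \<tau> *\<^sub>R v)) \<in> borel_measurable borel"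
    unfolding set_lebesgue_integral_def by measurable
qed (rule shear_fubini(2)[OF assms])

text \<open>
  Both sides have the same integral against every test function: translates of test functions are
  test functions, so the weak derivative can be used for each \<open>\<tau>\<close> separately.
\<close>

lemma weak_dderiv_translate:
  assumes "weak_dderiv u G v" and t: "0 \<le> t"
  shows "AE x in lborel. u (x + t *\<^sub>R v) - u x = (LINT \<tau>:{0..t}|lborel. G (x + \<tau> *\<^sub>R v))"
proof -
  have u: "loc_int u" and G: "loc_int G"
    and wk: "\<And>\<phi>. test_function \<phi> \<Longrightarrow> (LINT x|lborel. u x * frechet_derivative \<phi> (at x) v) = - (LINT x|lborel. G x * \<phi> x)"
    using assms(1) by (auto simp: weak_dderiv_def)
  have "AE x in lborel. (u (x + t *\<^sub>R v) - u x) - (LINT \<tau>:{0..t}|lborel. G (x + \<tau> *\<^sub>R v)) = 0"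
  proof (rule fundamental_lemma_borel)
    show "loc_int (\<lambda>x. (u (x + t *\<^sub>R v) - u x) - (LINT \<tau>:{0..t}|lborel. G (x + \<tau> *\<^sub>R v)))"
      by (intro loc_int_diff loc_int_translate loc_int_line_integral u G)
    fix \<phi> :: "real ^ 'a \<Rightarrow> real" assume \<phi>: "test_function \<phi>"
    note tl = test_function_test_like[OF \<phi>]
    have i1: "integrable lborel (\<lambda>x. \<phi> x * (u (x + t *\<^sub>R v) - u x))"
      using loc_int_mult_integrable[OF loc_int_diff[OF loc_int_translate[OF u] u] tl(1), of "t *\<^sub>R v"]
      by (simp add: mult.commute)
    have i2: "integrable lborel (\<lambda>x. \<phi> x * (LINT \<tau>:{0..t}|lborel. G (x + \<tau> *\<^sub>R v)))"
      by (rule shear_fubini(2)[OF G tl(1)])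
    have "(LINT x|lborel. (u (x + t *\<^sub>R v) - u x - (LINT \<tau>:{0..t}|lborel. G (x + \<tau> *\<^sub>R v))) * \<phi> x)
      = (LINT x|lborel. \<phi> x * (u (x + t *\<^sub>R v) - u x) - \<phi> x * (LINT \<tau>:{0..t}|lborel. G (x + \<tau> *\<^sub>R v)))"
      by (simp add: algebra_simps)
    also have "\<dots> = (LINT x|lborel. \<phi> x * (u (x + t *\<^sub>R v) - u x)) - (LINT x|lborel. \<phi> x * (LINT \<tau>:{0..t}|lborel. G (x + \<tau> *\<^sub>R v)))"
      by (intro Bochner_Integration.integral_diff i1 i2)
    also have "(LINT x|lborel. \<phi> x * (LINT \<tau>:{0..t}|lborel. G (x + \<tau> *\<^sub>R v)))
        = (LINT \<tau>:{0..t}|lborel. (LINT x|lborel. G x * \<phi> (x - \<tau> *\<^sub>R v)))"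
      by (rule shear_fubini(3)[OF G tl(1)])
    also have "(LINT x|lborel. \<phi> x * (u (x + t *\<^sub>R v) - u x))
        = - (LINT \<tau>:{0..t}|lborel. (LINT x|lborel. u x * frechet_derivative \<phi> (at (x - \<tau> *\<^sub>R v)) v))"
      by (rule integral_increment_test_function[OF u \<phi> t])
    also have "(\<lambda>\<tau>. LINT x|lborel. u x * frechet_derivative \<phi> (at (x - \<tau> *\<^sub>R v)) v)
        = (\<lambda>\<tau>. - (LINT x|lborel. G x * \<phi> (x - \<tau> *\<^sub>R v)))"
    proof
      show "(LINT x|lborel. u x * frechet_derivative \<phi> (at (x - \<tau> *\<^sub>R v)) v)
        = - (LINT x|lborel. G x * \<phi> (x - \<tau> *\<^sub>R v))" for \<tau>
        using wk[OF test_function_translate[OF \<phi>, of "- (\<tau> *\<^sub>R v)"]]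
        by (simp add: frechet_derivative_translate[OF \<phi>, of "- (\<tau> *\<^sub>R v)", simplified])
    qed
    finally show "(LINT x|lborel. (u (x + t *\<^sub>R v) - u x - (LINT \<tau>:{0..t}|lborel. G (x + \<tau> *\<^sub>R v))) * \<phi> x) = 0"
      by (simp add: set_lebesgue_integral_def)
  qed
  then show ?thesis by simp
qed

lemma shear_integral_continuous:
  fixes f :: "'a::euclidean_space \<Rightarrow> real"
  assumes f: "loc_int f" and h: "test_like h"
  shows "continuous_on UNIV (\<lambda>\<tau>. LINT x|lborel. f x * h (x - \<tau> *\<^sub>R v))"
  unfolding continuous_on_sequentially o_def
proof (intro allI impI ballI, elim conjE)
  fix \<sigma> :: "nat \<Rightarrow> real" and \<tau> assume lim: "\<sigma> \<longlonglongrightarrow> \<tau>"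
  note [measurable] = loc_int_measurable[OF f] test_like_measurable[OF h]
  obtain M R where M: "M \<ge> 0" "R \<ge> 0" "\<And>x. \<bar>h x\<bar> \<le> M * indicator (cball 0 R) x"
    using test_like_bounded[OF h] by metis
  obtain B where B: "\<And>n. \<bar>\<sigma> n\<bar> \<le> B"
    using convergent_imp_Bseq[OF convergentI[OF lim]] by (auto simp: Bseq_def)
  let ?R = "R + B * norm v"
  show "(\<lambda>n. LINT x|lborel. f x * h (x - \<sigma> n *\<^sub>R v)) \<longlonglongrightarrow> (LINT x|lborel. f x * h (x - \<tau> *\<^sub>R v))"
  proof (rule integral_dominated_convergence)
    have "(\<integral>\<^sup>+x. ennreal (norm (\<bar>f x\<bar> * indicator (cball 0 ?R) x)) \<partial>lborel) = (\<integral>\<^sup>+x\<in>cball 0 ?R. ennreal \<bar>f x\<bar> \<partial>lborel)"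
      by (intro nn_integral_cong) (auto simp: indicator_def)
    also have "\<dots> < \<infinity>" using f by (auto simp: loc_int_def)
    finally have "integrable lborel (\<lambda>x. \<bar>f x\<bar> * indicator (cball 0 ?R) x)"
      by (intro integrableI_bounded) auto
    then show "integrable lborel (\<lambda>x. M * (\<bar>f x\<bar> * indicator (cball 0 ?R) x))"
      by (rule integrable_mult_right)
    show "AE x in lborel. (\<lambda>n. f x * h (x - \<sigma> n *\<^sub>R v)) \<longlonglongrightarrow> f x * h (x - \<tau> *\<^sub>R v)"
    proof (intro AE_I2 tendsto_mult tendsto_const)
      fix x
      have "(\<lambda>n. x - \<sigma> n *\<^sub>R v) \<longlonglongrightarrow> x - \<tau> *\<^sub>R v" by (intro tendsto_intros lim)
      moreover have "isCont h (x - \<tau> *\<^sub>R v)"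
        using h by (auto simp: test_like_def continuous_on_eq_continuous_at)
      ultimately show "(\<lambda>n. h (x - \<sigma> n *\<^sub>R v)) \<longlonglongrightarrow> h (x - \<tau> *\<^sub>R v)"
        by (rule isCont_tendsto_compose[rotated])
    qed
    show "AE x in lborel. norm (f x * h (x - \<sigma> n *\<^sub>R v)) \<le> M * (\<bar>f x\<bar> * indicator (cball 0 ?R) x)" for n
    proof (intro AE_I2)
      fix x
      have n: "norm (\<sigma> n *\<^sub>R v) \<le> B * norm v" using B[of n] by (auto intro!: mult_right_mono)
      show "norm (f x * h (x - \<sigma> n *\<^sub>R v)) \<le> M * (\<bar>f x\<bar> * indicator (cball 0 ?R) x)"
      proof (cases "norm x \<le> ?R")
        case True
        have "\<bar>h (x - \<sigma> n *\<^sub>R v)\<bar> \<le> M"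
          using M(3)[of "x - \<sigma> n *\<^sub>R v"] M(1) by (cases "norm (x - \<sigma> n *\<^sub>R v) \<le> R") auto
        then have "\<bar>h (x - \<sigma> n *\<^sub>R v)\<bar> * \<bar>f x\<bar> \<le> M * \<bar>f x\<bar>" by (intro mult_right_mono) auto
        then show ?thesis using True by (simp add: abs_mult mult.commute)
      next
        case False
        then have "norm (x - \<sigma> n *\<^sub>R v) > R"
          using norm_triangle_ineq[of "x - \<sigma> n *\<^sub>R v" "\<sigma> n *\<^sub>R v"] n by auto
        then have "h (x - \<sigma> n *\<^sub>R v) = 0" using M(3)[of "x - \<sigma> n *\<^sub>R v"] by auto
        then show ?thesis using M(1) by simp
      qed
    qed
  qed measurable
qed

lemma AE_lborel_ex_Ioo:
  fixes d :: real
  assumes "AE t in lborel. P t" and "d > 0"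
  shows "\<exists>t\<in>{0<..<d}. P t"
proof (rule ccontr)
  assume "\<not> ?thesis"
  then have "AE t in lborel. t \<notin> {0<..<d}" using assms(1) by (auto elim!: eventually_mono)
  then have "{0<..<d} \<in> null_sets lborel" by (subst AE_iff_null_sets) auto
  then show False using \<open>d > 0\<close> by (auto simp: null_sets_def)
qed

text \<open>
  Almost every \<open>t\<close> suffices, since continuity at \<open>0\<close> only needs some small \<open>t\<close>.
\<close>

lemma continuous_eq_0_of_integrals:
  fixes L :: "real \<Rightarrow> real"
  assumes L: "continuous_on UNIV L"
    and zero: "AE t in lborel. t \<in> {0<..<1} \<longrightarrow> (LINT \<tau>:{0..t}|lborel. L \<tau>) = 0"
  shows "L 0 = 0"
proof (rule ccontr)
  assume n: "L 0 \<noteq> 0"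
  have "isCont L 0" using L by (simp add: continuous_on_eq_continuous_at)
  then obtain d where d: "d > 0" "\<And>t. \<bar>t\<bar> < d \<Longrightarrow> \<bar>L t - L 0\<bar> < \<bar>L 0\<bar> / 2"
    using n unfolding continuous_at_eps_delta dist_real_def by (metis diff_zero half_gt_zero zero_less_abs_iff)
  obtain t where t: "t \<in> {0<..<min d 1}" "(LINT \<tau>:{0..t}|lborel. L \<tau>) = 0"
    using AE_lborel_ex_Ioo[OF zero, of "min d 1"] d(1) by auto
  have Lt: "continuous_on {0..t} L" by (rule continuous_on_subset[OF L]) auto
  have "set_integrable lborel {0..t} L"
    unfolding set_integrable_def by (rule borel_integrable_compact[OF _ Lt]) simp
  then have "integral {0..t} L = 0" using t(2) by (simp add: set_borel_integral_eq_integral(2))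
  then have "(L has_integral 0) {0..t}" using integrable_continuous_real[OF Lt] by (metis integrable_integral)
  then have "((\<lambda>\<tau>. L \<tau> - L 0) has_integral (0 - (t - 0) *\<^sub>R L 0)) {0..t}"
    using has_integral_diff[OF \<open>(L has_integral 0) {0..t}\<close> has_integral_const_real[of "L 0" 0 t]] t(1) by simp
  then have "norm (0 - (t - 0) *\<^sub>R L 0) \<le> \<bar>L 0\<bar> / 2 * Sigma_Algebra.measure lborel {0..t}"
    using t d(2) by (intro has_integral_bound_real[where f="\<lambda>\<tau>. L \<tau> - L 0"]) (auto intro!: less_imp_le)
  then show False using t(1) n by (simp add: abs_mult)
qed

text \<open>
  The converse of \<open>weak_dderiv_translate\<close>: integrated against \<open>\<phi>\<close>, the increment formula says that
  the sum of the two terms of the weak formulation, evaluated at the translate of \<open>\<phi>\<close> by \<open>\<tau>v\<close>, has integral \<open>0\<close> over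
  \<open>\<tau> \<in> [0, t]\<close>; let \<open>t\<close> tend to \<open>0\<close>.
\<close>

lemma weak_dderivI:
  assumes w: "loc_int w" and H: "loc_int H"
    and line: "AE t in lborel. t \<in> {0<..<1} \<longrightarrow>
      (AE x in lborel. w (x + t *\<^sub>R v) - w x = (LINT \<tau>:{0..t}|lborel. H (x + \<tau> *\<^sub>R v)))"
  shows "weak_dderiv w H v"
  unfolding weak_dderiv_def
proof (intro conjI allI impI w H)
  fix \<phi> :: "real ^ 'a \<Rightarrow> real" assume \<phi>: "test_function \<phi>"
  note tl = test_function_test_like[OF \<phi>]
  let ?J = "\<lambda>\<tau>. LINT x|lborel. H x * \<phi> (x - \<tau> *\<^sub>R v)"
  let ?K = "\<lambda>\<tau>. LINT x|lborel. w x * frechet_derivative \<phi> (at (x - \<tau> *\<^sub>R v)) v"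
  note [measurable] = loc_int_measurable[OF w] loc_int_measurable[OF H]
    test_like_measurable[OF tl(1)] loc_int_measurable[OF loc_int_line_integral[OF H]]
  have "?J 0 + ?K 0 = 0"
  proof (rule continuous_eq_0_of_integrals)
    show "continuous_on UNIV (\<lambda>\<tau>. ?J \<tau> + ?K \<tau>)"
      by (intro continuous_on_add shear_integral_continuous w H tl)
    show "AE t in lborel. t \<in> {0<..<1} \<longrightarrow> (LINT \<tau>:{0..t}|lborel. ?J \<tau> + ?K \<tau>) = 0"
      using line
    proof eventually_elim
      case (elim t)
      show ?case
      proof
        assume t: "t \<in> {0<..<1}"
        have "(LINT \<tau>:{0..t}|lborel. ?J \<tau>) = (LINT x|lborel. \<phi> x * (LINT \<tau>:{0..t}|lborel. H (x + \<tau> *\<^sub>R v)))"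
          by (rule shear_fubini(3)[OF H tl(1), symmetric])
        also have "\<dots> = (LINT x|lborel. \<phi> x * (w (x + t *\<^sub>R v) - w x))"
        proof (rule integral_cong_AE)
          show "AE x in lborel. \<phi> x * (LINT \<tau>:{0..t}|lborel. H (x + \<tau> *\<^sub>R v)) = \<phi> x * (w (x + t *\<^sub>R v) - w x)"
            using elim[rule_format, OF t] by eventually_elim simp
        qed measurable
        also have "\<dots> = - (LINT \<tau>:{0..t}|lborel. ?K \<tau>)"
          by (rule integral_increment_test_function[OF w \<phi>]) (use t in simp)
        finally show "(LINT \<tau>:{0..t}|lborel. ?J \<tau> + ?K \<tau>) = 0"
          using shear_fubini(5)[OF H tl(1), of t v] shear_fubini(5)[OF w tl(2), of t v]
          by (subst set_integral_add) auto
      qed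
    qed
  qed
  then show "(LINT x|lborel. w x * frechet_derivative \<phi> (at x) v) = - (LINT x|lborel. H x * \<phi> x)"
    by simp
qed

lemma AE_line_integrable:
  assumes G: "loc_int G"
  shows "AE x in lborel. set_integrable lborel {0..t} (\<lambda>\<tau>. G (x + \<tau> *\<^sub>R v))"
proof -
  have "AE x in lborel. norm x < real n \<longrightarrow> set_integrable lborel {0..t} (\<lambda>\<tau>. G (x + \<tau> *\<^sub>R v))" for n :: nat
  proof -
    have "test_like (\<lambda>x::'a. max 0 (real n - norm x))"
      unfolding test_like_def by (intro conjI exI[of _ "real n"] continuous_intros) auto
    from shear_fubini(1)[OF G this, of t v] show ?thesis by eventually_elim auto
  qed
  then have "AE x in lborel. \<forall>n::nat. norm x < real n \<longrightarrow> set_integrable lborel {0..t} (\<lambda>\<tau>. G (x + \<tau> *\<^sub>R v))"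
    by (subst AE_all_countable) blast
  then show ?thesis
    by eventually_elim (use reals_Archimedean2 in blast)
qed

text \<open>
  By Fubini's theorem \<open>t \<mapsto> u(x + tv)\<close> agrees almost everywhere, for almost every \<open>x\<close>, with an indefinite
  integral, to which the chain rule on the line applies; a second use of Fubini's theorem returns to
  increments for fixed \<open>t\<close>.
\<close>

lemma weak_dderiv_chain:
  assumes wk: "weak_dderiv u G v"
    and T: "\<And>y. (T has_real_derivative T' y) (at y)" and T': "continuous_on UNIV T'"
    and bT: "\<And>y. \<bar>T y\<bar> \<le> \<bar>y\<bar>" and bT': "\<And>y. \<bar>T' y\<bar> \<le> 1"
  shows "weak_dderiv (\<lambda>x. T (u x)) (\<lambda>x. T' (u x) * G x) v"
proof -
  have u: "loc_int u" and G: "loc_int G" using wk by (auto simp: weak_dderiv_def)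
  note [measurable] = loc_int_measurable[OF u] loc_int_measurable[OF G]
  have "continuous_on UNIV T"
    using T by (auto intro!: continuous_at_imp_continuous_on DERIV_isCont)
  note [measurable] = borel_measurable_continuous_onI[OF this] borel_measurable_continuous_onI[OF T']
  show ?thesis
  proof (rule weak_dderivI)
    show "loc_int (\<lambda>x. T (u x))" by (rule loc_int_bound[OF u]) (use bT in auto)
    show "loc_int (\<lambda>x. T' (u x) * G x)"
      by (rule loc_int_bound[OF G]) (use bT' in \<open>auto simp: abs_mult intro: mult_left_le_one_le\<close>)
    let ?P = "\<lambda>x t. t \<in> {0..1} \<longrightarrow> u (x + t *\<^sub>R v) - u x = (LINT \<tau>:{0..t}|lborel. G (x + \<tau> *\<^sub>R v))"
    let ?Q = "\<lambda>x t. t \<in> {0..1} \<longrightarrow>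
       T (u (x + t *\<^sub>R v)) - T (u x) = (LINT \<tau>:{0..t}|lborel. T' (u (x + \<tau> *\<^sub>R v)) * G (x + \<tau> *\<^sub>R v))"
    have ind: "indicator {0..t} \<tau> = (if 0 \<le> \<tau> \<and> \<tau> \<le> t then 1 else (0::real))" for t \<tau> :: real
      by (auto simp: indicator_def)
    have mP: "{z \<in> space (lborel \<Otimes>\<^sub>M lborel). ?P (fst z) (snd z)} \<in> sets (lborel \<Otimes>\<^sub>M lborel)"
      unfolding set_lebesgue_integral_def ind by measurable
    have mQ: "{z \<in> space (lborel \<Otimes>\<^sub>M lborel). ?Q (fst z) (snd z)} \<in> sets (lborel \<Otimes>\<^sub>M lborel)"
      unfolding set_lebesgue_integral_def ind by measurable
    have "AE t in lborel. AE x in lborel. ?P x t"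
    proof (rule AE_I2)
      show "AE x in lborel. ?P x t" for t
        by (cases "t \<in> {0..1}") (use weak_dderiv_translate[OF wk, of t] in auto)
    qed
    then have "AE x in lborel. AE t in lborel. ?P x t"
      by (simp only: lborel_pair.AE_commute[OF mP])
    moreover have "AE x in lborel. set_integrable lborel {0..1} (\<lambda>\<tau>. G (x + \<tau> *\<^sub>R v))"
      by (rule AE_line_integrable[OF G])
    ultimately have "AE x in lborel. AE t in lborel. ?Q x t"
    proof eventually_elim
      case (elim x)
      let ?f = "\<lambda>\<tau>. G (x + \<tau> *\<^sub>R v)"
      define U where "U t = u x + (LINT \<tau>:{0..t}|lborel. ?f \<tau>)" for t
      have U0: "U 0 = u x"
        using set_borel_integral_eq_integral(2)[OF set_integrable_subset[OF elim(2), of "{0..0}"]]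
        by (simp add: U_def)
      have Uae: "AE t in lborel. t \<in> {0..1} \<longrightarrow> u (x + t *\<^sub>R v) = U t"
        using elim(1) by eventually_elim (auto simp: U_def)
      show ?case
        using Uae
      proof eventually_elim
        case (elim t)
        show ?case
        proof
          assume t: "t \<in> {0..1}"
          have "T (U t) - T (U 0) = (LINT \<tau>:{0..t}|lborel. T' (U \<tau>) * ?f \<tau>)"
          proof (rule chain_rule_indefinite_integral[OF _ _ T T'])
            show "set_integrable lborel {0..t} ?f"
              by (rule set_integrable_subset[OF \<open>set_integrable lborel {0..1} ?f\<close>]) (use t in auto)
          qed (use t U_def in auto)
          also have "\<dots> = (LINT \<tau>:{0..t}|lborel. T' (u (x + \<tau> *\<^sub>R v)) * ?f \<tau>)"
          proof -
            have Um: "(\<lambda>\<tau>. indicator {0..t} \<tau> * U \<tau>) \<in> borel_measurable borel"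
              unfolding U_def set_lebesgue_integral_def ind by measurable
            have e: "indicator {0..t} \<tau> *\<^sub>R (T' (U \<tau>) * ?f \<tau>) =
                indicator {0..t} \<tau> *\<^sub>R (T' (indicator {0..t} \<tau> * U \<tau>) * ?f \<tau>)" for \<tau>
              by (auto simp: indicator_def)
            show ?thesis
              unfolding set_lebesgue_integral_def
            proof (rule integral_cong_AE)
              show "(\<lambda>\<tau>. indicator {0..t} \<tau> *\<^sub>R (T' (U \<tau>) * ?f \<tau>)) \<in> borel_measurable lborel"
                unfolding e using Um by measurable
              show "AE \<tau> in lborel. indicator {0..t} \<tau> *\<^sub>R (T' (U \<tau>) * ?f \<tau>) =
                 indicator {0..t} \<tau> *\<^sub>R (T' (u (x + \<tau> *\<^sub>R v)) * ?f \<tau>)"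
                using Uae by eventually_elim (use t in \<open>auto simp: indicator_def\<close>)
            qed measurable
          qed
          finally show "T (u (x + t *\<^sub>R v)) - T (u x)
              = (LINT \<tau>:{0..t}|lborel. T' (u (x + \<tau> *\<^sub>R v)) * G (x + \<tau> *\<^sub>R v))"
            using elim t U0 by simp
        qed
      qed
    qed
    then have "AE t in lborel. AE x in lborel. ?Q x t"
      by (simp only: lborel_pair.AE_commute[OF mQ])
    then show "AE t in lborel. t \<in> {0<..<1} \<longrightarrow> (AE x in lborel.
       T (u (x + t *\<^sub>R v)) - T (u x) = (LINT \<tau>:{0..t}|lborel. T' (u (x + \<tau> *\<^sub>R v)) * G (x + \<tau> *\<^sub>R v)))"
      by eventually_elim auto
  qed
qed

section \<open>Weak gradients\<close>

text \<open>
  Jensen's inequality up to the factor \<open>2\<close>, which is harmless here: integrate the elementary inequality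
  \<open>y \<le> m + m\<^bsup>1-p\<^esup> y\<^sup>p\<close> and choose \<open>m\<close> such that both terms agree.
\<close>

lemma nn_integral_power_mean:
  fixes f :: "'a \<Rightarrow> real"
  assumes [measurable]: "f \<in> borel_measurable M" "A \<in> sets M"
    and A: "emeasure M A \<le> ennreal l" and l: "l > 0"
    and Q: "(\<integral>\<^sup>+x\<in>A. ennreal (\<bar>f x\<bar> powr p) \<partial>M) \<le> ennreal Q" "Q \<ge> 0" and p: "p > 1"
  shows "(\<integral>\<^sup>+x\<in>A. ennreal \<bar>f x\<bar> \<partial>M) \<le> ennreal (2 * l powr (1 - 1 / p) * Q powr (1 / p))"
proof -
  have *: "(\<integral>\<^sup>+x\<in>A. ennreal \<bar>f x\<bar> \<partial>M) \<le> ennreal (m * l + m powr (1 - p) * Q)" if m: "m > 0" for m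
  proof -
    have pt: "\<bar>y\<bar> \<le> m + m powr (1 - p) * \<bar>y\<bar> powr p" for y :: real
    proof (cases "\<bar>y\<bar> \<le> m")
      case False
      then have "\<bar>y\<bar> = \<bar>y\<bar> powr (1 - p) * \<bar>y\<bar> powr p" using m by (simp flip: powr_add)
      also have "\<dots> \<le> m powr (1 - p) * \<bar>y\<bar> powr p"
        using False m p by (intro mult_right_mono powr_mono2') auto
      finally show ?thesis using m by simp
    qed (use m in \<open>simp add: add_increasing2\<close>)
    have "(\<integral>\<^sup>+x\<in>A. ennreal \<bar>f x\<bar> \<partial>M)
      \<le> (\<integral>\<^sup>+x. ennreal m * indicator A x + ennreal (m powr (1 - p)) * (ennreal (\<bar>f x\<bar> powr p) * indicator A x) \<partial>M)"
      using pt m by (intro nn_integral_mono)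
        (auto simp: indicator_def ennreal_mult'[symmetric] ennreal_plus[symmetric] intro!: ennreal_leI simp del: ennreal_plus)
    also have "\<dots> = ennreal m * emeasure M A + ennreal (m powr (1 - p)) * (\<integral>\<^sup>+x\<in>A. ennreal (\<bar>f x\<bar> powr p) \<partial>M)"
      by (simp add: nn_integral_add nn_integral_cmult)
    also have "\<dots> \<le> ennreal m * ennreal l + ennreal (m powr (1 - p)) * ennreal Q"
      using A Q by (intro add_mono mult_left_mono) auto
    also have "\<dots> = ennreal (m * l + m powr (1 - p) * Q)"
      using m l Q by (simp add: ennreal_mult'[symmetric])
    finally show ?thesis .
  qed
  show ?thesis
  proof (cases "Q = 0")
    case True
    have small: "(\<integral>\<^sup>+x\<in>A. ennreal \<bar>f x\<bar> \<partial>M) \<le> 0 + ennreal e" if "e > 0" for e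
      using *[of "e / l"] that l True by simp
    then have "(\<integral>\<^sup>+x\<in>A. ennreal \<bar>f x\<bar> \<partial>M) \<le> 0"
      using small by (metis ennreal_le_epsilon)
    then show ?thesis by simp
  next
    case False
    then have Qp: "Q > 0" using Q by simp
    \<comment> \<open>the value of \<open>m\<close> for which both summands are equal\<close>
    let ?m = "(Q / l) powr (1 / p)"
    have "?m * l = l powr (1 - 1 / p) * Q powr (1 / p)"
      using l Qp by (simp add: powr_divide powr_diff)
    moreover have "?m powr (1 - p) * Q = l powr (1 - 1 / p) * Q powr (1 / p)"
    proof -
      have "?m powr (1 - p) = Q powr ((1 - p) / p) / l powr ((1 - p) / p)"
        using l Qp by (simp add: powr_powr powr_divide)
      also have "\<dots> * Q = Q powr (1 + (1 - p) / p) * l powr (- ((1 - p) / p))"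
        using l Qp by (simp add: powr_add powr_minus field_simps)
      also have "1 + (1 - p) / p = 1 / p"
        using p by (auto simp: field_simps)
      also have "- ((1 - p) / p) = 1 - 1 / p"
        using p by (auto simp: field_simps)
      finally show ?thesis by simp
    qed
    ultimately show ?thesis using *[of ?m] l Qp by (simp add: mult_ac)
  qed
qed

lemma loc_int_of_locally_integrable:
  fixes f :: "real ^ 'n \<Rightarrow> real"
  assumes f: "locally_integrable f" and [measurable]: "f \<in> borel_measurable borel"
  shows "loc_int f"
  unfolding loc_int_def
proof (intro conjI allI)
  fix R :: real
  have "integrable lebesgue (\<lambda>x. indicator (cball 0 R) x *\<^sub>R f x)"
    using f by (auto simp: locally_integrable_def set_integrable_def)
  then have "integrable lborel (\<lambda>x. indicator (cball 0 R) x *\<^sub>R f x)"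
    by (subst (asm) integrable_completion) auto
  moreover have "(\<integral>\<^sup>+x\<in>cball 0 R. ennreal \<bar>f x\<bar> \<partial>lborel) = (\<integral>\<^sup>+x. ennreal (norm (indicator (cball 0 R) x *\<^sub>R f x)) \<partial>lborel)"
    by (intro nn_integral_cong) (auto simp: indicator_def)
  ultimately show "(\<integral>\<^sup>+x\<in>cball 0 R. ennreal \<bar>f x\<bar> \<partial>lborel) < \<infinity>"
    by (simp add: integrable_iff_bounded)
qed simp

lemma locally_integrable_cong_AE:
  assumes f: "locally_integrable f" and g: "g \<in> borel_measurable lebesgue" and e: "AE x in lebesgue. f x = g x"
  shows "locally_integrable g"
  unfolding locally_integrable_def set_integrable_def
proof (intro allI impI)
  fix K assume K: "compact (K :: (real ^ 'a) set)"
  show "integrable lebesgue (\<lambda>x. indicator K x *\<^sub>R g x)"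
  proof (rule integrable_cong_AE_imp)
    show "integrable lebesgue (\<lambda>x. indicator K x *\<^sub>R f x)"
      using f K by (auto simp: locally_integrable_def set_integrable_def)
    show "AE x in lebesgue. indicator K x *\<^sub>R f x = indicator K x *\<^sub>R g x"
      using e by eventually_elim simp
    have "K \<in> sets lebesgue" using borel_compact[OF K] by simp
    then show "(\<lambda>x. indicator K x *\<^sub>R g x) \<in> borel_measurable lebesgue"
      using g by (intro borel_measurable_scaleR borel_measurable_indicator)
  qed
qed

lemma borel_measurable_vec_nth:
  fixes g :: "'a \<Rightarrow> real ^ 'n"
  assumes [measurable]: "g \<in> borel_measurable M"
  shows "(\<lambda>x. g x $ i) \<in> borel_measurable M"
proof -
  have "(\<lambda>x. g x \<bullet> axis i 1) \<in> borel_measurable M" by measurable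
  then show ?thesis by (simp add: inner_axis)
qed

lemma locally_integrable_nth:
  fixes g :: "real ^ 'n \<Rightarrow> real ^ 'n"
  assumes "locally_integrable g"
  shows "locally_integrable (\<lambda>x. g x $ i)"
  unfolding locally_integrable_def set_integrable_def
proof (intro allI impI)
  fix K assume K: "compact (K :: (real ^ 'n) set)"
  have "integrable lebesgue (\<lambda>x. (indicator K x *\<^sub>R g x) \<bullet> axis i 1)"
    using assms K unfolding locally_integrable_def set_integrable_def
    by (intro integrable_inner_left) auto
  then show "integrable lebesgue (\<lambda>x. indicator K x *\<^sub>R (g x $ i))"
    by (simp add: inner_axis)
qed

lemma borel_measurable_vec_lambda_component:
  fixes g :: "'a \<Rightarrow> real ^ 'n"
  assumes "\<And>i. (\<lambda>x. g x $ i) \<in> borel_measurable M"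
  shows "g \<in> borel_measurable M"
proof -
  have "g = (\<lambda>x. \<Sum>i\<in>UNIV. (g x $ i) *\<^sub>R axis i 1)"
    by (simp add: basis_expansion flip: scalar_mult_eq_scaleR)
  also have "\<dots> \<in> borel_measurable M"
    using assms by (intro borel_measurable_sum borel_measurable_scaleR) auto
  finally show ?thesis .
qed

lemma has_weak_gradient_cong_AE:
  assumes "has_weak_gradient u g" and "u' \<in> borel_measurable lebesgue" "g' \<in> borel_measurable lebesgue"
    and u: "AE x in lebesgue. u x = u' x" and g: "AE x in lebesgue. g x = g' x"
  shows "has_weak_gradient u' g'"
  unfolding has_weak_gradient_def
proof (intro conjI allI impI)
  have lu: "locally_integrable u" and lg: "locally_integrable g" using assms by (auto simp: has_weak_gradient_def)
  show "locally_integrable u'" by (rule locally_integrable_cong_AE[OF lu]) fact+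
  show lg': "locally_integrable g'" by (rule locally_integrable_cong_AE[OF lg]) fact+
  fix \<phi> :: "real ^ 'a \<Rightarrow> real" and i assume \<phi>: "test_function \<phi>"
  note tl = test_function_test_like[OF \<phi>]
  have [measurable]: "\<phi> \<in> borel_measurable lebesgue" "(\<lambda>x. frechet_derivative \<phi> (at x) (axis i 1)) \<in> borel_measurable lebesgue"
    using test_like_measurable[OF tl(1)] test_like_measurable[OF tl(2)] by (auto intro!: measurable_completion)
  note [measurable] = locally_integrable_measurable[OF lu] locally_integrable_measurable[OF locally_integrable_nth[OF lg], of i]
    assms(2) locally_integrable_measurable[OF locally_integrable_nth[OF lg'], of i]
  have "(LINT x|lebesgue. u x * frechet_derivative \<phi> (at x) (axis i 1)) = (LINT x|lebesgue. u' x * frechet_derivative \<phi> (at x) (axis i 1))"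
  proof (rule integral_cong_AE)
    show "AE x in lebesgue. u x * frechet_derivative \<phi> (at x) (axis i 1) = u' x * frechet_derivative \<phi> (at x) (axis i 1)"
      using u by eventually_elim simp
  qed measurable
  moreover have "(LINT x|lebesgue. g x $ i * \<phi> x) = (LINT x|lebesgue. g' x $ i * \<phi> x)"
  proof (rule integral_cong_AE)
    show "AE x in lebesgue. g x $ i * \<phi> x = g' x $ i * \<phi> x"
      using g by eventually_elim simp
  qed measurable
  ultimately show "(LINT x|lebesgue. u' x * frechet_derivative \<phi> (at x) (axis i 1)) = - (LINT x|lebesgue. g' x $ i * \<phi> x)"
    using assms(1) \<phi> by (simp add: has_weak_gradient_def)
qed

text \<open>
  A weak gradient may be replaced by a Borel representative, which makes the results on
  directional derivatives available.
\<close>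

lemma has_weak_gradient_borel:
  assumes "has_weak_gradient u g" and u: "u \<in> borel_measurable borel"
  obtains g' where "g' \<in> borel_measurable borel" "AE x in lborel. g x = g' x" "has_weak_gradient u g'"
proof -
  have lg: "locally_integrable g" using assms by (auto simp: has_weak_gradient_def)
  have "\<exists>G\<in>borel_measurable borel. AE x in lborel. g x $ i = G x" for i
    using completion_ex_borel_measurable_real[OF locally_integrable_measurable[OF locally_integrable_nth[OF lg], of i]] by auto
  then obtain G where G: "\<And>i. G i \<in> borel_measurable borel" "\<And>i. AE x in lborel. g x $ i = G i x"
    by metis
  define g' where "g' x = (\<chi> i. G i x)" for x
  have m: "g' \<in> borel_measurable borel"
    by (rule borel_measurable_vec_lambda_component) (simp add: g'_def G)
  have "AE x in lborel. \<forall>i\<in>UNIV. g x $ i = G i x"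
    using G by (subst AE_finite_all) auto
  then have ae: "AE x in lborel. g x = g' x"
    by eventually_elim (simp add: g'_def vec_eq_iff)
  have "has_weak_gradient u g'"
    by (rule has_weak_gradient_cong_AE[OF assms(1)])
      (use u m ae in \<open>auto intro: measurable_completion AE_completion\<close>)
  then show thesis using that m ae by blast
qed

lemma has_weak_gradient_imp_dderiv:
  assumes wk: "has_weak_gradient u g" and [measurable]: "u \<in> borel_measurable borel" "g \<in> borel_measurable borel"
  shows "weak_dderiv u (\<lambda>x. g x \<bullet> v) v"
  unfolding weak_dderiv_def
proof (intro conjI allI impI)
  have lu: "locally_integrable u" and lg: "locally_integrable g" using assms by (auto simp: has_weak_gradient_def)
  show u: "loc_int u" by (rule loc_int_of_locally_integrable[OF lu]) simp
  have [measurable]: "(\<lambda>x. g x $ i) \<in> borel_measurable borel" for i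
    by (rule borel_measurable_vec_nth) simp
  have g: "loc_int (\<lambda>x. g x $ i)" for i
    by (rule loc_int_of_locally_integrable[OF locally_integrable_nth[OF lg]]) simp
  have inner: "g x \<bullet> v = (\<Sum>i\<in>UNIV. v $ i * g x $ i)" for x
    by (simp add: inner_vec_def mult.commute)
  show "loc_int (\<lambda>x. g x \<bullet> v)"
  proof (rule loc_intI)
    fix h :: "real ^ 'a \<Rightarrow> real" assume h: "test_like h"
    have "integrable lborel (\<lambda>x. \<Sum>i\<in>UNIV. v $ i * (g x $ i * h x))"
      by (intro Bochner_Integration.integrable_sum integrable_mult_right loc_int_mult_integrable g h)
    then show "integrable lborel (\<lambda>x. h x * (g x \<bullet> v))"
      by (simp add: inner sum_distrib_left algebra_simps)
  qed measurable
  fix \<phi> :: "real ^ 'a \<Rightarrow> real" assume \<phi>: "test_function \<phi>"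
  note tl = test_function_test_like[OF \<phi>]
  note [measurable] = test_like_measurable[OF tl(1)] test_like_measurable[OF tl(2)]
  have c: "(LINT x|lborel. u x * frechet_derivative \<phi> (at x) (axis i 1)) = - (LINT x|lborel. g x $ i * \<phi> x)" for i
  proof -
    have "(LINT x|lebesgue. u x * frechet_derivative \<phi> (at x) (axis i 1)) = (LINT x|lborel. u x * frechet_derivative \<phi> (at x) (axis i 1))"
      by (rule integral_completion) measurable
    moreover have "(LINT x|lebesgue. g x $ i * \<phi> x) = (LINT x|lborel. g x $ i * \<phi> x)"
      by (rule integral_completion) measurable
    ultimately show ?thesis
      using wk \<phi> by (simp add: has_weak_gradient_def)
  qed
  have "(LINT x|lborel. u x * frechet_derivative \<phi> (at x) v)
      = (LINT x|lborel. (\<Sum>i\<in>UNIV. v $ i * (u x * frechet_derivative \<phi> (at x) (axis i 1))))"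
    by (subst frechet_derivative_eq_sum[OF test_function_has_derivative[OF \<phi>]]) (simp add: sum_distrib_left algebra_simps)
  also have "\<dots> = (\<Sum>i\<in>UNIV. v $ i * (LINT x|lborel. u x * frechet_derivative \<phi> (at x) (axis i 1)))"
    by (subst Bochner_Integration.integral_sum) (auto intro!: integrable_mult_right loc_int_mult_integrable u tl)
  also have "\<dots> = - (\<Sum>i\<in>UNIV. v $ i * (LINT x|lborel. g x $ i * \<phi> x))"
    by (simp add: c sum_negf)
  also have "(\<Sum>i\<in>UNIV. v $ i * (LINT x|lborel. g x $ i * \<phi> x)) = (LINT x|lborel. (\<Sum>i\<in>UNIV. v $ i * (g x $ i * \<phi> x)))"
    by (subst Bochner_Integration.integral_sum) (auto intro!: integrable_mult_right loc_int_mult_integrable g tl)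
  also have "\<dots> = (LINT x|lborel. (g x \<bullet> v) * \<phi> x)"
    by (simp add: inner sum_distrib_right mult.assoc)
  finally show "(LINT x|lborel. u x * frechet_derivative \<phi> (at x) v) = - (LINT x|lborel. (g x \<bullet> v) * \<phi> x)" .
qed

lemma has_weak_gradientI:
  assumes [measurable]: "u \<in> borel_measurable borel" "g \<in> borel_measurable borel"
    and d: "\<And>i. weak_dderiv u (\<lambda>x. g x $ i) (axis i 1)"
  shows "has_weak_gradient u g"
  unfolding has_weak_gradient_def
proof (intro conjI allI impI)
  show "locally_integrable u" using d by (auto simp: weak_dderiv_def intro: loc_int_locally_integrable)
  show "locally_integrable g"
    unfolding locally_integrable_def set_integrable_def
  proof (intro allI impI)
    fix K assume K: "compact (K :: (real ^ 'a) set)"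
    have "integrable lebesgue (\<lambda>x. indicator K x *\<^sub>R (g x $ i))" for i
      using loc_int_locally_integrable[of "\<lambda>x. g x $ i"] d[of i] K
      by (auto simp: weak_dderiv_def locally_integrable_def set_integrable_def)
    then have "integrable lebesgue (\<lambda>x. \<Sum>i\<in>UNIV. (indicator K x *\<^sub>R (g x $ i)) *\<^sub>R axis i 1)"
      by (intro Bochner_Integration.integrable_sum integrable_scaleR_left) auto
    also have "(\<lambda>x. \<Sum>i\<in>UNIV. (indicator K x *\<^sub>R (g x $ i)) *\<^sub>R axis i 1) = (\<lambda>x. indicator K x *\<^sub>R g x)"
    proof
      show "(\<Sum>i\<in>UNIV. (indicator K x *\<^sub>R (g x $ i)) *\<^sub>R axis i 1) = indicator K x *\<^sub>R g x" for x
        using basis_expansion[of "g x"]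
        by (simp add: scalar_mult_eq_scaleR flip: scaleR_sum_right scaleR_scaleR)
    qed
    finally show "integrable lebesgue (\<lambda>x. indicator K x *\<^sub>R g x)" .
  qed
  fix \<phi> :: "real ^ 'a \<Rightarrow> real" and i assume \<phi>: "test_function \<phi>"
  note tl = test_function_test_like[OF \<phi>]
  note [measurable] = test_like_measurable[OF tl(1)] test_like_measurable[OF tl(2)]
  have [measurable]: "(\<lambda>x. g x $ i) \<in> borel_measurable borel" for i
    by (rule borel_measurable_vec_nth) simp
  show "(LINT x|lebesgue. u x * frechet_derivative \<phi> (at x) (axis i 1)) = - (LINT x|lebesgue. g x $ i * \<phi> x)"
    using d[of i] \<phi> by (simp add: weak_dderiv_def integral_completion)
qed

lemma weak_gradient_unique:
  assumes "has_weak_gradient u g1" "has_weak_gradient u g2" and u: "u \<in> borel_measurable borel"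
  shows "AE x in lborel. g1 x = g2 x"
proof -
  obtain h1 where h1: "h1 \<in> borel_measurable borel" "AE x in lborel. g1 x = h1 x" "has_weak_gradient u h1"
    by (rule has_weak_gradient_borel[OF assms(1) u])
  obtain h2 where h2: "h2 \<in> borel_measurable borel" "AE x in lborel. g2 x = h2 x" "has_weak_gradient u h2"
    by (rule has_weak_gradient_borel[OF assms(2) u])
  have "AE x in lborel. h1 x \<bullet> axis i 1 - h2 x \<bullet> axis i 1 = 0" for i
  proof (rule fundamental_lemma_borel)
    note d = has_weak_gradient_imp_dderiv[OF h1(3) u h1(1), of "axis i 1"]
      has_weak_gradient_imp_dderiv[OF h2(3) u h2(1), of "axis i 1"]
    then have l: "loc_int (\<lambda>x. h1 x \<bullet> axis i 1)" "loc_int (\<lambda>x. h2 x \<bullet> axis i 1)"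
      by (auto simp: weak_dderiv_def)
    show "loc_int (\<lambda>x. h1 x \<bullet> axis i 1 - h2 x \<bullet> axis i 1)" by (intro loc_int_diff l)
    fix \<phi> :: "real ^ 'a \<Rightarrow> real" assume \<phi>: "test_function \<phi>"
    show "(LINT x|lborel. (h1 x \<bullet> axis i 1 - h2 x \<bullet> axis i 1) * \<phi> x) = 0"
      using d \<phi> loc_int_mult_integrable[OF l(1) test_function_test_like(1)[OF \<phi>]]
        loc_int_mult_integrable[OF l(2) test_function_test_like(1)[OF \<phi>]]
      by (simp add: weak_dderiv_def left_diff_distrib)
  qed
  then have "AE x in lborel. \<forall>i\<in>UNIV. h1 x \<bullet> axis i 1 - h2 x \<bullet> axis i 1 = 0"
    by (subst AE_finite_all) auto
  then show ?thesis
    using h1(2) h2(2) by eventually_elim (auto simp: vec_eq_iff inner_axis)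
qed

lemma weak_gradient_AE:
  assumes "has_weak_gradient u g" "u \<in> borel_measurable borel"
  shows "has_weak_gradient u (weak_gradient u)" "AE x in lborel. weak_gradient u x = g x"
proof -
  show 1: "has_weak_gradient u (weak_gradient u)"
    using someI[of "has_weak_gradient u" g] assms(1) by (simp add: weak_gradient_def)
  show "AE x in lborel. weak_gradient u x = g x"
    by (rule weak_gradient_unique[OF 1 assms])
qed

text \<open>
  The chosen weak gradients obey the chain rule as well, because weak gradients are unique almost
  everywhere.
\<close>

lemma weak_gradient_chain:
  assumes wk: "has_weak_gradient u g" and u[measurable]: "u \<in> borel_measurable borel"
    and T: "\<And>y. (T has_real_derivative T' y) (at y)" and T': "continuous_on UNIV T'"
    and bT: "\<And>y. \<bar>T y\<bar> \<le> \<bar>y\<bar>" and bT': "\<And>y. \<bar>T' y\<bar> \<le> 1"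
  shows "has_weak_gradient (\<lambda>x. T (u x)) (weak_gradient (\<lambda>x. T (u x)))"
    and "AE x in lborel. weak_gradient (\<lambda>x. T (u x)) x = T' (u x) *\<^sub>R weak_gradient u x"
proof -
  have "continuous_on UNIV T"
    using T by (auto intro!: continuous_at_imp_continuous_on DERIV_isCont)
  note [measurable] = borel_measurable_continuous_onI[OF this] borel_measurable_continuous_onI[OF T']
  obtain h where h[measurable]: "h \<in> borel_measurable borel" "AE x in lborel. g x = h x" "has_weak_gradient u h"
    by (rule has_weak_gradient_borel[OF wk u])
  have "weak_dderiv u (\<lambda>x. h x $ i) (axis i 1)" for i
    using has_weak_gradient_imp_dderiv[OF h(3) u h(1), of "axis i 1"] by (simp add: inner_axis)
  from weak_dderiv_chain[OF this T T' bT bT']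
  have "has_weak_gradient (\<lambda>x. T (u x)) (\<lambda>x. T' (u x) *\<^sub>R h x)"
    by (intro has_weak_gradientI) auto
  note w = weak_gradient_AE[OF this]
  show "has_weak_gradient (\<lambda>x. T (u x)) (weak_gradient (\<lambda>x. T (u x)))"
    by (rule w) measurable
  have "AE x in lborel. weak_gradient (\<lambda>x. T (u x)) x = T' (u x) *\<^sub>R h x"
    by (rule w) measurable
  with weak_gradient_AE(2)[OF h(3) u]
  show "AE x in lborel. weak_gradient (\<lambda>x. T (u x)) x = T' (u x) *\<^sub>R weak_gradient u x"
    by eventually_elim simp
qed

section \<open>Oscillation over pairs of nearby points\<close>

text \<open>
  The common quantity through which both seminorms act on the pointwise estimate. If it is at most
  \<open>K r\<^bsup>N+\<sigma>p\<^esup>\<close> for all \<open>r > 0\<close>, then \<open>w\<close> has regularity of order \<open>\<sigma>\<close> in the sense of Besov and Nikolskii.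
\<close>

definition oscillation :: "real \<Rightarrow> (real ^ 'n \<Rightarrow> real) \<Rightarrow> real \<Rightarrow> ennreal" where
  "oscillation p w r =
     (\<integral>\<^sup>+x. \<integral>\<^sup>+y. ennreal (if dist x y < r then \<bar>w x - w y\<bar> powr p else 0) \<partial>lborel \<partial>lborel)"

text \<open>
  Where \<open>|x - y| < r\<close> the Gagliardo kernel is at least \<open>r\<^bsup>-N-sp\<^esup>\<close>.
\<close>

lemma oscillation_gagliardo:
  fixes w :: "real ^ 'n \<Rightarrow> real"
  assumes [measurable]: "w \<in> borel_measurable borel" and r: "r > 0" and s: "0 < s" "1 < p"
  shows "oscillation p w r \<le> ennreal (r powr (real CARD('n) + s * p)) * gagliardo_pow s p w"
proof -
  let ?N = "real CARD('n) + s * p"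
  have N: "?N > 0" using s by (simp add: add_nonneg_pos)
  let ?F = "\<lambda>(x, y). ennreal (\<bar>w x - w y\<bar> powr p / norm (x - y) powr ?N)"
  have "gagliardo_pow s p w = integral\<^sup>N (lborel \<Otimes>\<^sub>M lborel) ?F"
    by (simp add: gagliardo_pow_def nn_integral_completion lborel_prod)
  also have "\<dots> = (\<integral>\<^sup>+x. \<integral>\<^sup>+y. ?F (x, y) \<partial>lborel \<partial>lborel)"
    by (rule lborel.nn_integral_fst[symmetric]) measurable
  finally have G: "gagliardo_pow s p w = (\<integral>\<^sup>+x. \<integral>\<^sup>+y. ?F (x, y) \<partial>lborel \<partial>lborel)" .
  have "oscillation p w r \<le> (\<integral>\<^sup>+x. \<integral>\<^sup>+y. ennreal (r powr ?N) * ?F (x, y) \<partial>lborel \<partial>lborel)"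
    unfolding oscillation_def
  proof (intro nn_integral_mono)
    fix x y :: "real ^ 'n"
    show "ennreal (if dist x y < r then \<bar>w x - w y\<bar> powr p else 0) \<le> ennreal (r powr ?N) * ?F (x, y)"
    proof (cases "x = y")
      case False
      then have n: "norm (x - y) > 0" by simp
      have "\<bar>w x - w y\<bar> powr p \<le> r powr ?N * (\<bar>w x - w y\<bar> powr p / norm (x - y) powr ?N)" if "dist x y < r"
      proof -
        have "1 * \<bar>w x - w y\<bar> powr p \<le> (r powr ?N / norm (x - y) powr ?N) * \<bar>w x - w y\<bar> powr p"
          using that n N by (intro mult_right_mono) (auto simp: dist_norm intro!: powr_mono2)
        then show ?thesis by simp
      qed
      then show ?thesis by (auto simp: ennreal_mult'[symmetric] intro!: ennreal_leI)
    qed (use s in simp)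
  qed
  also have "\<dots> = ennreal (r powr ?N) * gagliardo_pow s p w"
    unfolding G by (subst nn_integral_cmult[symmetric], measurable) (simp add: nn_integral_cmult)
  finally show ?thesis .
qed

lemma set_integral_norm_le:
  fixes f :: "real \<Rightarrow> real"
  shows "ennreal \<bar>LINT s:A|lborel. f s\<bar> \<le> (\<integral>\<^sup>+s\<in>A. ennreal \<bar>f s\<bar> \<partial>lborel)"
proof -
  have "ennreal \<bar>LINT s:A|lborel. f s\<bar> \<le> (\<integral>\<^sup>+s. ennreal (norm (indicator A s *\<^sub>R f s)) \<partial>lborel)"
    unfolding set_lebesgue_integral_def
    by (cases "integrable lborel (\<lambda>s. indicator A s *\<^sub>R f s)")
      (use integral_norm_bound_ennreal in \<open>force simp: not_integrable_integral_eq\<close>)+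
  also have "\<dots> = (\<integral>\<^sup>+s\<in>A. ennreal \<bar>f s\<bar> \<partial>lborel)"
    by (intro nn_integral_cong) (auto simp: indicator_def)
  finally show ?thesis .
qed

text \<open>
  The increment is the integral of the gradient along a segment; Jensen's inequality and
  translation invariance give the estimate in \<open>L\<^sup>p\<close>.
\<close>

lemma increment_gradient:
  fixes w :: "real ^ 'n \<Rightarrow> real"
  assumes wk: "has_weak_gradient w g" and [measurable]: "w \<in> borel_measurable borel" "g \<in> borel_measurable borel"
    and p: "p > 1"
  shows "(\<integral>\<^sup>+x. ennreal (\<bar>w (x + v) - w x\<bar> powr p) \<partial>lborel)
    \<le> ennreal (2 powr p * norm v powr p) * (\<integral>\<^sup>+x. ennreal (norm (g x) powr p) \<partial>lborel)"
proof -
  let ?G = "\<lambda>x. g x \<bullet> v"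
  let ?I = "\<lambda>x. (\<integral>\<^sup>+\<tau>\<in>{0..1}. ennreal (\<bar>?G (x + \<tau> *\<^sub>R v)\<bar> powr p) \<partial>lborel)"
  have jensen: "ennreal (\<bar>LINT \<tau>:{0..1}|lborel. ?G (x + \<tau> *\<^sub>R v)\<bar> powr p) \<le> ennreal (2 powr p) * ?I x" for x
  proof (cases "?I x = \<infinity>")
    case True
    then show ?thesis by (simp add: ennreal_mult_top)
  next
    case False
    then obtain Q where Q: "?I x = ennreal Q" "Q \<ge> 0" by (cases "?I x") auto
    have 1: "(\<integral>\<^sup>+\<tau>\<in>{0..1}. ennreal \<bar>?G (x + \<tau> *\<^sub>R v)\<bar> \<partial>lborel) \<le> ennreal (2 * 1 powr (1 - 1 / p) * Q powr (1 / p))"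
      by (rule nn_integral_power_mean) (use Q p in auto)
    have "ennreal \<bar>LINT \<tau>:{0..1}|lborel. ?G (x + \<tau> *\<^sub>R v)\<bar> \<le> (\<integral>\<^sup>+\<tau>\<in>{0..1}. ennreal \<bar>?G (x + \<tau> *\<^sub>R v)\<bar> \<partial>lborel)"
      by (rule set_integral_norm_le)
    also note 1
    finally have "\<bar>LINT \<tau>:{0..1}|lborel. ?G (x + \<tau> *\<^sub>R v)\<bar> \<le> 2 * Q powr (1 / p)"
      by simp
    then have "\<bar>LINT \<tau>:{0..1}|lborel. ?G (x + \<tau> *\<^sub>R v)\<bar> powr p \<le> (2 * Q powr (1 / p)) powr p"
      using p by (intro powr_mono2) auto
    also have "\<dots> = 2 powr p * Q" using p Q by (simp add: powr_mult powr_powr)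
    finally show ?thesis unfolding Q(1) using Q(2) by (simp add: ennreal_mult'[symmetric] ennreal_leI)
  qed
  have "(\<integral>\<^sup>+x. ennreal (\<bar>w (x + v) - w x\<bar> powr p) \<partial>lborel) \<le> (\<integral>\<^sup>+x. ennreal (2 powr p) * ?I x \<partial>lborel)"
  proof (rule nn_integral_mono_AE)
    show "AE x in lborel. ennreal (\<bar>w (x + v) - w x\<bar> powr p) \<le> ennreal (2 powr p) * ?I x"
      using weak_dderiv_translate[OF has_weak_gradient_imp_dderiv[OF wk], of 1 v]
      by (auto elim!: eventually_mono simp: jensen)
  qed
  also have "\<dots> = ennreal (2 powr p) * (\<integral>\<^sup>+x. ?I x \<partial>lborel)"
    by (rule nn_integral_cmult) measurable
  also have "(\<integral>\<^sup>+x. ?I x \<partial>lborel) = (\<integral>\<^sup>+\<tau>. \<integral>\<^sup>+x. ennreal (\<bar>?G (x + \<tau> *\<^sub>R v)\<bar> powr p) * indicator {0..1} \<tau> \<partial>lborel \<partial>lborel)"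
    by (rule lborel_pair.Fubini'[symmetric]) measurable
  also have "\<dots> \<le> (\<integral>\<^sup>+\<tau>. ennreal (norm v powr p) * (\<integral>\<^sup>+x. ennreal (norm (g x) powr p) \<partial>lborel) * indicator {0..1::real} \<tau> \<partial>lborel)"
  proof (rule nn_integral_mono)
    fix \<tau> :: real
    have "(\<integral>\<^sup>+x. ennreal (\<bar>?G (x + \<tau> *\<^sub>R v)\<bar> powr p) \<partial>lborel) = (\<integral>\<^sup>+x. ennreal (\<bar>?G x\<bar> powr p) \<partial>lborel)"
      by (rule nn_integral_lborel_translate) measurable
    also have "\<dots> \<le> (\<integral>\<^sup>+x. ennreal (norm v powr p) * ennreal (norm (g x) powr p) \<partial>lborel)"
    proof (rule nn_integral_mono)
      fix x
      have "\<bar>?G x\<bar> powr p \<le> (norm (g x) * norm v) powr p"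
        using p Cauchy_Schwarz_ineq2 by (intro powr_mono2) auto
      then show "ennreal (\<bar>?G x\<bar> powr p) \<le> ennreal (norm v powr p) * ennreal (norm (g x) powr p)"
        by (simp add: ennreal_mult'[symmetric] powr_mult mult.commute ennreal_leI)
    qed
    also have "\<dots> = ennreal (norm v powr p) * (\<integral>\<^sup>+x. ennreal (norm (g x) powr p) \<partial>lborel)"
      by (rule nn_integral_cmult) measurable
    finally show "(\<integral>\<^sup>+x. ennreal (\<bar>?G (x + \<tau> *\<^sub>R v)\<bar> powr p) * indicator {0..1} \<tau> \<partial>lborel)
        \<le> ennreal (norm v powr p) * (\<integral>\<^sup>+x. ennreal (norm (g x) powr p) \<partial>lborel) * indicator {0..1::real} \<tau>"
      by (auto simp: indicator_def)
  qed
  also have "\<dots> = ennreal (norm v powr p) * (\<integral>\<^sup>+x. ennreal (norm (g x) powr p) \<partial>lborel)"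
    by (simp add: nn_integral_cmult)
  finally show ?thesis
    by (simp add: ennreal_mult' mult.assoc mult_left_mono)
qed

lemma oscillation_gradient:
  fixes w :: "real ^ 'n \<Rightarrow> real"
  assumes wk: "has_weak_gradient w g" and [measurable]: "w \<in> borel_measurable borel" "g \<in> borel_measurable borel"
    and p: "p > 1" and r: "r > 0"
  shows "oscillation p w r
    \<le> ennreal (2 powr p * unit_ball_vol (real CARD('n)) * r powr (real CARD('n) + p)) * (\<integral>\<^sup>+x. ennreal (norm (g x) powr p) \<partial>lborel)"
proof -
  let ?E = "\<integral>\<^sup>+x. ennreal (norm (g x) powr p) \<partial>lborel"
  let ?f = "\<lambda>x v. ennreal (\<bar>w (x + v) - w x\<bar> powr p) * indicator (ball 0 r) v"
  have [measurable]: "ball 0 r \<in> sets (borel :: (real ^ 'n) measure)" by simp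
  have "oscillation p w r = (\<integral>\<^sup>+x. \<integral>\<^sup>+v. ?f x v \<partial>lborel \<partial>lborel)"
    unfolding oscillation_def
  proof (rule nn_integral_cong)
    fix x
    have "(\<integral>\<^sup>+y. ennreal (if dist x y < r then \<bar>w x - w y\<bar> powr p else 0) \<partial>lborel)
        = (\<integral>\<^sup>+y. ennreal (if dist x (y + x) < r then \<bar>w x - w (y + x)\<bar> powr p else 0) \<partial>lborel)"
      by (rule nn_integral_lborel_translate[symmetric]) measurable
    also have "\<dots> = (\<integral>\<^sup>+v. ?f x v \<partial>lborel)"
      by (intro nn_integral_cong) (auto simp: indicator_def dist_norm abs_minus_commute add.commute)
    finally show "(\<integral>\<^sup>+y. ennreal (if dist x y < r then \<bar>w x - w y\<bar> powr p else 0) \<partial>lborel) = (\<integral>\<^sup>+v. ?f x v \<partial>lborel)" .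
  qed
  also have "\<dots> = (\<integral>\<^sup>+v. \<integral>\<^sup>+x. ?f x v \<partial>lborel \<partial>lborel)"
    by (rule lborel_pair.Fubini'[symmetric]) measurable
  also have "\<dots> \<le> (\<integral>\<^sup>+v. ennreal (2 powr p * r powr p) * ?E * indicator (ball 0 r) (v :: real ^ 'n) \<partial>lborel)"
  proof (rule nn_integral_mono)
    fix v :: "real ^ 'n"
    have "(\<integral>\<^sup>+x. ennreal (\<bar>w (x + v) - w x\<bar> powr p) \<partial>lborel) \<le> ennreal (2 powr p * r powr p) * ?E" if "norm v < r"
    proof -
      have "(\<integral>\<^sup>+x. ennreal (\<bar>w (x + v) - w x\<bar> powr p) \<partial>lborel) \<le> ennreal (2 powr p * norm v powr p) * ?E"
        by (rule increment_gradient[OF wk _ _ p]) measurable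
      also have "\<dots> \<le> ennreal (2 powr p * r powr p) * ?E"
        using that p by (intro mult_right_mono ennreal_leI mult_left_mono powr_mono2) auto
      finally show ?thesis .
    qed
    then show "(\<integral>\<^sup>+x. ?f x v \<partial>lborel) \<le> ennreal (2 powr p * r powr p) * ?E * indicator (ball 0 r) v"
      by (auto simp: indicator_def)
  qed
  also have "\<dots> = ennreal (2 powr p * r powr p) * ?E * emeasure lborel (ball 0 r :: (real ^ 'n) set)"
    by (rule nn_integral_cmult_indicator) simp
  also have "emeasure lborel (ball 0 r :: (real ^ 'n) set) = ennreal (unit_ball_vol (real CARD('n)) * r ^ CARD('n))"
    using r by (simp add: emeasure_ball)
  also have "ennreal (2 powr p * r powr p) * ?E * ennreal (unit_ball_vol (real CARD('n)) * r ^ CARD('n))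
      = ennreal (2 powr p * r powr p * (unit_ball_vol (real CARD('n)) * r ^ CARD('n))) * ?E"
    by (subst (2) ennreal_mult') (auto simp: mult_ac)
  also have "2 powr p * r powr p * (unit_ball_vol (real CARD('n)) * r ^ CARD('n))
     = 2 powr p * unit_ball_vol (real CARD('n)) * r powr (real CARD('n) + p)"
    using r by (simp add: powr_add powr_realpow)
  finally show ?thesis .
qed

section \<open>Dilations and logarithmic radius\<close>

lemma powr_add_le:
  fixes a b :: real
  assumes "a \<ge> 0" "b \<ge> 0" "p > 0"
  shows "(a + b) powr p \<le> 2 powr p * (a powr p + b powr p)"
proof -
  have "(a + b) powr p \<le> (2 * max a b) powr p" using assms by (intro powr_mono2) auto
  also have "\<dots> = 2 powr p * max a b powr p" using assms by (simp add: powr_mult)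
  also have "\<dots> \<le> 2 powr p * (a powr p + b powr p)" by (intro mult_left_mono) (auto simp: max_def)
  finally show ?thesis .
qed

lemma nn_integral_dilation_le:
  fixes f :: "'a::euclidean_space \<Rightarrow> ennreal"
  assumes [measurable]: "f \<in> borel_measurable borel" and c: "c \<ge> 1"
  shows "(\<integral>\<^sup>+x. f (c *\<^sub>R x) \<partial>lborel) \<le> (\<integral>\<^sup>+x. f x \<partial>lborel)"
proof -
  have "(\<integral>\<^sup>+x. f x \<partial>lborel) = ennreal (\<bar>c\<bar> ^ DIM('a)) * (\<integral>\<^sup>+x. f (c *\<^sub>R x) \<partial>lborel)"
    by (subst lborel_affine[of c 0]) (use c in \<open>auto simp: nn_integral_density nn_integral_distr nn_integral_cmult\<close>)
  moreover have "1 \<le> ennreal (\<bar>c\<bar> ^ DIM('a))"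
    using c by (simp add: one_le_power)
  ultimately show ?thesis
    by (metis mult.left_neutral mult_right_mono zero_le)
qed

text \<open>
  Compare \<open>w(x)\<close> and \<open>w(e\<^sup>hx)\<close> through an intermediate point \<open>z\<close> and average over all \<open>z\<close> in the ball of
  radius \<open>hR\<close> about \<open>x\<close>. On the shell \<open>R \<le> |x| \<le> eR\<close> both \<open>|x - z|\<close> and \<open>|e\<^sup>hx - z|\<close> are at most \<open>7hR\<close>, so that the
  oscillation controls both parts. Dilations are the right maps here because they become translations
  in the logarithmic radius.
\<close>

lemma dilation_increment:
  fixes w :: "real ^ 'n \<Rightarrow> real"
  assumes [measurable]: "w \<in> borel_measurable borel" and p: "p > 1" and K: "K \<ge> 0"
    and D: "\<And>r. r > 0 \<Longrightarrow> oscillation p w r \<le> ennreal (K * r powr (real CARD('n) + e))"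
    and R: "R > 0" and h: "0 < h" "h \<le> 1"
  shows "(\<integral>\<^sup>+x. ennreal (if R \<le> norm x \<and> norm x \<le> exp 1 * R then \<bar>w (exp h *\<^sub>R x) - w x\<bar> powr p else 0) \<partial>lborel)
    \<le> ennreal (2 powr p * (1 + 7 powr (real CARD('n) + e)) / unit_ball_vol (real CARD('n)) * K * (h * R) powr e)"
proof -
  let ?N = "real CARD('n)" and ?om = "unit_ball_vol (real CARD('n))"
  define \<rho> where "\<rho> = h * R"
  have \<rho>: "\<rho> > 0" using R h by (simp add: \<rho>_def)
  have om: "?om > 0" by simp
  define a where "a x = (if R \<le> norm x \<and> norm x \<le> exp 1 * R then \<bar>w (exp h *\<^sub>R x) - w x\<bar> powr p else 0)" for x
  have a0: "a x \<ge> 0" for x by (simp add: a_def)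
  have [measurable]: "a \<in> borel_measurable borel" unfolding a_def by measurable
  let ?o = "\<lambda>r x z. ennreal (if dist x z < r then \<bar>w x - w z\<bar> powr p else 0)"
  have exph: "exp h - 1 \<le> 2 * h"
    using exp_bound[of h] h by (simp add: power2_eq_square) (smt (verit) mult_left_le)
  have exp1: "exp 1 \<le> (3::real)" by (rule exp_le)
  \<comment> \<open>for \<open>h \<le> 1\<close> the dilation moves \<open>x\<close> by at most \<open>2h \<cdot> 3R\<close>, whence the factor \<open>7\<close>\<close>
  have pt: "ennreal (a x) * indicator (ball x \<rho>) z \<le> ennreal (2 powr p) * (?o \<rho> x z + ?o (7 * \<rho>) (exp h *\<^sub>R x) z)" for x z
  proof (cases "z \<in> ball x \<rho> \<and> R \<le> norm x \<and> norm x \<le> exp 1 * R")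
    case True
    then have xz: "dist x z < \<rho>" and x: "norm x \<le> 3 * R" using exp1 R
      by (auto intro: order_trans mult_right_mono)
    have "dist (exp h *\<^sub>R x) z \<le> dist (exp h *\<^sub>R x) x + dist x z" by (rule dist_triangle)
    also have "dist (exp h *\<^sub>R x) x = (exp h - 1) * norm x"
    proof -
      have "exp h *\<^sub>R x - x = (exp h - 1) *\<^sub>R x" by (simp add: algebra_simps)
      then show ?thesis using h by (simp add: dist_norm)
    qed
    also have "(exp h - 1) * norm x \<le> (2 * h) * (3 * R)"
      using exph x h R by (intro mult_mono) auto
    finally have d7: "dist (exp h *\<^sub>R x) z < 7 * \<rho>" using xz by (simp add: \<rho>_def)
    have "a x \<le> (\<bar>w x - w z\<bar> + \<bar>w (exp h *\<^sub>R x) - w z\<bar>) powr p"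
      using True p by (auto simp: a_def intro!: powr_mono2)
    also have "\<dots> \<le> 2 powr p * (\<bar>w x - w z\<bar> powr p + \<bar>w (exp h *\<^sub>R x) - w z\<bar> powr p)"
      using p by (intro powr_add_le) auto
    finally have "a x \<le> 2 powr p * (\<bar>w x - w z\<bar> powr p + \<bar>w (exp h *\<^sub>R x) - w z\<bar> powr p)" .
    then have "ennreal (a x) \<le> ennreal (2 powr p * (\<bar>w x - w z\<bar> powr p + \<bar>w (exp h *\<^sub>R x) - w z\<bar> powr p))"
      by (rule ennreal_leI)
    then show ?thesis using xz d7 by (simp add: ennreal_mult' ennreal_plus[symmetric] del: ennreal_plus)
  next
    case False
    then show ?thesis by (auto simp: a_def indicator_def)
  qed
  have ballm: "(\<integral>\<^sup>+z. ennreal (a x) * indicator (ball x \<rho>) z \<partial>lborel) = ennreal (?om * \<rho> powr ?N) * ennreal (a x)" for x :: "real ^ 'n"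
    using \<rho> by (simp add: nn_integral_cmult_indicator emeasure_ball powr_realpow mult.commute)
  have "ennreal (?om * \<rho> powr ?N) * (\<integral>\<^sup>+x. ennreal (a x) \<partial>lborel)
      = (\<integral>\<^sup>+x. \<integral>\<^sup>+z. ennreal (a x) * indicator (ball x \<rho>) z \<partial>lborel \<partial>lborel)"
    unfolding ballm by (rule nn_integral_cmult[symmetric]) measurable
  also have "\<dots> \<le> (\<integral>\<^sup>+x. \<integral>\<^sup>+z. ennreal (2 powr p) * (?o \<rho> x z + ?o (7 * \<rho>) (exp h *\<^sub>R x) z) \<partial>lborel \<partial>lborel)"
    by (intro nn_integral_mono pt)
  also have "\<dots> = (\<integral>\<^sup>+x. ennreal (2 powr p) * ((\<integral>\<^sup>+z. ?o \<rho> x z \<partial>lborel) + (\<integral>\<^sup>+z. ?o (7 * \<rho>) (exp h *\<^sub>R x) z \<partial>lborel)) \<partial>lborel)"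
    by (intro nn_integral_cong, subst nn_integral_cmult, measurable, subst nn_integral_add, measurable)
  also have "\<dots> = ennreal (2 powr p) * (oscillation p w \<rho> + (\<integral>\<^sup>+x. \<integral>\<^sup>+z. ?o (7 * \<rho>) (exp h *\<^sub>R x) z \<partial>lborel \<partial>lborel))"
    unfolding oscillation_def by (subst nn_integral_cmult, measurable, subst nn_integral_add, measurable)
  also have "\<dots> \<le> ennreal (2 powr p) * (ennreal (K * \<rho> powr (?N + e)) + ennreal (K * (7 * \<rho>) powr (?N + e)))"
  proof (intro mult_left_mono add_mono)
    show "oscillation p w \<rho> \<le> ennreal (K * \<rho> powr (?N + e))" by (rule D) fact
    have "(\<integral>\<^sup>+x. \<integral>\<^sup>+z. ?o (7 * \<rho>) (exp h *\<^sub>R x) z \<partial>lborel \<partial>lborel) \<le> oscillation p w (7 * \<rho>)"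
      unfolding oscillation_def
      by (rule nn_integral_dilation_le[where f="\<lambda>x. \<integral>\<^sup>+z. ?o (7 * \<rho>) x z \<partial>lborel"]) (use h in auto)
    also have "\<dots> \<le> ennreal (K * (7 * \<rho>) powr (?N + e))" using \<rho> by (intro D) auto
    finally show "(\<integral>\<^sup>+x. \<integral>\<^sup>+z. ?o (7 * \<rho>) (exp h *\<^sub>R x) z \<partial>lborel \<partial>lborel) \<le> ennreal (K * (7 * \<rho>) powr (?N + e))" .
  qed auto
  also have "\<dots> = ennreal (2 powr p * (K * \<rho> powr (?N + e) + K * (7 * \<rho>) powr (?N + e)))"
    using K by (subst ennreal_plus[symmetric]) (auto simp: ennreal_mult'[symmetric] simp del: ennreal_plus)
  also have "2 powr p * (K * \<rho> powr (?N + e) + K * (7 * \<rho>) powr (?N + e))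
      = (?om * \<rho> powr ?N) * (2 powr p * (1 + 7 powr (?N + e)) / ?om * K * \<rho> powr e)" (is "_ = _ * ?X")
  proof -
    have "2 powr p * (K * \<rho> powr (?N + e) + K * (7 * \<rho>) powr (?N + e))
      = (v * \<rho> powr ?N) * (2 powr p * (1 + 7 powr (?N + e)) / v * K * \<rho> powr e)" if "v > 0" for v
      using \<rho> that by (simp add: powr_mult powr_add field_simps)
    from this[OF om] show ?thesis .
  qed
  also have "ennreal ((?om * \<rho> powr ?N) * ?X) = ennreal (?om * \<rho> powr ?N) * ennreal ?X"
    using K by (intro ennreal_mult) auto
  finally have "ennreal (?om * \<rho> powr ?N) * (\<integral>\<^sup>+x. ennreal (a x) \<partial>lborel) \<le> ennreal (?om * \<rho> powr ?N) * ennreal ?X" .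
  then have "(\<integral>\<^sup>+x. ennreal (a x) \<partial>lborel) \<le> ennreal ?X"
  proof (subst (asm) ennreal_mult_le_mult_iff)
    have "?om * \<rho> powr ?N > 0" by (rule mult_pos_pos[OF om]) (use \<rho> in simp)
    then show "ennreal (?om * \<rho> powr ?N) \<noteq> 0" by (metis ennreal_eq_0_iff not_le)
  qed simp_all
  then show ?thesis by (simp add: a_def \<rho>_def)
qed

lemma nn_integral_exp_atMost:
  fixes \<kappa> :: real
  assumes \<kappa>: "\<kappa> > 0" and c: "c \<ge> 0"
  shows "(\<integral>\<^sup>+s\<in>{..t}. ennreal (c * \<kappa> * exp (\<kappa> * s)) \<partial>lborel) = ennreal (c * exp (\<kappa> * t))"
proof -
  have "(\<integral>\<^sup>+s\<in>{..t}. ennreal (c * \<kappa> * exp (\<kappa> * s)) \<partial>lborel) = (\<integral>\<^sup>+s. ennreal (c * \<kappa> * exp (- \<kappa> * s)) * indicator {-t..} s \<partial>lborel)"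
    by (subst nn_integral_real_affine[where c="-1" and t=0])
      (auto simp: indicator_def intro!: nn_integral_cong)
  also have "\<dots> = ennreal (0 - (- (c * exp (- \<kappa> * (- t)))))"
  proof (rule nn_integral_FTC_atLeast)
    show "((\<lambda>s. - (c * exp (- \<kappa> * s))) has_real_derivative c * \<kappa> * exp (- \<kappa> * x)) (at x)" for x
      by (auto intro!: derivative_eq_intros)
    have "((\<lambda>s. exp (- \<kappa> * s)) \<longlongrightarrow> 0) at_top"
      by (rule filterlim_compose[OF exp_at_bot], rule filterlim_tendsto_neg_mult_at_bot[OF tendsto_const])
        (use \<kappa> in \<open>auto intro: filterlim_ident\<close>)
    then have "((\<lambda>s. - (c * exp (- \<kappa> * s))) \<longlongrightarrow> - (c * 0)) at_top"
      by (intro tendsto_intros)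
    then show "((\<lambda>s. - (c * exp (- \<kappa> * s))) \<longlongrightarrow> 0) at_top" by simp
  qed (use \<kappa> c in auto)
  finally show ?thesis by simp
qed

text \<open>
  Integration in polar coordinates for radial functions, in the variable \<open>t = ln |x|\<close>. Both measures
  give \<open>{..t}\<close> the volume of the ball of radius \<open>e\<^sup>t\<close>; the origin, where \<open>ln\<close> is \<open>0\<close>, is a null set.
\<close>

lemma distr_ln_norm:
  "distr (lborel :: (real ^ 'n) measure) borel (\<lambda>x. ln (norm x))
    = density lborel (\<lambda>t. ennreal (real CARD('n) * unit_ball_vol (real CARD('n)) * exp (real CARD('n) * t)))"
  (is "?M = ?D")
proof -
  let ?N = "real CARD('n)" and ?om = "unit_ball_vol (real CARD('n))"
  have N: "?N > 0" by simp
  have e1: "emeasure ?M {..t} = ennreal (?om * exp (?N * t))" for t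
  proof -
    have "emeasure ?M {..t} = emeasure lborel {x :: real ^ 'n. ln (norm x) \<le> t}"
      by (subst emeasure_distr) (auto simp: vimage_def)
    also have "\<dots> = emeasure lborel (cball 0 (exp t) :: (real ^ 'n) set)"
    proof (rule emeasure_eq_AE)
      show "AE x in lborel. (x \<in> {x :: real ^ 'n. ln (norm x) \<le> t}) = (x \<in> cball 0 (exp t))"
        using AE_lborel_singleton[of "0 :: real ^ 'n"]
      proof eventually_elim
        case (elim x)
        then have "ln (norm x) \<le> t \<longleftrightarrow> norm x \<le> exp t"
          by (metis exp_le_cancel_iff exp_ln zero_less_norm_iff)
        then show ?case by simp
      qed
    qed measurable
    also have "\<dots> = ennreal (?om * exp t ^ CARD('n))"
      by (simp add: emeasure_cball)
    finally show ?thesis by (simp add: exp_of_nat_mult)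
  qed
  have e2: "emeasure ?D {..t} = ennreal (?om * exp (?N * t))" for t
  proof -
    have "emeasure ?D {..t} = (\<integral>\<^sup>+s. ennreal (?N * ?om * exp (?N * s)) * indicator {..t} s \<partial>lborel)"
      by (simp add: emeasure_density)
    also have "\<dots> = ennreal (?om * exp (?N * t))"
      using nn_integral_exp_atMost[of ?N ?om t] by (simp add: mult.commute)
    finally show ?thesis .
  qed
  show ?thesis
  proof (rule measure_eqI_generator_eq[where \<Omega>=UNIV and E="range (\<lambda>t. {..t})" and A="\<lambda>n. {..real n}"])
    show "Int_stable (range (\<lambda>t::real. {..t}))"
      by (auto simp: Int_stable_def Int_atMost)
    show "(\<Union>n. {..real n}) = UNIV" using real_arch_simple by auto
    show "sets ?M = sigma_sets UNIV (range (\<lambda>t::real. {..t}))" "sets ?D = sigma_sets UNIV (range (\<lambda>t::real. {..t}))"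
      by (auto simp: borel_eq_atMost)
  qed (auto simp: e1 e2)
qed

lemma nn_integral_ln_norm:
  assumes [measurable]: "G \<in> borel_measurable borel"
  shows "(\<integral>\<^sup>+x. G (ln (norm x)) \<partial>(lborel :: (real ^ 'n) measure))
    = (\<integral>\<^sup>+t. ennreal (real CARD('n) * unit_ball_vol (real CARD('n)) * exp (real CARD('n) * t)) * G t \<partial>lborel)"
proof -
  have "(\<integral>\<^sup>+x. G (ln (norm x)) \<partial>(lborel :: (real ^ 'n) measure)) = (\<integral>\<^sup>+t. G t \<partial>distr (lborel :: (real ^ 'n) measure) borel (\<lambda>x. ln (norm x)))"
    by (simp add: nn_integral_distr)
  then show ?thesis by (simp add: distr_ln_norm nn_integral_density)
qed

lemma AE_ln_norm:
  assumes "AE t in lborel. P t" and [measurable]: "Measurable.pred borel P"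
  shows "AE x in (lborel :: (real ^ 'n) measure). P (ln (norm x))"
proof -
  have "AE t in density lborel (\<lambda>t. ennreal (real CARD('n) * unit_ball_vol (real CARD('n)) * exp (real CARD('n) * t))). P t"
    using assms(1) by (subst AE_density) auto
  then have "AE t in distr (lborel :: (real ^ 'n) measure) borel (\<lambda>x. ln (norm x)). P t"
    unfolding distr_ln_norm .
  then show ?thesis by (subst (asm) AE_distr_iff) auto
qed

section \<open>A Morrey estimate on the line\<close>

definition mean_value :: "(real \<Rightarrow> real) \<Rightarrow> real \<Rightarrow> real \<Rightarrow> real" where
  "mean_value F l t = (LINT s:{0..l}|lborel. F (t + s)) / l"

lemma set_integrable_shift:
  fixes F :: "real \<Rightarrow> real"
  assumes "set_integrable lborel {t..t + l} F"
  shows "set_integrable lborel {0..l} (\<lambda>s. F (t + s))"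
proof -
  have "integrable lborel (\<lambda>s. indicator {t..t + l} (t + 1 * s) *\<^sub>R F (t + 1 * s))"
    using assms unfolding set_integrable_def by (subst lborel_integrable_real_affine_iff) auto
  also have "(\<lambda>s. indicator {t..t + l} (t + 1 * s) *\<^sub>R F (t + 1 * s)) = (\<lambda>s. indicator {0..l} s *\<^sub>R F (t + s))"
    by (auto simp: indicator_def)
  finally show ?thesis by (simp only: set_integrable_def)
qed

lemma geometric_sum_le: "0 \<le> r \<Longrightarrow> r < 1 \<Longrightarrow> (\<Sum>i<n. r ^ i) \<le> 1 / (1 - r)" for r :: real
  by (simp add: sum_gp_strict divide_right_mono)

text \<open>
  A function on the line with \<open>L\<^sup>p\<close> increments of order \<open>\<sigma> > 1/p\<close>, with constants that decay like \<open>exp(-at)\<close>.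
  The assumption \<open>decay\<close> makes \<open>F\<close> locally integrable and excludes functions that do not vanish at
  infinity, such as constants.
\<close>

locale weighted_hoelder_on_line =
  fixes F :: "real \<Rightarrow> real" and p \<sigma> a c M B :: real
  assumes F[measurable]: "F \<in> borel_measurable borel"
    and p: "p > 1" and \<sigma>: "\<sigma> * p > 1" and a: "a > 0" and c: "c > 0" and M: "M \<ge> 0" and B: "B \<ge> 0"
    and increment: "\<And>t h. 0 < h \<Longrightarrow> h \<le> 1 \<Longrightarrow>
      (\<integral>\<^sup>+s\<in>{t..t + 1}. ennreal (\<bar>F (s + h) - F s\<bar> powr p) \<partial>lborel) \<le> ennreal ((M * h powr \<sigma> * exp (- a * t)) powr p)"
    and decay: "\<And>t. (\<integral>\<^sup>+s\<in>{t..t + 1}. ennreal (\<bar>F s\<bar> powr p) \<partial>lborel) \<le> ennreal ((B * exp (- c * t)) powr p)"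
begin

lemma \<sigma>_gt: "\<sigma> > 1 / p" "\<sigma> > 0"
  using \<sigma> p by (auto simp: field_simps) (smt (verit) mult_nonpos_nonneg)

lemma increment_L1:
  assumes h: "0 < h" "h \<le> 1" and l: "0 < l" "l \<le> 1"
  shows "(\<integral>\<^sup>+s\<in>{t..t + l}. ennreal \<bar>F (s + h) - F s\<bar> \<partial>lborel)
    \<le> ennreal (2 * l powr (1 - 1 / p) * (M * h powr \<sigma> * exp (- a * t)))"
proof -
  have "(\<integral>\<^sup>+s\<in>{t..t + l}. ennreal (\<bar>F (s + h) - F s\<bar> powr p) \<partial>lborel)
    \<le> (\<integral>\<^sup>+s\<in>{t..t + 1}. ennreal (\<bar>F (s + h) - F s\<bar> powr p) \<partial>lborel)"
    using l by (intro nn_integral_mono) (auto simp: indicator_def)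
  also note increment[OF h]
  finally have "(\<integral>\<^sup>+s\<in>{t..t + l}. ennreal \<bar>F (s + h) - F s\<bar> \<partial>lborel)
    \<le> ennreal (2 * l powr (1 - 1 / p) * ((M * h powr \<sigma> * exp (- a * t)) powr p) powr (1 / p))"
    by (intro nn_integral_power_mean) (use l p in auto)
  then show ?thesis using p M by (simp add: powr_powr)
qed

lemma decay_L1: "(\<integral>\<^sup>+s\<in>{t..t + 1}. ennreal \<bar>F s\<bar> \<partial>lborel) \<le> ennreal (2 * (B * exp (- c * t)))"
proof -
  have "(\<integral>\<^sup>+s\<in>{t..t + 1}. ennreal \<bar>F s\<bar> \<partial>lborel)
    \<le> ennreal (2 * 1 powr (1 - 1 / p) * ((B * exp (- c * t)) powr p) powr (1 / p))"
    by (intro nn_integral_power_mean decay) (use p in auto)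
  then show ?thesis using p B by (simp add: powr_powr)
qed

lemma F_set_integrable: "0 \<le> l \<Longrightarrow> l \<le> 1 \<Longrightarrow> set_integrable lborel {t..t + l} F"
proof (rule set_integrable_subset)
  have "(\<integral>\<^sup>+s. ennreal (norm (indicator {t..t + 1} s *\<^sub>R F s)) \<partial>lborel) = (\<integral>\<^sup>+s\<in>{t..t + 1}. ennreal \<bar>F s\<bar> \<partial>lborel)"
    by (intro nn_integral_cong) (auto simp: indicator_def)
  also have "\<dots> < \<infinity>" using decay_L1[of t] by (simp add: order_le_less_trans)
  finally show "set_integrable lborel {t..t + 1} F"
    unfolding set_integrable_def by (intro integrableI_bounded) auto
qed auto

lemma F_shift_integrable: "0 \<le> l \<Longrightarrow> l \<le> 1 \<Longrightarrow> set_integrable lborel {0..l} (\<lambda>s. F (t + s))"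
  by (intro set_integrable_shift F_set_integrable)

lemma mean_value_translate:
  assumes "0 < h" "h \<le> 1" "0 < l" "l \<le> 1"
  shows "\<bar>mean_value F l (t + h) - mean_value F l t\<bar> \<le> 2 * l powr (- (1 / p)) * (M * h powr \<sigma> * exp (- a * t))"
proof -
  have "mean_value F l (t + h) - mean_value F l t = (LINT s:{0..l}|lborel. F (t + h + s) - F (t + s)) / l"
    using F_shift_integrable[of l t] F_shift_integrable[of l "t + h"] assms
    by (simp add: mean_value_def diff_divide_distrib)
  moreover have "\<bar>LINT s:{0..l}|lborel. F (t + h + s) - F (t + s)\<bar> \<le> 2 * l powr (1 - 1 / p) * (M * h powr \<sigma> * exp (- a * t))"
  proof -
    have "ennreal \<bar>LINT s:{0..l}|lborel. F (t + h + s) - F (t + s)\<bar> \<le> (\<integral>\<^sup>+s\<in>{0..l}. ennreal \<bar>F (t + h + s) - F (t + s)\<bar> \<partial>lborel)"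
      by (rule set_integral_norm_le)
    also have "\<dots> = (\<integral>\<^sup>+s\<in>{t..t + l}. ennreal \<bar>F (s + h) - F s\<bar> \<partial>lborel)"
      by (subst (2) nn_integral_lborel_translate[where c=t, symmetric])
        (auto simp: indicator_def algebra_simps intro!: nn_integral_cong)
    also note increment_L1[OF assms]
    finally show ?thesis using M by simp
  qed
  moreover have "l powr (- (1 / p)) = l powr (1 - 1 / p) / l"
    using assms by (simp add: powr_diff powr_minus field_simps)
  ultimately show ?thesis using assms by (simp add: abs_divide divide_right_mono)
qed

text \<open>
  The mean over \<open>[t, t + 2l]\<close> is the average of two means over adjacent intervals of length \<open>l\<close>.
  The gain \<open>l\<^bsup>\<sigma>-1/p\<^esup>\<close> makes the dyadic telescoping sum geometric.
\<close>

lemma mean_value_halve: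
  assumes l: "0 < l" "l \<le> 1 / 2"
  shows "\<bar>mean_value F l t - mean_value F (2 * l) t\<bar> \<le> M * l powr (\<sigma> - 1 / p) * exp (- a * t)"
proof -
  have i: "(\<lambda>s. F (t + s)) integrable_on {0..2 * l}"
    using l by (intro set_borel_integral_eq_integral F_shift_integrable) auto
  have "(LINT s:{0..2 * l}|lborel. F (t + s)) = integral {0..2 * l} (\<lambda>s. F (t + s))"
    using l by (intro set_borel_integral_eq_integral F_shift_integrable) auto
  also have "\<dots> = integral {0..l} (\<lambda>s. F (t + s)) + integral {l..2 * l} (\<lambda>s. F (t + s))"
    using l i by (intro Henstock_Kurzweil_Integration.integral_combine[symmetric]) auto
  also have "integral {l..2 * l} (\<lambda>s. F (t + s)) = integral {0..l} (\<lambda>s. F (t + l + s))"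
    using integral_shift_Icc_real[of 0 l "\<lambda>s. F (t + s)" l] by (simp add: o_def algebra_simps)
  also have "integral {0..l} (\<lambda>s. F (t + s)) = (LINT s:{0..l}|lborel. F (t + s))"
    using l by (intro set_borel_integral_eq_integral(2)[symmetric] F_shift_integrable) auto
  also have "integral {0..l} (\<lambda>s. F (t + l + s)) = (LINT s:{0..l}|lborel. F (t + l + s))"
    using l by (intro set_borel_integral_eq_integral(2)[symmetric] F_shift_integrable) auto
  finally have "mean_value F (2 * l) t = (mean_value F l t + mean_value F l (t + l)) / 2"
    using l by (simp add: mean_value_def field_simps)
  then have "\<bar>mean_value F l t - mean_value F (2 * l) t\<bar> = \<bar>mean_value F l (t + l) - mean_value F l t\<bar> / 2"
    by (simp add: abs_if field_simps)
  also have "\<dots> \<le> (2 * l powr (- (1 / p)) * (M * l powr \<sigma> * exp (- a * t))) / 2"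
    using l by (intro divide_right_mono mean_value_translate) auto
  also have "\<dots> = M * l powr (\<sigma> - 1 / p) * exp (- a * t)"
    by (simp add: powr_diff powr_minus field_simps)
  finally show ?thesis .
qed

text \<open>
  Compare the means over \<open>[t, t + 1]\<close>, \<open>[t + 1, t + 2]\<close>, \<dots>. The differences sum up geometrically,
  and the means tend to \<open>0\<close>.
\<close>

lemma mean_value_1_bound: "\<bar>mean_value F 1 t\<bar> \<le> 2 / (1 - exp (- a)) * M * exp (- a * t)"
proof -
  have ea: "exp (- a) < 1" using a by simp
  have step: "\<bar>mean_value F 1 t\<bar> \<le> \<bar>mean_value F 1 (t + real n)\<bar> + 2 * M * exp (- a * t) * (\<Sum>i<n. exp (- a) ^ i)" for n
  proof (induction n)
    case (Suc n)
    have "\<bar>mean_value F 1 (t + real n + 1) - mean_value F 1 (t + real n)\<bar> \<le> 2 * M * exp (- a * (t + real n))"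
      using mean_value_translate[of 1 1 "t + real n"] by simp
    also have "exp (- a * (t + real n)) = exp (- a * t) * exp (- a) ^ n"
      by (simp add: exp_of_nat_mult[symmetric] exp_add[symmetric] algebra_simps)
    finally show ?case using Suc by (simp add: algebra_simps)
  qed simp
  have geo: "(\<Sum>i<n. exp (- a) ^ i) \<le> 1 / (1 - exp (- a))" for n
    using ea by (simp add: sum_gp_strict divide_right_mono)
  have "\<bar>mean_value F 1 t\<bar> \<le> 2 * B * exp (- c * t) * exp (- c) ^ n + 2 * M * exp (- a * t) * (1 / (1 - exp (- a)))" for n
  proof -
    have "ennreal \<bar>mean_value F 1 (t + real n)\<bar> \<le> (\<integral>\<^sup>+s\<in>{0..1}. ennreal \<bar>F (t + real n + s)\<bar> \<partial>lborel)"
      unfolding mean_value_def using set_integral_norm_le[of "{0..1}" "\<lambda>s. F (t + real n + s)"] by simp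
    also have "\<dots> = (\<integral>\<^sup>+s\<in>{t + real n..t + real n + 1}. ennreal \<bar>F s\<bar> \<partial>lborel)"
      by (subst (2) nn_integral_lborel_translate[where c="t + real n", symmetric])
        (auto simp: indicator_def algebra_simps intro!: nn_integral_cong)
    also note decay_L1
    finally have "\<bar>mean_value F 1 (t + real n)\<bar> \<le> 2 * (B * exp (- c * (t + real n)))"
      using B by simp
    also have "exp (- c * (t + real n)) = exp (- c * t) * exp (- c) ^ n"
      by (simp add: exp_of_nat_mult[symmetric] exp_add[symmetric] algebra_simps)
    finally show ?thesis
      using step[of n] mult_left_mono[OF geo[of n], of "2 * M * exp (- a * t)"] M by simp
  qed
  moreover have "(\<lambda>n. 2 * B * exp (- c * t) * exp (- c) ^ n + 2 * M * exp (- a * t) * (1 / (1 - exp (- a))))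
      \<longlonglongrightarrow> 2 * B * exp (- c * t) * 0 + 2 * M * exp (- a * t) * (1 / (1 - exp (- a)))"
    by (intro tendsto_intros LIMSEQ_power_zero) (use c in auto)
  ultimately have "\<bar>mean_value F 1 t\<bar> \<le> 2 * B * exp (- c * t) * 0 + 2 * M * exp (- a * t) * (1 / (1 - exp (- a)))"
    by (intro LIMSEQ_le_const) auto
  then show ?thesis by (simp add: field_simps)
qed

text \<open>
  The first summand bounds the means over unit intervals, the second the dyadic telescoping sum.
\<close>

definition morrey_const :: real where
  "morrey_const = 2 / (1 - exp (- a)) + 1 / (1 - (1 / 2) powr (\<sigma> - 1 / p))"

lemma half_powr_less_1: "(1 / 2) powr (\<sigma> - 1 / p) < 1"
  using powr_less_mono2[of "\<sigma> - 1 / p" "1 / 2" 1] \<sigma>_gt by simp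

lemma morrey_const_nonneg: "morrey_const \<ge> 0"
  unfolding morrey_const_def using half_powr_less_1 a by (intro add_nonneg_nonneg divide_nonneg_nonneg) auto

lemma mean_value_dyadic_bound: "\<bar>mean_value F ((1 / 2) ^ j) t\<bar> \<le> morrey_const * M * exp (- a * t)"
proof -
  let ?r = "(1 / 2) powr (\<sigma> - 1 / p)"
  have r: "0 < ?r" "?r < 1" by (auto simp: half_powr_less_1)
  have "\<bar>mean_value F ((1 / 2) ^ j) t\<bar> \<le> \<bar>mean_value F 1 t\<bar> + M * exp (- a * t) * (\<Sum>i<j. ?r ^ Suc i)"
  proof (induction j)
    case (Suc j)
    have "\<bar>mean_value F ((1 / 2) ^ Suc j) t - mean_value F (2 * (1 / 2) ^ Suc j) t\<bar>
        \<le> M * ((1 / 2) ^ Suc j) powr (\<sigma> - 1 / p) * exp (- a * t)"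
      by (rule mean_value_halve) (auto simp: power_le_one)
    also have "((1 / 2 :: real) ^ Suc j) powr (\<sigma> - 1 / p) = ?r ^ Suc j"
      by (simp add: powr_realpow[symmetric] powr_powr mult.commute del: power_Suc)
    finally show ?case using Suc by (simp add: algebra_simps)
  qed simp
  also have "(\<Sum>i<j. ?r ^ Suc i) \<le> 1 / (1 - ?r)"
  proof -
    have "(\<Sum>i<j. ?r ^ Suc i) \<le> (\<Sum>i<j. ?r ^ i)"
      using r by (intro sum_mono power_decreasing) auto
    also have "\<dots> \<le> 1 / (1 - ?r)" using r by (intro geometric_sum_le) auto
    finally show ?thesis .
  qed
  finally have "\<bar>mean_value F ((1 / 2) ^ j) t\<bar> \<le> \<bar>mean_value F 1 t\<bar> + M * exp (- a * t) * (1 / (1 - ?r))"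
    using M by (simp add: mult_left_mono)
  then show ?thesis using mean_value_1_bound[of t] by (simp add: morrey_const_def algebra_simps)
qed

text \<open>
  The hypothesis on increments itself shows that means over short intervals converge to \<open>F\<close> in
  \<open>L\<^sup>1\<close>, with a rate.
\<close>

lemma mean_value_approximates:
  assumes l: "0 < l" "l \<le> 1"
  shows "(\<integral>\<^sup>+t\<in>{t0..t0 + 1}. ennreal \<bar>F t - mean_value F l t\<bar> \<partial>lborel) \<le> ennreal (2 * M * l powr \<sigma> * exp (- a * t0))"
proof -
  let ?X = "2 * M * l powr \<sigma> * exp (- a * t0)"
  have pt: "ennreal \<bar>F t - mean_value F l t\<bar> \<le> ennreal (1 / l) * (\<integral>\<^sup>+s\<in>{0..l}. ennreal \<bar>F (t + s) - F t\<bar> \<partial>lborel)" for t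
  proof -
    have const: "set_integrable lborel {0..l} (\<lambda>s. F t)"
      unfolding set_integrable_def by (rule borel_integrable_compact) auto
    then have "(LINT s:{0..l}|lborel. F (t + s) - F t) = l * mean_value F l t - l * F t"
      using set_integral_diff(2)[OF F_shift_integrable[of l t] const] l
      by (simp add: mean_value_def) (simp add: set_lebesgue_integral_def)
    then have "\<bar>F t - mean_value F l t\<bar> = (1 / l) * \<bar>LINT s:{0..l}|lborel. F (t + s) - F t\<bar>"
      using l by (simp add: right_diff_distrib[symmetric] abs_mult abs_minus_commute)
    then have "ennreal \<bar>F t - mean_value F l t\<bar> = ennreal (1 / l) * ennreal \<bar>LINT s:{0..l}|lborel. F (t + s) - F t\<bar>"
      using l by (simp add: ennreal_mult'[symmetric])
    also have "\<dots> \<le> ennreal (1 / l) * (\<integral>\<^sup>+s\<in>{0..l}. ennreal \<bar>F (t + s) - F t\<bar> \<partial>lborel)"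
      by (intro mult_left_mono set_integral_norm_le) auto
    finally show ?thesis .
  qed
  let ?g = "\<lambda>t s. ennreal \<bar>F (t + s) - F t\<bar> * indicator {0..l} s * indicator {t0..t0 + 1} t"
  have "(\<integral>\<^sup>+t\<in>{t0..t0 + 1}. ennreal \<bar>F t - mean_value F l t\<bar> \<partial>lborel)
      \<le> (\<integral>\<^sup>+t. ennreal (1 / l) * (\<integral>\<^sup>+s. ?g t s \<partial>lborel) \<partial>lborel)"
  proof (rule nn_integral_mono)
    fix t
    show "ennreal \<bar>F t - mean_value F l t\<bar> * indicator {t0..t0 + 1} t \<le> ennreal (1 / l) * (\<integral>\<^sup>+s. ?g t s \<partial>lborel)"
      using pt[of t] by (cases "t \<in> {t0..t0 + 1}") auto
  qed
  also have "\<dots> = ennreal (1 / l) * (\<integral>\<^sup>+t. \<integral>\<^sup>+s. ?g t s \<partial>lborel \<partial>lborel)"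
    by (rule nn_integral_cmult) measurable
  also have "(\<integral>\<^sup>+t. \<integral>\<^sup>+s. ?g t s \<partial>lborel \<partial>lborel) = (\<integral>\<^sup>+s. \<integral>\<^sup>+t. ?g t s \<partial>lborel \<partial>lborel)"
    by (rule lborel_pair.Fubini'[symmetric]) measurable
  also have "\<dots> \<le> (\<integral>\<^sup>+s. ennreal ?X * indicator {0..l} s \<partial>lborel)"
  proof (rule nn_integral_mono)
    fix s :: real
    consider "s \<in> {0..l}" "s > 0" | "s = 0" | "s \<notin> {0..l}" by fastforce
    then show "(\<integral>\<^sup>+t. ?g t s \<partial>lborel) \<le> ennreal ?X * indicator {0..l} s"
    proof cases
      case 1
      have "(\<integral>\<^sup>+t. ?g t s \<partial>lborel) = (\<integral>\<^sup>+t\<in>{t0..t0 + 1}. ennreal \<bar>F (t + s) - F t\<bar> \<partial>lborel)"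
        using 1 by simp
      also have "\<dots> \<le> ennreal (2 * 1 powr (1 - 1 / p) * (M * s powr \<sigma> * exp (- a * t0)))"
        using 1 l by (intro increment_L1) auto
      also have "\<dots> \<le> ennreal ?X"
        using 1 M \<sigma>_gt by (intro ennreal_leI) (auto intro!: mult_right_mono mult_left_mono powr_mono2)
      finally show ?thesis using 1 by simp
    qed auto
  qed
  also have "\<dots> = ennreal ?X * ennreal l" using l by (simp add: nn_integral_cmult_indicator)
  also have "ennreal (1 / l) * (ennreal ?X * ennreal l) = ennreal ?X"
    using l M by (simp add: ennreal_mult'[symmetric])
  finally show ?thesis using l by (simp add: mult_left_mono)
qed

lemma unit_interval_bound: "AE t in lborel. t \<in> {t0..t0 + 1} \<longrightarrow> \<bar>F t\<bar> \<le> morrey_const * M * exp (- a * t0)"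
proof -
  let ?L = "morrey_const * M * exp (- a * t0)"
  note morrey_const = morrey_const_nonneg
  have "(\<integral>\<^sup>+t\<in>{t0..t0 + 1}. ennreal (\<bar>F t\<bar> - ?L) \<partial>lborel) \<le> ennreal (2 * M * exp (- a * t0) * ((1 / 2) powr \<sigma>) ^ j)" for j
  proof -
    have "(\<integral>\<^sup>+t\<in>{t0..t0 + 1}. ennreal (\<bar>F t\<bar> - ?L) \<partial>lborel)
        \<le> (\<integral>\<^sup>+t\<in>{t0..t0 + 1}. ennreal \<bar>F t - mean_value F ((1 / 2) ^ j) t\<bar> \<partial>lborel)"
    proof (rule nn_integral_mono)
      fix t
      have "\<bar>F t\<bar> - ?L \<le> \<bar>F t - mean_value F ((1 / 2) ^ j) t\<bar>" if "t0 \<le> t"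
      proof -
        have "morrey_const * M * exp (- a * t) \<le> ?L" using that a M morrey_const by (intro mult_left_mono) auto
        then show ?thesis using mean_value_dyadic_bound[of j t] by simp
      qed
      then show "ennreal (\<bar>F t\<bar> - ?L) * indicator {t0..t0 + 1} t
          \<le> ennreal \<bar>F t - mean_value F ((1 / 2) ^ j) t\<bar> * indicator {t0..t0 + 1} t"
        by (auto simp: indicator_def intro!: ennreal_leI)
    qed
    also have "\<dots> \<le> ennreal (2 * M * ((1 / 2) ^ j) powr \<sigma> * exp (- a * t0))"
      by (rule mean_value_approximates) (auto simp: power_le_one)
    also have "((1 / 2 :: real) ^ j) powr \<sigma> = ((1 / 2) powr \<sigma>) ^ j"
      by (simp add: powr_realpow[symmetric] powr_powr mult.commute)
    finally show ?thesis by (simp add: mult_ac)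
  qed
  moreover have "(\<lambda>j. ennreal (2 * M * exp (- a * t0) * ((1 / 2) powr \<sigma>) ^ j)) \<longlonglongrightarrow> ennreal (2 * M * exp (- a * t0) * 0)"
    by (intro tendsto_ennrealI tendsto_intros LIMSEQ_power_zero) (use powr_less_mono2[of \<sigma> "1 / 2" 1] \<sigma>_gt in auto)
  ultimately have "(\<integral>\<^sup>+t\<in>{t0..t0 + 1}. ennreal (\<bar>F t\<bar> - ?L) \<partial>lborel) \<le> ennreal (2 * M * exp (- a * t0) * 0)"
    by (intro LIMSEQ_le_const) auto
  then have "(\<integral>\<^sup>+t\<in>{t0..t0 + 1}. ennreal (\<bar>F t\<bar> - ?L) \<partial>lborel) = 0" by simp
  then have "AE t in lborel. ennreal (\<bar>F t\<bar> - ?L) * indicator {t0..t0 + 1} t = 0"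
    by (subst (asm) nn_integral_0_iff_AE) auto
  then show ?thesis
    by eventually_elim (auto simp: ennreal_eq_0_iff)
qed

lemma exponential_bound: "AE t in lborel. \<bar>F t\<bar> \<le> exp a * morrey_const * M * exp (- a * t)"
proof -
  note morrey_const = morrey_const_nonneg
  have "AE t in lborel. \<forall>k::int. t \<in> {of_int k..of_int k + 1} \<longrightarrow> \<bar>F t\<bar> \<le> morrey_const * M * exp (- a * of_int k)"
    by (subst AE_all_countable) (intro allI unit_interval_bound)
  then show ?thesis
  proof eventually_elim
    case (elim t)
    have "\<bar>F t\<bar> \<le> morrey_const * M * exp (- a * of_int \<lfloor>t\<rfloor>)"
      by (rule elim[rule_format]) (simp add: real_of_int_floor_add_one_ge)
    also have "\<dots> \<le> morrey_const * M * (exp a * exp (- a * t))"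
    proof -
      have "- a * of_int \<lfloor>t\<rfloor> \<le> a + - a * t"
        using a mult_left_mono[of "t - of_int \<lfloor>t\<rfloor>" 1 a] by (simp add: algebra_simps) linarith
      then have "exp (- a * of_int \<lfloor>t\<rfloor>) \<le> exp a * exp (- a * t)" by (simp add: exp_add[symmetric])
      then show ?thesis using morrey_const M by (intro mult_left_mono) auto
    qed
    finally show ?case by (simp add: mult_ac)
  qed
qed

end

section \<open>Pointwise decay of radial functions\<close>

lemma ennreal_le_divide:
  assumes "ennreal k * X \<le> ennreal Y" and "k > 0"
  shows "X \<le> ennreal (Y / k)"
proof -
  have "ennreal k * X \<le> ennreal k * ennreal (Y / k)"
    using assms by (simp add: ennreal_mult'[symmetric])
  moreover have "ennreal k \<noteq> 0" using assms(2) by simp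
  ultimately show ?thesis by (subst (asm) ennreal_mult_le_mult_iff) auto
qed

text \<open>
  The estimate on the line, applied to \<open>F(t) = f(e\<^sup>t)\<close>. The constant is uniform in \<open>f\<close> and \<open>K\<close>, so that the lemma
  applies to all truncations of a solution at once; the weighted norm only has to be finite, in order that
  \<open>f\<close> vanishes at infinity.
\<close>

lemma radial_pointwise_bound:
  fixes p e \<beta> :: real
  defines "N \<equiv> real CARD('n)"
  assumes p: "p > 1" and e: "e > 1" "e < N" and \<beta>: "\<beta> > 0"
  shows "\<exists>C>0. \<forall>f\<in>borel_measurable borel. \<forall>K\<ge>0.
    (\<forall>r>0. oscillation p (\<lambda>x :: real ^ 'n. f (norm x)) r \<le> ennreal (K * r powr (N + e))) \<longrightarrow>
    (\<integral>\<^sup>+x. ennreal (norm x powr \<beta> * \<bar>f (norm x)\<bar> powr p) \<partial>(lborel :: (real ^ 'n) measure)) < \<infinity> \<longrightarrow>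
    (AE x in (lborel :: (real ^ 'n) measure). \<bar>f (norm x)\<bar> \<le> C * K powr (1 / p) * norm x powr (- ((N - e) / p)))"
proof -
  define om where "om = unit_ball_vol N"
  have om: "om > 0" unfolding om_def N_def by (rule unit_ball_vol_pos) simp
  have N: "N > 0" by (simp add: N_def)
  define a where "a = (N - e) / p"
  have a: "a > 0" using e p by (simp add: a_def)
  define C1 where "C1 = 2 powr p * (1 + 7 powr (N + e)) / om"
  define C2 where "C2 = C1 / (N * om)"
  have C2: "C2 > 0" unfolding C2_def C1_def using om N by (intro divide_pos_pos mult_pos_pos add_pos_nonneg) auto
  define C3 where "C3 = exp a * (2 / (1 - exp (- a)) + 1 / (1 - (1 / 2) powr (e / p - 1 / p)))"
  have "(1 / 2) powr (e / p - 1 / p) < (1 :: real)"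
    using powr_less_mono2[of "e / p - 1 / p" "1 / 2" 1] e p by (simp add: divide_strict_right_mono)
  then have C3: "C3 > 0" unfolding C3_def using a by (intro mult_pos_pos add_pos_pos divide_pos_pos) auto
  show ?thesis
  proof (intro exI[of _ "C3 * C2 powr (1 / p)"] conjI ballI allI impI)
    show "0 < C3 * C2 powr (1 / p)" using C3 C2 by simp
    fix f :: "real \<Rightarrow> real" and K :: real
    assume f[measurable]: "f \<in> borel_measurable borel" and K: "0 \<le> K"
      and D: "\<forall>r>0. oscillation p (\<lambda>x :: real ^ 'n. f (norm x)) r \<le> ennreal (K * r powr (N + e))"
      and W: "(\<integral>\<^sup>+x. ennreal (norm x powr \<beta> * \<bar>f (norm x)\<bar> powr p) \<partial>(lborel :: (real ^ 'n) measure)) < \<infinity>"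
    define F where "F t = f (exp t)" for t
    have [measurable]: "F \<in> borel_measurable borel" unfolding F_def by measurable
    have Fln: "AE x in (lborel :: (real ^ 'n) measure). x \<noteq> 0 \<and> exp (ln (norm x)) = norm x"
      using AE_lborel_singleton[of "0 :: real ^ 'n"] by eventually_elim simp
    have weight: "ennreal (N * om * exp (N * t)) * (\<integral>\<^sup>+s\<in>{t..t + 1}. G s \<partial>lborel)
        \<le> (\<integral>\<^sup>+x. G (ln (norm x)) * indicator {t..t + 1} (ln (norm x)) \<partial>(lborel :: (real ^ 'n) measure))"
      if [measurable]: "G \<in> borel_measurable borel" for G :: "real \<Rightarrow> ennreal" and t
    proof -
      have "ennreal (N * om * exp (N * t)) * (\<integral>\<^sup>+s\<in>{t..t + 1}. G s \<partial>lborel)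
         = (\<integral>\<^sup>+s. ennreal (N * om * exp (N * t)) * (G s * indicator {t..t + 1} s) \<partial>lborel)"
        by (rule nn_integral_cmult[symmetric]) measurable
      also have "\<dots> \<le> (\<integral>\<^sup>+s. ennreal (N * om * exp (N * s)) * (G s * indicator {t..t + 1} s) \<partial>lborel)"
        using N om by (intro nn_integral_mono) (auto simp: indicator_def intro!: mult_right_mono ennreal_leI)
      also have "\<dots> = (\<integral>\<^sup>+x. G (ln (norm x)) * indicator {t..t + 1} (ln (norm x)) \<partial>(lborel :: (real ^ 'n) measure))"
        by (subst nn_integral_ln_norm[where G="\<lambda>s. G s * indicator {t..t + 1} s"]) (simp_all add: N_def om_def)
      finally show ?thesis .
    qed
    let ?M = "(C2 * K) powr (1 / p)"
    obtain W' where W': "(\<integral>\<^sup>+x. ennreal (norm x powr \<beta> * \<bar>f (norm x)\<bar> powr p) \<partial>(lborel :: (real ^ 'n) measure)) = ennreal W'" "W' \<ge> 0"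
      using W by (cases "\<integral>\<^sup>+x. ennreal (norm x powr \<beta> * \<bar>f (norm x)\<bar> powr p) \<partial>(lborel :: (real ^ 'n) measure)") auto
    let ?B = "(W' / (N * om)) powr (1 / p)"
    interpret weighted_hoelder_on_line F p "e / p" a "(N + \<beta>) / p" ?M ?B
    proof
      show "(\<integral>\<^sup>+s\<in>{t..t + 1}. ennreal (\<bar>F (s + h) - F s\<bar> powr p) \<partial>lborel) \<le> ennreal ((?M * h powr (e / p) * exp (- a * t)) powr p)"
        if h: "0 < h" "h \<le> 1" for t h
      proof -
        let ?G = "\<lambda>s. ennreal (\<bar>F (s + h) - F s\<bar> powr p)"
        have "ennreal (N * om * exp (N * t)) * (\<integral>\<^sup>+s\<in>{t..t + 1}. ?G s \<partial>lborel)
            \<le> (\<integral>\<^sup>+x. ?G (ln (norm x)) * indicator {t..t + 1} (ln (norm x)) \<partial>(lborel :: (real ^ 'n) measure))"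
          by (rule weight) measurable
        also have "\<dots> \<le> (\<integral>\<^sup>+x. ennreal (if exp t \<le> norm x \<and> norm x \<le> exp 1 * exp t
             then \<bar>f (norm (exp h *\<^sub>R x)) - f (norm x)\<bar> powr p else 0) \<partial>(lborel :: (real ^ 'n) measure))"
        proof (rule nn_integral_mono_AE)
          show "AE x in (lborel :: (real ^ 'n) measure). ?G (ln (norm x)) * indicator {t..t + 1} (ln (norm x))
            \<le> ennreal (if exp t \<le> norm x \<and> norm x \<le> exp 1 * exp t
               then \<bar>f (norm (exp h *\<^sub>R x)) - f (norm x)\<bar> powr p else 0)"
            using Fln
          proof eventually_elim
            case (elim x)
            have "exp t \<le> norm x \<and> norm x \<le> exp 1 * exp t" if "t \<le> ln (norm x)" "ln (norm x) \<le> t + 1"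
              using elim that by (metis add.commute exp_add exp_le_cancel_iff)
            moreover have "F (ln (norm x) + h) = f (norm (exp h *\<^sub>R x))" "F (ln (norm x)) = f (norm x)"
              using elim by (simp_all add: F_def exp_add mult.commute)
            ultimately show ?case by (auto simp: indicator_def)
          qed
        qed
        also have "\<dots> \<le> ennreal (2 powr p * (1 + 7 powr (real CARD('n) + e)) / unit_ball_vol (real CARD('n)) * K * (h * exp t) powr e)"
          by (rule dilation_increment[of "\<lambda>x :: real ^ 'n. f (norm x)"]) (use p K D h in \<open>auto simp: N_def\<close>)
        also have "2 powr p * (1 + 7 powr (real CARD('n) + e)) / unit_ball_vol (real CARD('n)) * K * (h * exp t) powr e
            = C1 * K * (h * exp t) powr e" by (simp add: C1_def om_def N_def)
        finally have "(\<integral>\<^sup>+s\<in>{t..t + 1}. ?G s \<partial>lborel) \<le> ennreal (C1 * K * (h * exp t) powr e / (N * om * exp (N * t)))"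
          using N om by (intro ennreal_le_divide) auto
        also have "C1 * K * (h * exp t) powr e / (N * om * exp (N * t)) = C2 * K * h powr e * (exp (e * t) / exp (N * t))"
        proof -
          have "(h * exp t) powr e = h powr e * exp (e * t)"
            using h by (simp add: powr_mult exp_powr_real mult.commute)
          then show ?thesis by (simp add: C2_def)
        qed
        also have "exp (e * t) / exp (N * t) = exp (- (N - e) * t)"
          by (simp add: exp_diff[symmetric] algebra_simps)
        also have "C2 * K * h powr e * exp (- (N - e) * t) = (?M * h powr (e / p) * exp (- a * t)) powr p"
        proof -
          have "- a * t * p = - (N - e) * t" using p by (simp add: a_def field_simps)
          then have "exp (- a * t) powr p = exp (- (N - e) * t)" by (simp only: exp_powr_real)
          then show ?thesis using p C2 K h by (simp add: powr_mult powr_powr)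
        qed
        finally show ?thesis .
      qed
      show "(\<integral>\<^sup>+s\<in>{t..t + 1}. ennreal (\<bar>F s\<bar> powr p) \<partial>lborel) \<le> ennreal ((?B * exp (- ((N + \<beta>) / p) * t)) powr p)" for t
      proof -
        let ?G = "\<lambda>s. ennreal (\<bar>F s\<bar> powr p)"
        have "ennreal (exp (\<beta> * t)) * (ennreal (N * om * exp (N * t)) * (\<integral>\<^sup>+s\<in>{t..t + 1}. ?G s \<partial>lborel))
            \<le> ennreal (exp (\<beta> * t)) * (\<integral>\<^sup>+x. ?G (ln (norm x)) * indicator {t..t + 1} (ln (norm x)) \<partial>(lborel :: (real ^ 'n) measure))"
          by (intro mult_left_mono weight) auto
        also have "\<dots> = (\<integral>\<^sup>+x. ennreal (exp (\<beta> * t)) * (?G (ln (norm x)) * indicator {t..t + 1} (ln (norm x))) \<partial>(lborel :: (real ^ 'n) measure))"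
          by (rule nn_integral_cmult[symmetric]) measurable
        also have "\<dots> \<le> (\<integral>\<^sup>+x. ennreal (norm x powr \<beta> * \<bar>f (norm x)\<bar> powr p) \<partial>(lborel :: (real ^ 'n) measure))"
        proof (rule nn_integral_mono_AE)
          show "AE x in (lborel :: (real ^ 'n) measure). ennreal (exp (\<beta> * t)) * (?G (ln (norm x)) * indicator {t..t + 1} (ln (norm x)))
             \<le> ennreal (norm x powr \<beta> * \<bar>f (norm x)\<bar> powr p)"
            using Fln
          proof eventually_elim
            case (elim x)
            have "exp (\<beta> * t) \<le> norm x powr \<beta>" if "t \<le> ln (norm x)"
              using elim that \<beta> by (simp add: powr_def)
            moreover have "F (ln (norm x)) = f (norm x)"
              using elim by (simp add: F_def)
            ultimately show ?case
              by (auto simp: indicator_def ennreal_mult'[symmetric] intro!: ennreal_leI mult_right_mono)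
          qed
        qed
        also note W'(1)
        finally have "ennreal (exp (\<beta> * t) * (N * om * exp (N * t))) * (\<integral>\<^sup>+s\<in>{t..t + 1}. ?G s \<partial>lborel) \<le> ennreal W'"
          using N om by (simp add: ennreal_mult' mult.assoc)
        then have "(\<integral>\<^sup>+s\<in>{t..t + 1}. ?G s \<partial>lborel) \<le> ennreal (W' / (exp (\<beta> * t) * (N * om * exp (N * t))))"
          using N om by (intro ennreal_le_divide) auto
        also have "W' / (exp (\<beta> * t) * (N * om * exp (N * t))) = W' / (N * om) * exp (- (N + \<beta>) * t)"
          by (simp add: exp_add exp_minus field_simps exp_diff)
        also have "\<dots> = (?B * exp (- ((N + \<beta>) / p) * t)) powr p"
        proof -
          have "- ((N + \<beta>) / p) * t * p = - (N + \<beta>) * t" using p by (simp add: field_simps)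
          then have "exp (- ((N + \<beta>) / p) * t) powr p = exp (- (N + \<beta>) * t)" by (simp only: exp_powr_real)
          then show ?thesis using p W'(2) N om by (simp add: powr_mult powr_powr)
        qed
        finally show ?thesis .
      qed
    qed (use p e a N \<beta> in auto)
    define L where "L = exp a * morrey_const * ?M"
    have AEt: "AE t in lborel. \<bar>F t\<bar> \<le> L * exp (- a * t)"
      unfolding L_def by (rule exponential_bound)
    have "Measurable.pred borel (\<lambda>t. \<bar>F t\<bar> \<le> L * exp (- a * t))"
      by measurable
    note AE_ln_norm[where 'n='n, OF AEt this]
    then have "AE x in (lborel :: (real ^ 'n) measure). \<bar>F (ln (norm x))\<bar> \<le> exp a * morrey_const * ?M * exp (- a * ln (norm x))"
      by (simp only: L_def)
    then show "AE x in (lborel :: (real ^ 'n) measure). \<bar>f (norm x)\<bar>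
        \<le> C3 * C2 powr (1 / p) * K powr (1 / p) * norm x powr (- ((N - e) / p))"
      using Fln
    proof eventually_elim
      case (elim x)
      have "F (ln (norm x)) = f (norm x)" using elim(2) by (simp add: F_def)
      moreover have "exp (- a * ln (norm x)) = norm x powr (- ((N - e) / p))"
        using elim(2) by (simp add: powr_def a_def)
      moreover have "exp a * morrey_const = C3" by (simp add: C3_def morrey_const_def)
      ultimately show ?case using elim(1) C2 K by (simp add: powr_mult mult.assoc)
    qed
  qed
qed

section \<open>De Giorgi iteration\<close>

lemma nn_integral_ball_powr:
  fixes \<kappa> \<rho> :: real
  assumes \<kappa>: "\<kappa> > 0" and \<rho>: "\<rho> \<ge> 0"
  shows "(\<integral>\<^sup>+x. ennreal (if norm x < \<rho> then norm x powr (\<kappa> - real CARD('n)) else 0) \<partial>(lborel :: (real ^ 'n) measure))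
    \<le> ennreal (real CARD('n) * unit_ball_vol (real CARD('n)) / \<kappa> * \<rho> powr \<kappa>)"
proof (cases "\<rho> = 0")
  case False
  then have \<rho>: "\<rho> > 0" using assms by simp
  let ?N = "real CARD('n)" and ?om = "unit_ball_vol (real CARD('n))"
  let ?G = "\<lambda>t. ennreal (if t \<le> ln \<rho> then exp ((\<kappa> - ?N) * t) else 0)"
  have om: "?om \<ge> 0" by simp
  have "(\<integral>\<^sup>+x. ennreal (if norm x < \<rho> then norm x powr (\<kappa> - ?N) else 0) \<partial>(lborel :: (real ^ 'n) measure))
      \<le> (\<integral>\<^sup>+x. ?G (ln (norm x)) \<partial>(lborel :: (real ^ 'n) measure))"
  proof (rule nn_integral_mono_AE)
    show "AE x in (lborel :: (real ^ 'n) measure). ennreal (if norm x < \<rho> then norm x powr (\<kappa> - ?N) else 0) \<le> ?G (ln (norm x))"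
      using AE_lborel_singleton[of "0 :: real ^ 'n"]
      by eventually_elim (use \<rho> in \<open>auto simp: powr_def\<close>)
  qed
  also have "\<dots> = (\<integral>\<^sup>+t. ennreal (?N * ?om * exp (?N * t)) * ?G t \<partial>lborel)"
    by (rule nn_integral_ln_norm) measurable
  also have "\<dots> = (\<integral>\<^sup>+t\<in>{..ln \<rho>}. ennreal (?N * ?om / \<kappa> * \<kappa> * exp (\<kappa> * t)) \<partial>lborel)"
  proof (rule nn_integral_cong)
    fix t :: real
    have "exp (?N * t) * exp ((\<kappa> - ?N) * t) = exp (\<kappa> * t)"
      by (simp add: exp_add[symmetric] algebra_simps)
    then show "ennreal (?N * ?om * exp (?N * t)) * ?G t = ennreal (?N * ?om / \<kappa> * \<kappa> * exp (\<kappa> * t)) * indicator {..ln \<rho>} t"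
      using \<kappa> om by (auto simp: indicator_def ennreal_mult'[symmetric] mult.assoc)
  qed
  also have "\<dots> = ennreal (?N * ?om / \<kappa> * exp (\<kappa> * ln \<rho>))"
    using \<kappa> by (intro nn_integral_exp_atMost) auto
  also have "exp (\<kappa> * ln \<rho>) = \<rho> powr \<kappa>" using \<rho> by (simp add: powr_def)
  finally show ?thesis .
qed simp

text \<open>
  De Giorgi's fast geometric convergence: with \<open>r = b\<^bsup>-1/\<delta>\<^esup>\<close> the bound \<open>Y j \<le> Y 0 r\<^sup>j\<close> reproduces itself.
\<close>

lemma superlinear_recursion_decay:
  fixes Y :: "nat \<Rightarrow> real"
  assumes nonneg: "\<And>j. Y j \<ge> 0" and A: "A \<ge> 0" and b: "b > 1" and \<delta>: "\<delta> > 0"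
    and rec: "\<And>j. Y (Suc j) \<le> A * b ^ j * Y j powr (1 + \<delta>)"
    and small: "A * Y 0 powr \<delta> * b powr (1 / \<delta>) \<le> 1"
  shows "Y \<longlonglongrightarrow> 0"
proof -
  define r where "r = b powr (- (1 / \<delta>))"
  have r: "0 < r" "r < 1" using b \<delta> by (auto simp: r_def powr_less_one intro: powr_less_one)
  have "r powr \<delta> = b powr (- 1)" using \<delta> by (simp add: r_def powr_powr)
  then have rb: "b * r powr \<delta> = 1" using b by (simp add: powr_minus)
  have small': "A * Y 0 powr \<delta> \<le> r"
    using small b by (simp add: r_def powr_minus field_simps)
  have bound: "Y j \<le> Y 0 * r ^ j" for j
  proof (induction j)
    case (Suc j)
    have "Y (Suc j) \<le> A * b ^ j * Y j powr (1 + \<delta>)" by (rule rec)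
    also have "\<dots> \<le> A * b ^ j * (Y 0 * r ^ j) powr (1 + \<delta>)"
      using Suc A b \<delta> nonneg by (intro mult_left_mono powr_mono2) auto
    also have "(Y 0 * r ^ j) powr (1 + \<delta>) = (Y 0 * Y 0 powr \<delta>) * (r ^ j * (r powr \<delta>) ^ j)"
      using nonneg r by (simp add: powr_mult powr_add powr_realpow[symmetric] powr_powr mult.commute)
    also have "A * b ^ j * ((Y 0 * Y 0 powr \<delta>) * (r ^ j * (r powr \<delta>) ^ j))
        = (A * Y 0 powr \<delta>) * Y 0 * r ^ j * (b * r powr \<delta>) ^ j"
      by (simp add: power_mult_distrib mult_ac)
    also have "\<dots> \<le> r * Y 0 * r ^ j"
      unfolding rb using small' nonneg r by (simp add: mult_right_mono)
    finally show ?case by (simp add: mult_ac)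
  qed simp
  have "(\<lambda>j. Y 0 * r ^ j) \<longlonglongrightarrow> Y 0 * 0"
    using r by (intro tendsto_mult_left LIMSEQ_power_zero) auto
  then show ?thesis
    by (intro tendsto_sandwich[of "\<lambda>_. 0" Y sequentially "\<lambda>j. Y 0 * r ^ j"]) (use nonneg bound in auto)
qed

text \<open>
  The level-set argument described at the beginning, with levels \<open>d(2 - 2\<^bsup>-j\<^esup>)\<close>. In the recursion \<open>d\<close> occurs with
  the negative power \<open>-\<epsilon>/a\<close>, so a large \<open>d\<close> meets the smallness condition on the starting value.
\<close>

lemma bounded_of_level_set_estimate:
  fixes u :: "real ^ 'n \<Rightarrow> real" and p q a \<epsilon> \<alpha> C0 Cr :: real
  assumes [measurable]: "u \<in> borel_measurable borel"
    and p: "p > 1" and q: "q > p" and a: "a > 0" and \<epsilon>: "\<epsilon> > 0"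
    and exponents: "\<alpha> - a * q = \<epsilon> - real CARD('n)"
    and C0: "C0 > 0" and Cr: "Cr > 0"
    and F1: "AE x in lborel. \<bar>u x\<bar> \<le> C0 * norm x powr (- a)"
    and F2: "\<And>k J. k > 0 \<Longrightarrow> J \<ge> 0 \<Longrightarrow>
      (\<integral>\<^sup>+x. ennreal (if u x > k then norm x powr \<alpha> * u x powr q else 0) \<partial>lborel) \<le> ennreal J \<Longrightarrow>
      AE x in lborel. u x - k \<le> Cr * J powr (1 / p) * norm x powr (- a)"
  shows "\<exists>d>0. AE x in lborel. u x \<le> d"
proof -
  define X where "X k = (\<integral>\<^sup>+x. ennreal (if u x > k then norm x powr \<alpha> * u x powr q else 0) \<partial>lborel)" for k
  let ?N = "real CARD('n)"
  define c where "c = ?N * unit_ball_vol ?N / \<epsilon>"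
  have c: "c \<ge> 0" using \<epsilon> by (simp add: c_def)
  have nz: "AE x in (lborel :: (real ^ 'n) measure). norm x > 0"
    using AE_lborel_singleton[of "0 :: real ^ 'n"] by eventually_elim simp
  have ball_int: "(\<integral>\<^sup>+x. ennreal (if norm x < \<rho> then D * norm x powr (\<epsilon> - ?N) else 0) \<partial>(lborel :: (real ^ 'n) measure))
      \<le> ennreal (D * (c * \<rho> powr \<epsilon>))" if "D \<ge> 0" "\<rho> \<ge> 0" for D \<rho>
  proof -
    have "(\<integral>\<^sup>+x. ennreal (if norm x < \<rho> then D * norm x powr (\<epsilon> - ?N) else 0) \<partial>(lborel :: (real ^ 'n) measure))
      = (\<integral>\<^sup>+x. ennreal D * ennreal (if norm x < \<rho> then norm x powr (\<epsilon> - ?N) else 0) \<partial>(lborel :: (real ^ 'n) measure))"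
      using that by (intro nn_integral_cong) (auto simp: ennreal_mult'[symmetric])
    also have "\<dots> = ennreal D * (\<integral>\<^sup>+x. ennreal (if norm x < \<rho> then norm x powr (\<epsilon> - ?N) else 0) \<partial>(lborel :: (real ^ 'n) measure))"
      by (rule nn_integral_cmult) measurable
    also have "\<dots> \<le> ennreal D * ennreal (c * \<rho> powr \<epsilon>)"
      unfolding c_def by (intro mult_left_mono nn_integral_ball_powr \<epsilon> that) auto
    finally show ?thesis using that by (simp add: ennreal_mult'[symmetric])
  qed
  \<comment> \<open>on a level set the pointwise bound confines \<open>x\<close> to a small ball\<close>
  have small_norm: "norm x < (B / m) powr (1 / a)" if "m > 0" "norm x > 0" "m < B * norm x powr (- a)"
    for B m :: real and x :: "real ^ 'n"
  proof -
    have "norm x powr a < B / m"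
      using that by (simp add: powr_minus field_simps)
    then have "(norm x powr a) powr (1 / a) < (B / m) powr (1 / a)"
      using a by (intro powr_less_mono2) auto
    then show ?thesis using a that by (simp add: powr_powr)
  qed
  have finite: "X k < \<infinity>" if k: "k > 0" for k
  proof -
    have "X k \<le> (\<integral>\<^sup>+x. ennreal (if norm x < (C0 / k) powr (1 / a) then C0 powr q * norm x powr (\<epsilon> - ?N) else 0) \<partial>(lborel :: (real ^ 'n) measure))"
      unfolding X_def
    proof (rule nn_integral_mono_AE)
      show "AE x in lborel. ennreal (if u x > k then norm x powr \<alpha> * u x powr q else 0)
        \<le> ennreal (if norm x < (C0 / k) powr (1 / a) then C0 powr q * norm x powr (\<epsilon> - ?N) else 0)"
        using F1 nz
      proof eventually_elim
        case (elim x)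
        show ?case
        proof (cases "u x > k")
          case True
          have "norm x < (C0 / k) powr (1 / a)" using small_norm[of k x C0] elim True k by simp
          moreover have "norm x powr \<alpha> * u x powr q \<le> norm x powr \<alpha> * (C0 * norm x powr (- a)) powr q"
            using elim True k p q by (intro mult_left_mono powr_mono2) auto
          moreover have "norm x powr \<alpha> * (C0 * norm x powr (- a)) powr q = C0 powr q * norm x powr (\<epsilon> - ?N)"
          proof -
            have "(C0 * norm x powr (- a)) powr q = C0 powr q * norm x powr (- a * q)"
              using C0 by (simp add: powr_mult powr_powr)
            moreover have "norm x powr \<alpha> * norm x powr (- a * q) = norm x powr (\<epsilon> - ?N)"
              unfolding exponents[symmetric] powr_add[symmetric] by (simp add: algebra_simps)
            ultimately show ?thesis by (simp add: mult.left_commute)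
          qed
          ultimately show ?thesis using True by (auto intro!: ennreal_leI)
        qed simp
      qed
    qed
    also have "\<dots> \<le> ennreal (C0 powr q * (c * ((C0 / k) powr (1 / a)) powr \<epsilon>))"
      by (rule ball_int) auto
    finally show ?thesis by (simp add: order_le_less_trans)
  qed
  define Y where "Y k = enn2real (X k)" for k
  have Y: "X k = ennreal (Y k)" if "k > 0" for k
    using finite[OF that] by (simp add: Y_def)
  have Y0: "Y k \<ge> 0" for k by (simp add: Y_def)
  have F2': "AE x in lborel. u x - k \<le> Cr * Y k powr (1 / p) * norm x powr (- a)" if "k > 0" for k
    using F2[OF that Y0] Y[OF that] by (simp add: X_def)
  have step: "Y l \<le> C0 powr (q - p) * (l / (l - k) * Cr) powr p * Y k * (c * (Cr * Y k powr (1 / p) / (l - k)) powr (\<epsilon> / a))"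
    if kl: "0 < k" "k < l" for k l
  proof -
    let ?\<rho> = "(Cr * Y k powr (1 / p) / (l - k)) powr (1 / a)"
    let ?D = "C0 powr (q - p) * (l / (l - k) * Cr) powr p * Y k"
    have D: "?D \<ge> 0" using Y0 by simp
    have "X l \<le> (\<integral>\<^sup>+x. ennreal (if norm x < ?\<rho> then ?D * norm x powr (\<epsilon> - ?N) else 0) \<partial>(lborel :: (real ^ 'n) measure))"
      unfolding X_def
    proof (rule nn_integral_mono_AE)
      show "AE x in lborel. ennreal (if u x > l then norm x powr \<alpha> * u x powr q else 0)
        \<le> ennreal (if norm x < ?\<rho> then ?D * norm x powr (\<epsilon> - ?N) else 0)"
        using F1 nz F2'[OF kl(1)]
      proof eventually_elim
        case (elim x)
        show ?case
        proof (cases "u x > l")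
          case True
          have n: "norm x < ?\<rho>" using small_norm[of "l - k" x "Cr * Y k powr (1 / p)"] elim True kl by simp
          have "u x * (l - k) \<le> l * (u x - k)"
            using True kl by (simp add: algebra_simps)
          then have "u x \<le> l / (l - k) * (u x - k)"
            using kl by (simp add: field_simps)
          also have "\<dots> \<le> l / (l - k) * (Cr * Y k powr (1 / p) * norm x powr (- a))"
            using elim kl by (intro mult_left_mono) auto
          finally have "u x powr p \<le> (l / (l - k) * (Cr * Y k powr (1 / p) * norm x powr (- a))) powr p"
            using True kl p by (intro powr_mono2) auto
          also have "\<dots> = (l / (l - k) * Cr) powr p * Y k * norm x powr (- a * p)"
            using kl Cr p Y0[of k] by (simp add: powr_mult powr_powr powr_divide)
          finally have up: "u x powr p \<le> (l / (l - k) * Cr) powr p * Y k * norm x powr (- a * p)" .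
          have "u x powr (q - p) \<le> (C0 * norm x powr (- a)) powr (q - p)"
            using elim True kl q by (intro powr_mono2) auto
          also have "\<dots> = C0 powr (q - p) * norm x powr (- a * (q - p))"
            using C0 by (simp add: powr_mult powr_powr)
          finally have "u x powr (q - p) * u x powr p
              \<le> (C0 powr (q - p) * norm x powr (- a * (q - p))) * ((l / (l - k) * Cr) powr p * Y k * norm x powr (- a * p))"
            using up by (intro mult_mono) auto
          also have "u x powr (q - p) * u x powr p = u x powr q" by (simp add: powr_add[symmetric])
          finally have "norm x powr \<alpha> * u x powr q \<le> norm x powr \<alpha> *
             ((C0 powr (q - p) * norm x powr (- a * (q - p))) * ((l / (l - k) * Cr) powr p * Y k * norm x powr (- a * p)))"
            by (intro mult_left_mono) auto
          also have "\<dots> = ?D * (norm x powr \<alpha> * norm x powr (- a * (q - p)) * norm x powr (- a * p))"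
            by (simp add: mult_ac)
          also have "norm x powr \<alpha> * norm x powr (- a * (q - p)) * norm x powr (- a * p) = norm x powr (\<epsilon> - ?N)"
            unfolding exponents[symmetric] powr_add[symmetric] by (simp add: algebra_simps)
          finally show ?thesis using True n by (auto intro!: ennreal_leI)
        qed simp
      qed
    qed
    also have "\<dots> \<le> ennreal (?D * (c * ?\<rho> powr \<epsilon>))"
      by (rule ball_int[OF D]) simp
    finally have "ennreal (Y l) \<le> ennreal (?D * (c * ?\<rho> powr \<epsilon>))" using Y[of l] kl by simp
    then have "Y l \<le> ?D * (c * ?\<rho> powr \<epsilon>)"
      using D c by (subst (asm) ennreal_le_iff) (auto intro!: mult_nonneg_nonneg)
    then show ?thesis by (simp add: powr_powr)
  qed
  define \<delta> where "\<delta> = \<epsilon> / (a * p)"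
  have \<delta>: "\<delta> > 0" using \<epsilon> a p by (simp add: \<delta>_def)
  define b where "b = 2 powr (p + \<epsilon> / a)"
  have "p + \<epsilon> / a > 0" using p \<epsilon> a by (intro add_pos_pos) auto
  then have b: "b > 1" unfolding b_def by (intro gr_one_powr) auto
  define A1 where "A1 = C0 powr (q - p) * (4 * Cr) powr p * c * (2 * Cr) powr (\<epsilon> / a)"
  have A1: "A1 \<ge> 0" using c by (simp add: A1_def)
  \<comment> \<open>the least \<open>d \<ge> 1\<close> for which the starting value is small enough\<close>
  define d where "d = max 1 ((A1 * Y 1 powr \<delta> * b powr (1 / \<delta>)) powr (a / \<epsilon>))"
  have d: "d \<ge> 1" by (simp add: d_def)
  define A where "A = A1 * d powr (- (\<epsilon> / a))"
  have A: "A \<ge> 0" using A1 by (simp add: A_def)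
  define K where "K j = d * (2 - (1 / 2) ^ j)" for j :: nat
  have Kd: "d \<le> K j" "K j < 2 * d" for j
  proof -
    have "(1 / 2 :: real) ^ j \<le> 1" "(1 / 2 :: real) ^ j > 0" by (simp_all add: power_le_one)
    then show "d \<le> K j" "K j < 2 * d" using d by (auto simp: K_def algebra_simps)
  qed
  have mono: "Y l \<le> Y k" if "0 < k" "k \<le> l" for k l
  proof -
    have "X l \<le> X k" unfolding X_def using that by (intro nn_integral_mono ennreal_leI) auto
    then show ?thesis using Y0 that by (simp add: Y)
  qed
  have "(\<lambda>j. Y (K j)) \<longlonglongrightarrow> 0"
  proof (rule superlinear_recursion_decay[OF Y0 A b \<delta>])
    fix j
    have diff: "K (Suc j) - K j = d * (1 / 2) ^ Suc j" by (simp add: K_def algebra_simps)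
    have "d * (1 / 2) ^ Suc j > 0" using d by simp
    then have Kpos: "0 < K j" "K j < K (Suc j)" using Kd(1)[of j] d diff by linarith+
    have "Y (K (Suc j)) \<le> C0 powr (q - p) * (K (Suc j) / (K (Suc j) - K j) * Cr) powr p * Y (K j)
        * (c * (Cr * Y (K j) powr (1 / p) / (K (Suc j) - K j)) powr (\<epsilon> / a))"
      by (rule step[OF Kpos])
    also have "\<dots> \<le> C0 powr (q - p) * (4 * Cr * 2 ^ j) powr p * Y (K j)
        * (c * (2 * Cr / d * 2 ^ j * Y (K j) powr (1 / p)) powr (\<epsilon> / a))"
    proof -
      have "K (Suc j) / (K (Suc j) - K j) * Cr \<le> 4 * Cr * 2 ^ j"
      proof -
        have "K (Suc j) / (d * (1 / 2) ^ Suc j) \<le> 2 * d / (d * (1 / 2) ^ Suc j)"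
          using Kd(2)[of "Suc j"] d by (intro divide_right_mono) auto
        also have "\<dots> = 4 * 2 ^ j" using d by (simp add: field_simps power_one_over)
        finally have "K (Suc j) / (d * (1 / 2) ^ Suc j) * Cr \<le> 4 * 2 ^ j * Cr"
          using Cr by (intro mult_right_mono) auto
        then show ?thesis unfolding diff by (simp only: mult_ac)
      qed
      moreover have "Cr * Y (K j) powr (1 / p) / (K (Suc j) - K j) = 2 * Cr / d * 2 ^ j * Y (K j) powr (1 / p)"
        unfolding diff using d by (simp add: field_simps power_one_over)
      moreover have "0 \<le> K (Suc j) / (K (Suc j) - K j) * Cr" using Kpos Cr by simp
      ultimately show ?thesis
        using Y0 c p by (auto intro!: mult_left_mono mult_right_mono powr_mono2)
    qed
    also have "\<dots> = A * b ^ j * Y (K j) powr (1 + \<delta>)"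
    proof -
      have e1: "(4 * Cr * 2 ^ j) powr p = (4 * Cr) powr p * (2 powr p) ^ j"
        using Cr by (simp add: powr_mult powr_realpow[symmetric] powr_powr mult.commute)
      have e2: "(2 * Cr / d * 2 ^ j * Y (K j) powr (1 / p)) powr (\<epsilon> / a)
          = (2 * Cr) powr (\<epsilon> / a) * d powr (- (\<epsilon> / a)) * (2 powr (\<epsilon> / a)) ^ j * Y (K j) powr \<delta>"
      proof -
        have "(2 * Cr / d * 2 ^ j * Y (K j) powr (1 / p)) powr (\<epsilon> / a)
          = (2 * Cr) powr (\<epsilon> / a) / d powr (\<epsilon> / a) * ((2 :: real) ^ j) powr (\<epsilon> / a) * (Y (K j) powr (1 / p)) powr (\<epsilon> / a)"
          using Cr d Y0 by (simp add: powr_mult powr_divide)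
        also have "((2 :: real) ^ j) powr (\<epsilon> / a) = (2 powr (\<epsilon> / a)) ^ j"
          by (simp add: powr_realpow[symmetric] powr_powr mult.commute)
        also have "(Y (K j) powr (1 / p)) powr (\<epsilon> / a) = Y (K j) powr \<delta>"
          by (simp add: powr_powr \<delta>_def mult.commute)
        finally show ?thesis by (simp add: powr_minus divide_inverse)
      qed
      have e3: "b ^ j = (2 powr p) ^ j * (2 powr (\<epsilon> / a)) ^ j"
        by (simp add: b_def powr_add power_mult_distrib)
      have e4: "Y (K j) powr (1 + \<delta>) = Y (K j) * Y (K j) powr \<delta>" using Y0 by (simp add: powr_add)
      show ?thesis unfolding e1 e2 e3 e4 A_def A1_def by (simp add: mult_ac)
    qed
    finally show "Y (K (Suc j)) \<le> A * b ^ j * Y (K j) powr (1 + \<delta>)" .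
  next
    have "Y (K 0) \<le> Y 1" using d by (intro mono) (auto simp: K_def)
    then have "A * Y (K 0) powr \<delta> * b powr (1 / \<delta>) \<le> A * Y 1 powr \<delta> * b powr (1 / \<delta>)"
      using A \<delta> Y0 by (intro mult_right_mono mult_left_mono powr_mono2) auto
    also have "\<dots> = (A1 * Y 1 powr \<delta> * b powr (1 / \<delta>)) * d powr (- (\<epsilon> / a))"
      by (simp add: A_def mult_ac)
    also have "\<dots> \<le> 1"
    proof -
      let ?Z = "A1 * Y 1 powr \<delta> * b powr (1 / \<delta>)"
      have Z: "?Z \<ge> 0" using A1 by simp
      have "?Z = (?Z powr (a / \<epsilon>)) powr (\<epsilon> / a)" using Z a \<epsilon> by (simp add: powr_powr)
      also have "\<dots> \<le> d powr (\<epsilon> / a)" using a \<epsilon> by (intro powr_mono2) (auto simp: d_def)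
      finally show ?thesis using d by (simp add: powr_minus field_simps)
    qed
    finally show "A * Y (K 0) powr \<delta> * b powr (1 / \<delta>) \<le> 1" .
  qed
  moreover have "Y (2 * d) \<le> Y (K j)" for j
    using Kd[of j] d by (intro mono) auto
  ultimately have "Y (2 * d) \<le> 0" by (intro LIMSEQ_le_const) auto
  then have "Y (2 * d) = 0" using Y0[of "2 * d"] by simp
  then have "AE x in lborel. u x \<le> 2 * d" using F2'[of "2 * d"] d by simp
  then show ?thesis using d by (intro exI[of _ "2 * d"]) auto
qed

section \<open>Truncations\<close>

text \<open>
  A \<open>C\<^sup>1\<close> substitute for \<open>(t - k)\<^sup>+\<close>, below it by at most \<open>h\<close>. Being \<open>C\<^sup>1\<close>, it is within the reach of the
  chain rule above.
\<close>

definition smooth_excess :: "real \<Rightarrow> real \<Rightarrow> real \<Rightarrow> real" where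
  "smooth_excess k h t = sqrt (h\<^sup>2 + (max 0 (t - k))\<^sup>2) - h"

definition smooth_excess' :: "real \<Rightarrow> real \<Rightarrow> real \<Rightarrow> real" where
  "smooth_excess' k h t = max 0 (t - k) / sqrt (h\<^sup>2 + (max 0 (t - k))\<^sup>2)"

lemma max_0_squared_derivative: "((\<lambda>t::real. (max 0 (t - k))\<^sup>2) has_real_derivative 2 * max 0 (t - k)) (at t)"
proof -
  consider "t > k" | "t < k" | "t = k" by linarith
  then show ?thesis
  proof cases
    case 1
    have "((\<lambda>t::real. (t - k)\<^sup>2) has_real_derivative 2 * max 0 (t - k)) (at t)"
      using 1 by (auto intro!: derivative_eq_intros)
    then show ?thesis
      by (rule has_field_derivative_transform_within_open[where S="{k<..}"]) (use 1 in auto)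
  next
    case 2
    have "((\<lambda>t::real. 0) has_real_derivative 2 * max 0 (t - k)) (at t)"
      using 2 by auto
    then show ?thesis
      by (rule has_field_derivative_transform_within_open[where S="{..<k}"]) (use 2 in auto)
  next
    case 3
    have "((\<lambda>y. ((max 0 (y - k))\<^sup>2 - 0) / (y - k)) \<longlongrightarrow> 0) (at k)"
    proof (rule Lim_null_comparison)
      show "\<forall>\<^sub>F y in at k. norm (((max 0 (y - k))\<^sup>2 - 0) / (y - k)) \<le> \<bar>y - k\<bar>"
        by (rule always_eventually) (auto simp: max_def power2_eq_square)
      show "((\<lambda>y. \<bar>y - k\<bar>) \<longlongrightarrow> 0) (at k)"
      proof -
        have "((\<lambda>y. \<bar>y - k\<bar>) \<longlongrightarrow> \<bar>k - k\<bar>) (at k)" by (intro tendsto_intros)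
        then show ?thesis by simp
      qed
    qed
    then show ?thesis using 3 by (simp add: has_field_derivative_iff)
  qed
qed

context
  fixes k h :: real
  assumes h: "h > 0"
begin

lemma root_pos: "h\<^sup>2 + (max 0 (t - k))\<^sup>2 > 0"
  using h by (intro add_pos_nonneg) auto

lemma smooth_excess_derivative: "(smooth_excess k h has_real_derivative smooth_excess' k h t) (at t)"
proof -
  have "((\<lambda>t. h\<^sup>2 + (max 0 (t - k))\<^sup>2) has_real_derivative 0 + 2 * max 0 (t - k)) (at t)"
    by (intro DERIV_add DERIV_const max_0_squared_derivative)
  then have "((\<lambda>t. sqrt (h\<^sup>2 + (max 0 (t - k))\<^sup>2)) has_real_derivative
      inverse (sqrt (h\<^sup>2 + (max 0 (t - k))\<^sup>2)) / 2 * (0 + 2 * max 0 (t - k))) (at t)"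
    by (rule DERIV_chain2[where f=sqrt and g="\<lambda>t. h\<^sup>2 + (max 0 (t - k))\<^sup>2", OF DERIV_real_sqrt[OF root_pos]])
  then have "((\<lambda>t. sqrt (h\<^sup>2 + (max 0 (t - k))\<^sup>2) - h) has_real_derivative
      inverse (sqrt (h\<^sup>2 + (max 0 (t - k))\<^sup>2)) / 2 * (0 + 2 * max 0 (t - k)) - 0) (at t)"
    by (rule DERIV_diff[OF _ DERIV_const])
  moreover have "smooth_excess k h = (\<lambda>t. sqrt (h\<^sup>2 + (max 0 (t - k))\<^sup>2) - h)"
    by (rule ext) (simp add: smooth_excess_def)
  moreover have "smooth_excess' k h t = inverse (sqrt (h\<^sup>2 + (max 0 (t - k))\<^sup>2)) / 2 * (0 + 2 * max 0 (t - k)) - 0"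
    by (simp only: smooth_excess'_def divide_inverse) algebra
  ultimately show ?thesis by (simp only:)
qed

lemma smooth_excess'_continuous: "continuous_on UNIV (smooth_excess' k h)"
  unfolding smooth_excess'_def
  by (intro continuous_intros ballI) (metis root_pos less_irrefl real_sqrt_eq_zero_cancel_iff)

lemma smooth_excess'_bounds: "0 \<le> smooth_excess' k h t" "smooth_excess' k h t \<le> 1"
proof -
  show "0 \<le> smooth_excess' k h t" by (simp add: smooth_excess'_def)
  have "max 0 (t - k) \<le> sqrt (h\<^sup>2 + (max 0 (t - k))\<^sup>2)" by (rule real_le_rsqrt) simp
  then show "smooth_excess' k h t \<le> 1"
    using root_pos[of t] by (simp add: smooth_excess'_def divide_le_eq_1)
qed

lemma smooth_excess_nonneg: "0 \<le> smooth_excess k h t"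
  using h unfolding smooth_excess_def by (simp add: real_le_rsqrt)

lemma smooth_excess_upper: "smooth_excess k h t \<le> max 0 (t - k)"
proof -
  have "sqrt (h\<^sup>2 + (max 0 (t - k))\<^sup>2) \<le> h + max 0 (t - k)"
    using h by (intro real_le_lsqrt) (auto simp: power2_sum)
  then show ?thesis by (simp add: smooth_excess_def)
qed

lemma smooth_excess_lower: "t - k - h \<le> smooth_excess k h t"
proof -
  have "t - k \<le> sqrt (h\<^sup>2 + (max 0 (t - k))\<^sup>2)"
    by (rule order_trans[of _ "max 0 (t - k)"], simp, rule real_le_rsqrt, simp)
  then show ?thesis by (simp add: smooth_excess_def)
qed

lemma smooth_excess_increment: "b \<le> c \<Longrightarrow> 0 \<le> smooth_excess k h c - smooth_excess k h b \<and> smooth_excess k h c - smooth_excess k h b \<le> c - b"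
proof
  assume bc: "b \<le> c"
  show "0 \<le> smooth_excess k h c - smooth_excess k h b"
    using DERIV_nonneg_imp_nondecreasing[OF bc, of "smooth_excess k h"] smooth_excess_derivative smooth_excess'_bounds by auto
  have "\<exists>y. ((\<lambda>t. t - smooth_excess k h t) has_real_derivative y) (at x) \<and> 0 \<le> y" for x
    using smooth_excess'_bounds[of x]
    by (intro exI[of _ "1 - smooth_excess' k h x"]) (auto intro!: derivative_eq_intros smooth_excess_derivative)
  then show "smooth_excess k h c - smooth_excess k h b \<le> c - b"
    using DERIV_nonneg_imp_nondecreasing[OF bc, of "\<lambda>t. t - smooth_excess k h t"] by auto
qed

lemma smooth_excess_abs_le: "k \<ge> 0 \<Longrightarrow> \<bar>smooth_excess k h t\<bar> \<le> \<bar>t\<bar>"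
  using smooth_excess_nonneg[of t] smooth_excess_upper[of t] by auto

lemma smooth_excess_measurable: "smooth_excess k h \<in> borel_measurable borel"
  unfolding smooth_excess_def by measurable

text \<open>
  A nondecreasing function with Lipschitz constant \<open>1\<close> only decreases the energy density, also when it
  occurs in just one factor of the weak form; \<open>Phi_scaled_bound\<close> is the local counterpart.
\<close>

lemma smooth_excess_nonlocal_bound:
  assumes p: "p > 1"
  shows "\<bar>smooth_excess k h b - smooth_excess k h c\<bar> powr p \<le> Phi p (b - c) * (smooth_excess k h b - smooth_excess k h c)"
    and "\<bar>smooth_excess k h b - smooth_excess k h c\<bar> \<le> \<bar>b - c\<bar>"
proof -
  let ?B = "smooth_excess k h b - smooth_excess k h c"
  have 1: "\<bar>?B\<bar> \<le> \<bar>b - c\<bar>"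
    using smooth_excess_increment[of b c] smooth_excess_increment[of c b] by (cases "b \<le> c") auto
  have "0 \<le> (b - c) * ?B"
    using smooth_excess_increment[of b c] smooth_excess_increment[of c b]
    by (cases "b \<le> c") (auto intro: mult_nonpos_nonpos)
  then have 2: "(b - c) * ?B = \<bar>b - c\<bar> * \<bar>?B\<bar>" by (simp add: abs_mult[symmetric])
  show "\<bar>?B\<bar> \<le> \<bar>b - c\<bar>" by fact
  have "\<bar>?B\<bar> powr p = \<bar>?B\<bar> powr (p - 1) * \<bar>?B\<bar>"
    by (cases "?B = 0") (auto simp: powr_diff)
  also have "\<dots> \<le> \<bar>b - c\<bar> powr (p - 1) * \<bar>?B\<bar>"
    using 1 p by (intro mult_right_mono powr_mono2) auto
  also have "\<dots> = \<bar>b - c\<bar> powr (p - 2) * (\<bar>b - c\<bar> * \<bar>?B\<bar>)"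
    using powr_add[of "\<bar>b - c\<bar>" "p - 2" 1] by simp
  also have "\<dots> = Phi p (b - c) * ?B" by (simp add: Phi_def 2[symmetric])
  finally show "\<bar>?B\<bar> powr p \<le> Phi p (b - c) * ?B" .
qed

end

lemma Phi_scaled_bound:
  fixes g :: "'a::real_inner"
  assumes "0 \<le> \<tau>" "\<tau> \<le> 1" "p > 1"
  shows "norm (\<tau> *\<^sub>R g) powr p \<le> Phi p g \<bullet> (\<tau> *\<^sub>R g)"
proof -
  have "\<tau> powr p \<le> \<tau>"
    using assms powr_mono'[of 1 p \<tau>] by (cases "\<tau> = 0") auto
  then have le: "\<tau> powr p * norm g powr p \<le> \<tau> * norm g powr p" by (intro mult_right_mono) auto
  have "norm g powr p = norm g powr (p - 2) * (norm g)\<^sup>2"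
    by (cases "g = 0") (auto simp: powr_diff)
  then have "Phi p g \<bullet> (\<tau> *\<^sub>R g) = \<tau> * norm g powr p"
    by (simp add: Phi_def dot_square_norm)
  moreover have "norm (\<tau> *\<^sub>R g) powr p = \<tau> powr p * norm g powr p"
    using assms by (simp add: powr_mult)
  ultimately show ?thesis using le by (simp only:)
qed

section \<open>Energy of truncated solutions\<close>

lemma AE_lebesgue_pair:
  fixes P :: "real ^ 'n \<Rightarrow> bool"
  assumes "AE x in lebesgue. P x"
  shows "AE z in (lebesgue :: ((real ^ 'n) \<times> (real ^ 'n)) measure). P (fst z) \<and> P (snd z)"
proof -
  have "AE x in lborel. P x" using assms by (simp add: AE_completion_iff)
  then obtain S where S: "{x \<in> space lborel. \<not> P x} \<subseteq> S" "S \<in> null_sets lborel"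
    by (auto simp: eventually_ae_filter)
  have [measurable]: "S \<in> sets borel" using S(2) by auto
  have *: "AE x in lborel. x \<notin> S" using S(2) by (rule AE_not_in)
  have m: "{z \<in> space (lborel \<Otimes>\<^sub>M lborel). fst z \<notin> S} \<in> sets (lborel \<Otimes>\<^sub>M (lborel :: (real ^ 'n) measure))"
    "{z \<in> space (lborel \<Otimes>\<^sub>M lborel). snd z \<notin> S} \<in> sets ((lborel :: (real ^ 'n) measure) \<Otimes>\<^sub>M lborel)"
    by measurable
  have "AE z in lborel \<Otimes>\<^sub>M (lborel :: (real ^ 'n) measure). fst z \<notin> S"
    by (rule lborel_pair.AE_pair_measure[OF m(1)]) (use * in auto)
  moreover have "AE z in (lborel :: (real ^ 'n) measure) \<Otimes>\<^sub>M lborel. snd z \<notin> S"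
    by (rule lborel_pair.AE_pair_measure[OF m(2)]) (use * in auto)
  ultimately have "AE z in lborel \<Otimes>\<^sub>M lborel. P (fst z) \<and> P (snd z)"
    by eventually_elim (use S(1) in auto)
  then show ?thesis unfolding lborel_prod by (rule AE_completion)
qed

lemma ennreal_integral_le:
  assumes "integrable M f" "AE x in M. 0 \<le> f x" "(\<integral>\<^sup>+x. ennreal (f x) \<partial>M) \<le> ennreal J" "J \<ge> 0"
  shows "integral\<^sup>L M f \<le> J"
  using nn_integral_eq_integral[OF assms(1,2)] assms(3,4) by simp

lemma oscillation_weak_gradient:
  fixes w :: "real ^ 'n \<Rightarrow> real"
  assumes wk: "has_weak_gradient w g" and w: "w \<in> borel_measurable borel"
    and p: "p > 1" and r: "r > 0" and E: "(\<integral>\<^sup>+x. ennreal (norm (g x) powr p) \<partial>lebesgue) \<le> ennreal E" "E \<ge> 0"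
  shows "oscillation p w r \<le> ennreal (2 powr p * unit_ball_vol (real CARD('n)) * E * r powr (real CARD('n) + p))"
proof -
  obtain h where h: "h \<in> borel_measurable borel" "AE x in lborel. g x = h x" "has_weak_gradient w h"
    by (rule has_weak_gradient_borel[OF wk w])
  let ?c = "2 powr p * unit_ball_vol (real CARD('n)) * r powr (real CARD('n) + p)"
  have "(\<integral>\<^sup>+x. ennreal (norm (h x) powr p) \<partial>lborel) = (\<integral>\<^sup>+x. ennreal (norm (g x) powr p) \<partial>lborel)"
    by (rule nn_integral_cong_AE) (use h(2) in \<open>auto elim!: eventually_mono\<close>)
  also have "\<dots> \<le> ennreal E" using E by (simp add: nn_integral_completion)
  finally have "ennreal ?c * (\<integral>\<^sup>+x. ennreal (norm (h x) powr p) \<partial>lborel) \<le> ennreal ?c * ennreal E"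
    by (intro mult_left_mono) auto
  also have "\<dots> = ennreal (2 powr p * unit_ball_vol (real CARD('n)) * E * r powr (real CARD('n) + p))"
    using E by (simp add: ennreal_mult'[symmetric] mult_ac)
  finally show ?thesis
    using oscillation_gradient[OF h(3) w h(1) p r] by (rule order_trans[rotated])
qed

lemma weak_gradient_of_finite_energy:
  fixes u u' :: "real ^ 'n \<Rightarrow> real"
  assumes fin: "gradient_pow p u < \<infinity>" and u': "u' \<in> borel_measurable borel"
    and eq: "AE x in lebesgue. u x = u' x"
  shows "has_weak_gradient u (weak_gradient u)" "has_weak_gradient u' (weak_gradient u)"
    and "(\<integral>\<^sup>+x. ennreal (norm (weak_gradient u x) powr p) \<partial>lebesgue) < \<infinity>"
proof -
  obtain g where g: "has_weak_gradient u g"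
    using fin by (auto simp: gradient_pow_def split: if_splits)
  then show wg: "has_weak_gradient u (weak_gradient u)"
    using someI[of "has_weak_gradient u" g] by (simp add: weak_gradient_def)
  have "weak_gradient u \<in> borel_measurable lebesgue"
    using wg by (auto simp: has_weak_gradient_def intro: locally_integrable_measurable)
  then show "has_weak_gradient u' (weak_gradient u)"
    by (intro has_weak_gradient_cong_AE[OF wg _ _ eq]) (use u' in \<open>auto intro: measurable_completion\<close>)
  show "(\<integral>\<^sup>+x. ennreal (norm (weak_gradient u x) powr p) \<partial>lebesgue) < \<infinity>"
    using fin g by (auto simp: gradient_pow_def split: if_splits)
qed

text \<open>
  Test the equation with the smooth truncation \<open>w\<close> of \<open>u\<close>. The operator form dominates the energy of
  \<open>w\<close>, the term with weight \<open>|x|\<^bsup>\<beta>\<^esup>\<close> is nonnegative, and \<open>w \<le> u\<close> vanishes outside \<open>{u > k}\<close>. If both parts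
  of the operator are present, the nonlocal one is nonnegative and can be dropped.
\<close>

lemma truncation_energy:
  fixes u :: "real ^ 'n \<Rightarrow> real"
  assumes p: "p > 1" and q: "q > p" and \<gamma>: "0 \<le> \<gamma>" "\<gamma> \<le> 1" and s: "0 < s" "\<gamma> < 1 \<Longrightarrow> s < 1"
    and sol: "weak_solution \<gamma> s p q \<alpha> \<beta> u"
    and f[measurable]: "f \<in> borel_measurable borel" and uf: "AE x in lebesgue. u x = f (norm x)"
    and k: "k > 0" and h: "h > 0" and J: "J \<ge> 0"
      "(\<integral>\<^sup>+x. ennreal (if f (norm x) > k then norm x powr \<alpha> * f (norm x) powr q else 0) \<partial>(lborel :: (real ^ 'n) measure)) \<le> ennreal J"
    and r: "r > 0"
  shows "oscillation p (\<lambda>x :: real ^ 'n. smooth_excess k h (f (norm x))) r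
    \<le> ennreal ((if \<gamma> = 0 then 1 else 2 powr p * unit_ball_vol (real CARD('n)) / \<gamma>) * J
         * r powr (real CARD('n) + (if \<gamma> = 0 then s * p else p)))"
proof -
  let ?u' = "\<lambda>x :: real ^ 'n. f (norm x)" and ?T = "smooth_excess k h"
  define w where "w x = ?T (?u' x)" for x :: "real ^ 'n"
  note [measurable] = smooth_excess_measurable[OF h]
  have wm[measurable]: "w \<in> borel_measurable borel" unfolding w_def by measurable
  have u'm: "?u' \<in> borel_measurable borel" by measurable
  have space: "u \<in> solution_space \<gamma> s p \<beta>" and pos: "AE x in lebesgue. u x > 0"
    and wi: "\<And>v. v \<in> solution_space \<gamma> s p \<beta> \<Longrightarrow> weak_identity \<gamma> s p q \<alpha> \<beta> u v"
    using sol by (auto simp: weak_solution_def)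
  have uL: "u \<in> Lp_weighted p \<beta>" using space by (auto simp: solution_space_def sobolev_rad_def sobolev_def split: if_splits)
  have wL: "w \<in> Lp_weighted p \<beta>"
  proof -
    have "weighted_norm_pow p \<beta> w \<le> weighted_norm_pow p \<beta> u"
      unfolding weighted_norm_pow_def
    proof (rule nn_integral_mono_AE)
      show "AE x in lebesgue. ennreal (norm x powr \<beta> * \<bar>w x\<bar> powr p) \<le> ennreal (norm x powr \<beta> * \<bar>u x\<bar> powr p)"
        using uf
      proof eventually_elim
        case (elim x)
        then show ?case using smooth_excess_abs_le[OF h, of k "u x"] k p
          by (intro ennreal_leI mult_left_mono powr_mono2) (auto simp: w_def)
      qed
    qed
    then show ?thesis using uL wm by (auto simp: Lp_weighted_def measurable_completion)
  qed
  have wrad: "radial w"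
    unfolding radial_def by (intro bexI[of _ "\<lambda>t. ?T (f t)"]) (auto simp: w_def)
  have pairs: "AE z in (lebesgue :: ((real ^ 'n) \<times> (real ^ 'n)) measure). u (fst z) = ?u' (fst z) \<and> u (snd z) = ?u' (snd z)"
    by (rule AE_lebesgue_pair[OF uf])
  have nonlocal: "AE z in (lebesgue :: ((real ^ 'n) \<times> (real ^ 'n)) measure).
      \<bar>w (fst z) - w (snd z)\<bar> powr p / norm (fst z - snd z) powr (real CARD('n) + s * p) \<le> nonlocal_density s p u w z"
    using pairs
  proof eventually_elim
    case (elim z)
    then show ?case
      using smooth_excess_nonlocal_bound(1)[OF h p, of k "u (fst z)" "u (snd z)"]
      by (auto simp: nonlocal_density_def w_def case_prod_beta intro!: divide_right_mono)
  qed
  have nonlocal_nonneg: "AE z in (lebesgue :: ((real ^ 'n) \<times> (real ^ 'n)) measure). 0 \<le> nonlocal_density s p u w z"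
    using nonlocal by eventually_elim (auto intro: order_trans[rotated])
  have rhs_ineq: "operator_form \<gamma> s p u w \<le> J" if "weak_identity \<gamma> s p q \<alpha> \<beta> u w"
  proof -
    have "(LINT x|lebesgue. norm x powr \<beta> * Phi p (u x) * w x) \<ge> 0"
      by (rule integral_nonneg_AE)
        (use pos in \<open>eventually_elim, auto simp: Phi_def w_def intro!: mult_nonneg_nonneg smooth_excess_nonneg[OF h]\<close>)
    moreover have "(LINT x|lebesgue. norm x powr \<alpha> * Phi q (u x) * w x) \<le> J"
    proof (rule ennreal_integral_le)
      show "integrable lebesgue (\<lambda>x. norm x powr \<alpha> * Phi q (u x) * w x)"
        using that by (simp add: weak_identity_def)
      show "AE x in lebesgue. 0 \<le> norm x powr \<alpha> * Phi q (u x) * w x"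
        using pos by eventually_elim (auto simp: Phi_def w_def intro!: mult_nonneg_nonneg smooth_excess_nonneg[OF h])
      have "(\<integral>\<^sup>+x. ennreal (norm x powr \<alpha> * Phi q (u x) * w x) \<partial>lebesgue)
         \<le> (\<integral>\<^sup>+x. ennreal (if f (norm x) > k then norm x powr \<alpha> * f (norm x) powr q else 0) \<partial>(lebesgue :: (real ^ 'n) measure))"
      proof (rule nn_integral_mono_AE)
        show "AE x in lebesgue. ennreal (norm x powr \<alpha> * Phi q (u x) * w x)
          \<le> ennreal (if f (norm x) > k then norm x powr \<alpha> * f (norm x) powr q else 0)"
          using pos uf
        proof eventually_elim
          case (elim x)
          have w0: "0 \<le> w x" "w x \<le> max 0 (u x - k)"
            using smooth_excess_nonneg[OF h, of k] smooth_excess_upper[OF h, of k "u x"] elim by (auto simp: w_def)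
          have "Phi q (u x) * w x \<le> u x powr (q - 1) * u x" if "u x > k"
          proof -
            have "Phi q (u x) = u x powr (q - 1)"
              using elim by (simp add: Phi_def powr_diff power2_eq_square)
            moreover have "w x \<le> u x" using w0 k that by simp
            ultimately show ?thesis by (simp add: mult_left_mono)
          qed
          moreover have "u x powr (q - 1) * u x = u x powr q"
            using elim by (simp add: powr_diff)
          moreover have "w x = 0" if "\<not> u x > k" using w0 that by simp
          ultimately show ?case
            using elim by (auto simp: mult.assoc intro!: ennreal_leI mult_left_mono)
        qed
      qed
      also have "\<dots> \<le> ennreal J" using J by (simp add: nn_integral_completion)
      finally show "(\<integral>\<^sup>+x. ennreal (norm x powr \<alpha> * Phi q (u x) * w x) \<partial>lebesgue) \<le> ennreal J" .
    qed fact
    ultimately show ?thesis using that by (simp add: weak_identity_def)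
  qed
  show ?thesis
  proof (cases "\<gamma> = 0")
    case True
    then have s1: "s \<noteq> 1" using s by simp
    have "gagliardo_pow s p w \<le> gagliardo_pow s p u"
      unfolding gagliardo_pow_def
    proof (rule nn_integral_mono_AE)
      show "AE z in lebesgue. (case z of (x, y) \<Rightarrow> ennreal (\<bar>w x - w y\<bar> powr p / norm (x - y) powr (real CARD('n) + s * p)))
        \<le> (case z of (x, y) \<Rightarrow> ennreal (\<bar>u x - u y\<bar> powr p / norm (x - y) powr (real CARD('n) + s * p)))"
        using pairs
      proof eventually_elim
        case (elim z)
        then show ?case
          using smooth_excess_nonlocal_bound(2)[OF h p, of k "u (fst z)" "u (snd z)"] p
          by (auto simp: w_def case_prod_beta intro!: ennreal_leI divide_right_mono powr_mono2)
      qed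
    qed
    also have "\<dots> < \<infinity>"
      using space True s1 by (simp add: solution_space_def sobolev_rad_def sobolev_def seminorm_pow_def)
    finally have "w \<in> solution_space \<gamma> s p \<beta>"
      using True s1 wL wrad by (simp add: solution_space_def sobolev_rad_def sobolev_def seminorm_pow_def)
    from wi[OF this] have id: "weak_identity \<gamma> s p q \<alpha> \<beta> u w" .
    have int: "integrable lebesgue (nonlocal_density s p u w)" using id True by (simp add: weak_identity_def)
    have "gagliardo_pow s p w \<le> (\<integral>\<^sup>+z. ennreal (nonlocal_density s p u w z) \<partial>lebesgue)"
      unfolding gagliardo_pow_def
      by (rule nn_integral_mono_AE) (use nonlocal in \<open>eventually_elim, auto simp: case_prod_beta intro!: ennreal_leI\<close>)
    also have "\<dots> = ennreal (LINT z|lebesgue. nonlocal_density s p u w z)"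
      by (rule nn_integral_eq_integral[OF int nonlocal_nonneg])
    also have "\<dots> \<le> ennreal J"
      using rhs_ineq[OF id] True by (intro ennreal_leI) (simp add: operator_form_def)
    finally have "gagliardo_pow s p w \<le> ennreal J" .
    then have "ennreal (r powr (real CARD('n) + s * p)) * gagliardo_pow s p w \<le> ennreal (r powr (real CARD('n) + s * p)) * ennreal J"
      by (intro mult_left_mono) auto
    then have "oscillation p w r \<le> ennreal (r powr (real CARD('n) + s * p)) * ennreal J"
      using oscillation_gagliardo[OF wm r s(1) p] by (rule order_trans[rotated])
    then show ?thesis using True J by (simp add: w_def[abs_def] ennreal_mult'[symmetric] mult.commute)
  next
    case False
    then have \<gamma>0: "\<gamma> > 0" using \<gamma> by simp
    have gfin: "gradient_pow p u < \<infinity>"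
      using space False by (simp add: solution_space_def sobolev_rad_def sobolev_def seminorm_pow_def)
    note wg = weak_gradient_of_finite_energy(1)[OF gfin u'm uf] and wg' = weak_gradient_of_finite_energy(2)[OF gfin u'm uf]
    note chain = weak_gradient_chain[OF wg' u'm smooth_excess_derivative[OF h, of k] smooth_excess'_continuous[OF h]]
    have T': "\<bar>smooth_excess' k h y\<bar> \<le> 1" for y using smooth_excess'_bounds[OF h, of k y] by simp
    have hw: "has_weak_gradient w (weak_gradient w)"
      using chain(1)[OF smooth_excess_abs_le[OF h] T'] k by (simp add: w_def[abs_def])
    have "AE x in lborel. weak_gradient w x = smooth_excess' k h (?u' x) *\<^sub>R weak_gradient ?u' x"
      using chain(2)[OF smooth_excess_abs_le[OF h] T'] k by (simp add: w_def[abs_def])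
    then have "AE x in lborel. weak_gradient w x = smooth_excess' k h (?u' x) *\<^sub>R weak_gradient u x"
      using weak_gradient_AE(2)[OF wg' u'm] by eventually_elim simp
    then have gw: "AE x in lebesgue. weak_gradient w x = smooth_excess' k h (?u' x) *\<^sub>R weak_gradient u x"
      by (rule AE_completion)
    have "gradient_pow p w \<le> gradient_pow p u"
    proof -
      have "(\<integral>\<^sup>+x. ennreal (norm (weak_gradient w x) powr p) \<partial>lebesgue) \<le> (\<integral>\<^sup>+x. ennreal (norm (weak_gradient u x) powr p) \<partial>lebesgue)"
      proof (rule nn_integral_mono_AE)
        show "AE x in lebesgue. ennreal (norm (weak_gradient w x) powr p) \<le> ennreal (norm (weak_gradient u x) powr p)"
          using gw
        proof eventually_elim
          case (elim x)
          then show ?case using T' p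
            by (intro ennreal_leI powr_mono2) (auto intro!: mult_left_le_one_le)
        qed
      qed
      then show ?thesis using wg hw by (auto simp: gradient_pow_def)
    qed
    then have "w \<in> solution_space \<gamma> s p \<beta>"
      using gfin False wL wrad by (simp add: solution_space_def sobolev_rad_def sobolev_def seminorm_pow_def)
    from wi[OF this] have id: "weak_identity \<gamma> s p q \<alpha> \<beta> u w" .
    have int: "integrable lebesgue (local_density p u w)" using id False by (simp add: weak_identity_def)
    have loc: "AE x in lebesgue. norm (weak_gradient w x) powr p \<le> local_density p u w x"
      using gw
    proof eventually_elim
      case (elim x)
      then show ?case
        using Phi_scaled_bound[OF smooth_excess'_bounds[OF h, of k "?u' x"] p, of "weak_gradient u x"]
        by (simp add: local_density_def)
    qed
    have loc_nonneg: "AE x in lebesgue. 0 \<le> local_density p u w x"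
      using loc by eventually_elim (auto intro: order_trans[rotated])
    have "(LINT z|lebesgue. nonlocal_density s p u w z) \<ge> 0"
      by (rule integral_nonneg_AE[OF nonlocal_nonneg])
    then have "(if \<gamma> = 1 then 0 else (1 - \<gamma>) * (LINT z|lebesgue. nonlocal_density s p u w z)) \<ge> 0"
      using \<gamma> by simp
    then have "\<gamma> * (LINT x|lebesgue. local_density p u w x) \<le> J"
      using rhs_ineq[OF id] False by (simp add: operator_form_def)
    then have L: "(LINT x|lebesgue. local_density p u w x) \<le> J / \<gamma>"
      using \<gamma>0 by (simp add: field_simps)
    have "(\<integral>\<^sup>+x. ennreal (norm (weak_gradient w x) powr p) \<partial>lebesgue) \<le> (\<integral>\<^sup>+x. ennreal (local_density p u w x) \<partial>lebesgue)"
      by (rule nn_integral_mono_AE) (use loc in \<open>eventually_elim, auto intro!: ennreal_leI\<close>)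
    also have "\<dots> = ennreal (LINT x|lebesgue. local_density p u w x)"
      by (rule nn_integral_eq_integral[OF int loc_nonneg])
    also have "\<dots> \<le> ennreal (J / \<gamma>)" by (intro ennreal_leI L)
    finally have "oscillation p w r \<le> ennreal (2 powr p * unit_ball_vol (real CARD('n)) * (J / \<gamma>) * r powr (real CARD('n) + p))"
      using J \<gamma>0 by (intro oscillation_weak_gradient[OF hw wm p r]) auto
    then show ?thesis using False by (simp add: w_def[abs_def] mult_ac)
  qed
qed

lemma solution_energy_finite:
  fixes u :: "real ^ 'n \<Rightarrow> real"
  assumes p: "p > 1" and s: "0 < s" "\<gamma> = 0 \<Longrightarrow> s < 1"
    and space: "u \<in> solution_space \<gamma> s p \<beta>"
    and f[measurable]: "f \<in> borel_measurable borel" and uf: "AE x in lebesgue. u x = f (norm x)"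
  shows "\<exists>K>0. \<forall>r>0. oscillation p (\<lambda>x :: real ^ 'n. f (norm x)) r
    \<le> ennreal (K * r powr (real CARD('n) + (if \<gamma> = 0 then s * p else p)))"
proof (cases "\<gamma> = 0")
  case True
  let ?u' = "\<lambda>x :: real ^ 'n. f (norm x)"
  have "gagliardo_pow s p ?u' = gagliardo_pow s p u"
    unfolding gagliardo_pow_def
    by (rule nn_integral_cong_AE) (use AE_lebesgue_pair[OF uf] in \<open>eventually_elim, auto simp: case_prod_beta\<close>)
  also have "\<dots> < \<infinity>"
    using space True s by (simp add: solution_space_def sobolev_rad_def sobolev_def seminorm_pow_def)
  finally obtain E where E: "gagliardo_pow s p ?u' = ennreal E" "E \<ge> 0"
    by (cases "gagliardo_pow s p ?u'") auto
  have "oscillation p ?u' r \<le> ennreal ((E + 1) * r powr (real CARD('n) + s * p))" if "r > 0" for r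
  proof -
    have "oscillation p ?u' r \<le> ennreal (r powr (real CARD('n) + s * p)) * ennreal E"
      using oscillation_gagliardo[of ?u' r s p] that s p E by simp
    also have "\<dots> \<le> ennreal ((E + 1) * r powr (real CARD('n) + s * p))"
      using E by (simp add: ennreal_mult'[symmetric] algebra_simps ennreal_leI)
    finally show ?thesis .
  qed
  then show ?thesis using E True by (intro exI[of _ "E + 1"]) auto
next
  case False
  let ?u' = "\<lambda>x :: real ^ 'n. f (norm x)"
  have u'm: "?u' \<in> borel_measurable borel" by measurable
  have gfin: "gradient_pow p u < \<infinity>"
    using space False by (simp add: solution_space_def sobolev_rad_def sobolev_def seminorm_pow_def)
  note wg' = weak_gradient_of_finite_energy(2)[OF gfin u'm uf]
  have "(\<integral>\<^sup>+x. ennreal (norm (weak_gradient u x) powr p) \<partial>lebesgue) < \<infinity>"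
    by (rule weak_gradient_of_finite_energy(3)[OF gfin u'm uf])
  then obtain E where E: "(\<integral>\<^sup>+x. ennreal (norm (weak_gradient u x) powr p) \<partial>lebesgue) = ennreal E" "E \<ge> 0"
    by (cases "\<integral>\<^sup>+x. ennreal (norm (weak_gradient u x) powr p) \<partial>lebesgue") auto
  let ?c = "2 powr p * unit_ball_vol (real CARD('n))"
  have "oscillation p ?u' r \<le> ennreal ((?c * E + 1) * r powr (real CARD('n) + p))" if "r > 0" for r
  proof -
    have "oscillation p ?u' r \<le> ennreal (?c * E * r powr (real CARD('n) + p))"
      by (rule oscillation_weak_gradient[OF wg' u'm p that]) (use E in auto)
    also have "\<dots> \<le> ennreal ((?c * E + 1) * r powr (real CARD('n) + p))"
      by (intro ennreal_leI mult_right_mono) auto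
    finally show ?thesis .
  qed
  moreover have "?c * E + 1 > 0" using E by (intro add_nonneg_pos mult_nonneg_nonneg) auto
  ultimately show ?thesis using False by (intro exI[of _ "?c * E + 1"]) auto
qed

section \<open>Boundedness of solutions\<close>

theorem theorem1p2:
  fixes p q s \<alpha> \<beta> \<gamma> N :: real
    and u :: "real ^ 'n \<Rightarrow> real"
  defines "N \<equiv> real CARD('n)"
  assumes "p > 1" and "\<beta> > 0"
    and "0 \<le> \<gamma>" and "\<gamma> \<le> 1"
    and "0 < s" and "s \<le> 1"
    and "\<gamma> < 1 \<Longrightarrow> s < 1" and "\<gamma> = 1 \<Longrightarrow> s = 1"
    and "1 / p < s" and "s < N / p"
    and "\<gamma> > 0 \<Longrightarrow> N > p"
    and "\<alpha> > - s * p"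
    and "p < q" and "q < critical_exponent N p \<gamma> s \<alpha>"
    and "\<alpha> - \<beta> + (q - p) * ((1 - N) / p) < 0"
    and "weak_solution \<gamma> s p q \<alpha> \<beta> u"
  shows "\<exists>C>0. Linfty_norm u \<le> ereal C"
proof -
  note p = \<open>p > 1\<close> and q = \<open>p < q\<close> and sol = \<open>weak_solution \<gamma> s p q \<alpha> \<beta> u\<close>
  define e where "e = (if \<gamma> = 0 then s * p else p)"
  have e: "e > 1" "e < N"
    using assms by (auto simp: e_def field_simps)
  have crit: "critical_exponent N p \<gamma> s \<alpha> = p * (N + \<alpha>) / (N - e)"
    by (simp add: critical_exponent_def e_def)
  define a where "a = (N - e) / p"
  have a: "a > 0" using e p by (simp add: a_def)
  define \<epsilon> where "\<epsilon> = N + \<alpha> - a * q"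
  have \<epsilon>: "\<epsilon> > 0"
  proof -
    have "q < p * (N + \<alpha>) / (N - e)" using assms(15) by (simp add: crit)
    then have "q * (N - e) < p * (N + \<alpha>)" using e by (simp add: pos_less_divide_eq)
    then show ?thesis using p by (simp add: \<epsilon>_def a_def field_simps)
  qed
  have space: "u \<in> solution_space \<gamma> s p \<beta>" and pos: "AE x in lebesgue. u x > 0"
    using sol by (auto simp: weak_solution_def)
  have "radial u" using space by (auto simp: solution_space_def sobolev_rad_def split: if_splits)
  then obtain f where f[measurable]: "f \<in> borel_measurable borel" and uf: "AE x in lebesgue. u x = f (norm x)"
    by (auto simp: radial_def)
  obtain C where C: "C > 0" and bound: "\<And>g K. g \<in> borel_measurable borel \<Longrightarrow> K \<ge> 0 \<Longrightarrow>
     (\<And>r. r > 0 \<Longrightarrow> oscillation p (\<lambda>x :: real ^ 'n. g (norm x)) r \<le> ennreal (K * r powr (N + e))) \<Longrightarrow>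
     (\<integral>\<^sup>+x. ennreal (norm x powr \<beta> * \<bar>g (norm x)\<bar> powr p) \<partial>(lborel :: (real ^ 'n) measure)) < \<infinity> \<Longrightarrow>
     AE x in (lborel :: (real ^ 'n) measure). \<bar>g (norm x)\<bar> \<le> C * K powr (1 / p) * norm x powr (- a)"
    using radial_pointwise_bound[where 'n='n, OF p e(1) _ \<open>\<beta> > 0\<close>] e(2) unfolding N_def a_def by blast
  have fin: "(\<integral>\<^sup>+x. ennreal (norm x powr \<beta> * \<bar>f (norm x)\<bar> powr p) \<partial>(lborel :: (real ^ 'n) measure)) < \<infinity>"
  proof -
    have "(\<integral>\<^sup>+x. ennreal (norm x powr \<beta> * \<bar>f (norm x)\<bar> powr p) \<partial>(lebesgue :: (real ^ 'n) measure)) = weighted_norm_pow p \<beta> u"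
      unfolding weighted_norm_pow_def
      by (rule nn_integral_cong_AE) (use uf in \<open>eventually_elim, simp\<close>)
    also have "\<dots> < \<infinity>"
      using space by (auto simp: solution_space_def sobolev_rad_def sobolev_def Lp_weighted_def split: if_splits)
    finally show ?thesis by (simp add: nn_integral_completion)
  qed
  obtain K0 where K0: "K0 > 0" "\<And>r. r > 0 \<Longrightarrow> oscillation p (\<lambda>x :: real ^ 'n. f (norm x)) r \<le> ennreal (K0 * r powr (N + e))"
    using solution_energy_finite[OF p \<open>0 < s\<close> _ space f uf] assms(8) unfolding e_def N_def by auto
  define Ce where "Ce = (if \<gamma> = 0 then 1 else 2 powr p * unit_ball_vol N / \<gamma>)"
  have Ce: "Ce > 0"
  proof -
    have "unit_ball_vol N > 0" by (rule unit_ball_vol_pos) (simp add: N_def)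
    then show ?thesis using \<open>0 \<le> \<gamma>\<close> by (auto simp: Ce_def)
  qed
  have "\<exists>d>0. AE x in (lborel :: (real ^ 'n) measure). f (norm x) \<le> d"
  proof (rule bounded_of_level_set_estimate[OF _ p q a \<epsilon>])
    show "\<alpha> - a * q = \<epsilon> - real CARD('n)" by (simp add: \<epsilon>_def N_def)
    show "0 < C * K0 powr (1 / p)" "0 < C * Ce powr (1 / p)" using C K0 Ce by auto
    show "AE x in (lborel :: (real ^ 'n) measure). \<bar>f (norm x)\<bar> \<le> C * K0 powr (1 / p) * norm x powr (- a)"
      by (rule bound) (use K0 fin in auto)
    fix k J :: real
    assume k: "k > 0" and J: "J \<ge> 0"
      "(\<integral>\<^sup>+x. ennreal (if f (norm x) > k then norm x powr \<alpha> * f (norm x) powr q else 0) \<partial>(lborel :: (real ^ 'n) measure)) \<le> ennreal J"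
    \<comment> \<open>the smoothing parameter tends to \<open>0\<close> at fixed \<open>k\<close> and \<open>J\<close>\<close>
    have "AE x in (lborel :: (real ^ 'n) measure). \<bar>smooth_excess k (1 / real (Suc n)) (f (norm x))\<bar> \<le> C * (Ce * J) powr (1 / p) * norm x powr (- a)" for n
    proof (rule bound)
      let ?h = "1 / real (Suc n)"
      have h: "?h > 0" by simp
      note [measurable] = smooth_excess_measurable[OF h, of k]
      show "(\<lambda>t. smooth_excess k ?h (f t)) \<in> borel_measurable borel" by measurable
      show "0 \<le> Ce * J" using Ce J by simp
      show "oscillation p (\<lambda>x :: real ^ 'n. smooth_excess k ?h (f (norm x))) r \<le> ennreal (Ce * J * r powr (N + e))" if "r > 0" for r
        unfolding Ce_def N_def e_def
        by (rule truncation_energy[OF p q _ _ _ _ sol f uf k h J that]) (use assms in auto)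
      have "(\<integral>\<^sup>+x. ennreal (norm x powr \<beta> * \<bar>smooth_excess k ?h (f (norm x))\<bar> powr p) \<partial>(lborel :: (real ^ 'n) measure))
        \<le> (\<integral>\<^sup>+x. ennreal (norm x powr \<beta> * \<bar>f (norm x)\<bar> powr p) \<partial>(lborel :: (real ^ 'n) measure))"
        using smooth_excess_abs_le[OF h, of k] k p by (intro nn_integral_mono ennreal_leI mult_left_mono powr_mono2) auto
      then show "(\<integral>\<^sup>+x. ennreal (norm x powr \<beta> * \<bar>smooth_excess k ?h (f (norm x))\<bar> powr p) \<partial>(lborel :: (real ^ 'n) measure)) < \<infinity>"
        using fin by (rule order_le_less_trans)
    qed
    then have "AE x in (lborel :: (real ^ 'n) measure). \<forall>n. \<bar>smooth_excess k (1 / real (Suc n)) (f (norm x))\<bar> \<le> C * (Ce * J) powr (1 / p) * norm x powr (- a)"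
      by (subst AE_all_countable) blast
    then show "AE x in (lborel :: (real ^ 'n) measure). f (norm x) - k \<le> C * Ce powr (1 / p) * J powr (1 / p) * norm x powr (- a)"
    proof eventually_elim
      case (elim x)
      have "f (norm x) - k \<le> C * (Ce * J) powr (1 / p) * norm x powr (- a) + 1 / real (Suc n)" for n
        using elim[rule_format, of n] smooth_excess_lower[of "1 / real (Suc n)" "f (norm x)" k] by simp
      moreover have "(\<lambda>n. C * (Ce * J) powr (1 / p) * norm x powr (- a) + 1 / real (Suc n)) \<longlonglongrightarrow> C * (Ce * J) powr (1 / p) * norm x powr (- a) + 0"
        by (intro tendsto_intros LIMSEQ_Suc[OF lim_1_over_n])
      ultimately have "f (norm x) - k \<le> C * (Ce * J) powr (1 / p) * norm x powr (- a) + 0"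
        by (intro LIMSEQ_le_const) auto
      then show ?case using Ce J by (simp add: powr_mult mult.assoc)
    qed
  qed measurable
  then obtain d where d: "d > 0" "AE x in (lborel :: (real ^ 'n) measure). f (norm x) \<le> d" by blast
  have um: "u \<in> borel_measurable lebesgue"
    using space by (auto simp: solution_space_def sobolev_rad_def sobolev_def Lp_weighted_def split: if_splits)
  have "AE x in lebesgue. ereal \<bar>u x\<bar> \<le> ereal d"
    using AE_completion[OF d(2)] uf pos by eventually_elim simp
  then have "Linfty_norm u \<le> ereal d"
    unfolding Linfty_norm_def using um by (intro esssup_I) auto
  then show ?thesis using d(1) by blast
qed

end
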